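(* Let $\varphi:\mathbb{R}^m\to\mathbb{R}^{m'}$ be a $1$-periodic Lipschitz function which satisfies the geometric-stability property, satisfies the controlled-length condition, and has non-degenerate levels. Let $\delta=\delta_\varepsilon>0$ satisfy $\delta_\varepsilon\to 0$ and $\delta_\varepsilon/\varepsilon\to+\infty$ as $\varepsilon\to0$, and let $F_\varepsilon:L^2([0,1];\mathbb{R}^m)\to[0,+\infty]$ be defined by $$F_\varepsilon(u)=\int_0^1\Bigl(|u'|^2+\Bigl(\frac{\delta}{\varepsilon}\Bigr)^2\Bigl|\nabla\varphi\Bigl(\frac{u}{\varepsilon}\Bigr)u'\Bigr|^2\Bigr)\,dt\quad\text{if }u\in H^1([0,1];\mathbb{R}^m),\qquad F_\varepsilon(u)=+\infty\ \text{otherwise}.$$ Then, for any $u\in L^2([0,1];\mathbb{R}^m)$, $$\Gamma\text{-}\lim_{\varepsilon\to0}F_\varepsilon(u)=F(u)=\begin{cases}\displaystyle\int_0^1\psi_{\rm hom}(u')\,dt & \text{if }u\in H^1([0,1];\mathbb{R}^m),\\ +\infty&\text{otherwise,}\end{cases}$$ where the $\Gamma$-limit is taken with respect to the strong topology of $L^2([0,1];\mathbb{R}^m)$, and $$\psi_{\rm hom}=\Bigl(\min_{z\in{\rm Im}(\varphi)}\psi^z_{\rm hom}\Bigr)^{**},\qquad \psi^z_{\rm hom}(w)=\lim_{T\to+\infty}\psi^z_T(w).$$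
   Context: Here $m,m'\ge1$ are integers; $\varphi$ is $1$-periodic if $\varphi(x+k)=\varphi(x)$ for all $x\in\mathbb{R}^m$, $k\in\mathbb{Z}^m$. For $u\in H^1$ the quantity $\frac1\varepsilon\nabla\varphi(u/\varepsilon)u'$ is understood as the a.e. derivative $\frac{d}{dt}\bigl(\varphi(u(t)/\varepsilon)\bigr)$. For $z\in{\rm Im}(\varphi)$ let $L^z_\varphi=\{x\in\mathbb{R}^m:\varphi(x)=z\}$. The symbol $^{**}$ denotes the convex envelope (largest convex function below). For $w\in\mathbb{R}^m$, $z\in{\rm Im}(\varphi)$, $c>0$, $T>0$, define (with $u$ ranging over $H^1([0,T];\mathbb{R}^m)$) $$\psi^{z,c}_T(w)=\frac1T\min\Bigl\{\int_0^T|u'|^2dt:\ |\varphi(u(t))-z|\le c\ \forall t,\ |u(0)|\le\sqrt m,\ |u(T)-Tw|\le\sqrt m\Bigr\},$$ $$\psi^{z}_T(w)=\frac1T\min\Bigl\{\int_0^T|u'|^2dt:\ \varphi(u(t))=z\ \forall t,\ |u(0)|\le\sqrt m,\ |u(T)-Tw|\le\sqrt m\Bigr\},$$ each set equal to $+\infty$ if there is no admissible $u$. Under the hypotheses below, the limit $\psi^z_{\rm hom}(w)=\lim_{T\to+\infty}\psi^z_T(w)$ exists in $[0,+\infty]$. Geometric-stability property: there exists a continuous function $\omega(c)$ with $\omega(c)\to0$ as $c\to0$, and numbers $k(c)\in\mathbb{R}$ depending only on $c$ (in particular independent of $z$), such that for any $c>0$, $T>0$, $w\in\mathbb{R}^m$,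 $z\in{\rm Im}(\varphi)$, either $\psi^{z,c}_T(w)=+\infty$, or $$\psi^{z,c}_T(w)\ge(1-\omega(c))\,\psi^{z'}_T(w')-\frac{k(c)}{T}$$ for suitable $z'\in{\rm Im}(\varphi)$ and $w'\in\mathbb{R}^m$ with $|z-z'|\le c$ and $|w-w'|\le\sqrt m/T$. Controlled-length condition: for all $z\in{\rm Im}(\varphi)$ such that $L^z_\varphi$ is connected, there exists a constant $C\in\mathbb{R}$ such that for any $x,y\in L^z_\varphi$ there is a path $\gamma\in H^1([0,1];\mathbb{R}^m)$ with $\gamma(0)=x$, $\gamma(1)=y$, $\varphi(\gamma(t))=z$ for all $t$, and $\int_0^1|\gamma'(t)|\,dt\le C|x-y|$. Non-degenerate levels: for any $z\in{\rm Im}(\varphi)$ one of the following holds: (i) $L^z_\varphi$ is composed of a unique unbounded connected component (i.e. $L^z_\varphi$ is connected and unbounded); (ii) $L^z_\varphi$ contains no unbounded connected components; and there exists at least one $z$ for which (i) holds. *)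

theory Defs
  imports "HOL-Analysis.Analysis"
begin

definition L2 :: "real \<Rightarrow> (real \<Rightarrow> 'a::euclidean_space) set" where
  "L2 T = {u \<in> borel_measurable (lebesgue_on {0..T}).
             integrable (lebesgue_on {0..T}) (\<lambda>t. (norm (u t))\<^sup>2)}"

definition test_function :: "real \<Rightarrow> (real \<Rightarrow> real) \<Rightarrow> bool" where
  "test_function T \<eta> \<longleftrightarrow> \<eta> C1_differentiable_on UNIV \<and>
     (\<exists>a b. 0 < a \<and> b < T \<and> (\<forall>t. t \<notin> {a..b} \<longrightarrow> \<eta> t = 0))"

definition has_weak_deriv ::
    "real \<Rightarrow> (real \<Rightarrow> 'a::euclidean_space) \<Rightarrow> (real \<Rightarrow> 'a) \<Rightarrow> bool" where
  "has_weak_deriv T u v \<longleftrightarrow> (\<forall>\<eta>. test_function T \<eta> \<longrightarrow>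
     (LINT t|lebesgue_on {0..T}. deriv \<eta> t *\<^sub>R u t) =
       - (LINT t|lebesgue_on {0..T}. \<eta> t *\<^sub>R v t))"

text \<open>Elements of \<open>L2\<close> and \<open>H1\<close> are representatives: both notions are invariant under
  changes on null sets. Where pointwise values matter, the continuous representative is used,
  which is what \<open>H1_path\<close> and \<open>cont_rep\<close> are for.\<close>

definition H1 :: "real \<Rightarrow> (real \<Rightarrow> 'a::euclidean_space) set" where
  "H1 T = {u \<in> L2 T. \<exists>v \<in> L2 T. has_weak_deriv T u v}"

definition weak_deriv ::
    "real \<Rightarrow> (real \<Rightarrow> 'a::euclidean_space) \<Rightarrow> real \<Rightarrow> 'a" where
  "weak_deriv T u = (SOME v. v \<in> L2 T \<and> has_weak_deriv T u v)"

definition H1_path :: "real \<Rightarrow> (real \<Rightarrow> 'a::euclidean_space) set" where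
  "H1_path T = {u \<in> H1 T. continuous_on {0..T} u}"

definition cont_rep ::
    "real \<Rightarrow> (real \<Rightarrow> 'a::euclidean_space) \<Rightarrow> real \<Rightarrow> 'a" where
  "cont_rep T u =
     (SOME w. continuous_on {0..T} w \<and> (AE t in lebesgue_on {0..T}. w t = u t))"

definition dirichlet_energy :: "real \<Rightarrow> (real \<Rightarrow> 'a::euclidean_space) \<Rightarrow> ennreal" where
  "dirichlet_energy T u =
     (\<integral>\<^sup>+ t. ennreal ((norm (weak_deriv T u t))\<^sup>2) \<partial>lebesgue_on {0..T})"

definition L2_tendsto ::
    "real \<Rightarrow> (nat \<Rightarrow> real \<Rightarrow> 'a::euclidean_space) \<Rightarrow> (real \<Rightarrow> 'a) \<Rightarrow> bool" where
  "L2_tendsto T us u \<longleftrightarrow>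
     (\<lambda>j. \<integral>\<^sup>+ t. ennreal ((norm (us j t - u t))\<^sup>2) \<partial>lebesgue_on {0..T}) \<longlonglongrightarrow> 0"

text \<open>The family indexed by the continuous parameter \<open>\<epsilon> \<rightarrow> 0\<close> has Gamma-limit \<open>l\<close> at \<open>u\<close> if every
  sequence \<open>\<epsilon>\<^sub>j \<rightarrow> 0\<close> of positive numbers satisfies the liminf inequality and
  admits a recovery sequence.\<close>

definition has_gamma_limit_at ::
    "(real \<Rightarrow> (real \<Rightarrow> 'a::euclidean_space) \<Rightarrow> ennreal) \<Rightarrow> (real \<Rightarrow> 'a) \<Rightarrow> ennreal \<Rightarrow> bool" where
  "has_gamma_limit_at F u l \<longleftrightarrow>
     (\<forall>e. (\<forall>j. e j > 0) \<and> e \<longlonglongrightarrow> 0 \<longrightarrow>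
        (\<forall>us. (\<forall>j. us j \<in> L2 1) \<and> L2_tendsto 1 us u \<longrightarrow>
            l \<le> liminf (\<lambda>j. F (e j) (us j))) \<and>
        (\<exists>us. (\<forall>j. us j \<in> L2 1) \<and> L2_tendsto 1 us u \<and>
            limsup (\<lambda>j. F (e j) (us j)) \<le> l))"

definition ext_convex :: "('a::real_vector \<Rightarrow> ennreal) \<Rightarrow> bool" where
  "ext_convex g \<longleftrightarrow> (\<forall>x y. \<forall>s\<in>{0..1}.
     g ((1 - s) *\<^sub>R x + s *\<^sub>R y) \<le> ennreal (1 - s) * g x + ennreal s * g y)"

definition convex_envelope :: "('a::real_vector \<Rightarrow> ennreal) \<Rightarrow> 'a \<Rightarrow> ennreal" where
  "convex_envelope f x = (SUP g \<in> {g. ext_convex g \<and> (\<forall>y. g y \<le> f y)}. g x)"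

definition one_periodic :: "(real^'m \<Rightarrow> 'b) \<Rightarrow> bool" where
  "one_periodic \<phi> \<longleftrightarrow> (\<forall>x k. (\<forall>i. k $ i \<in> \<int>) \<longrightarrow> \<phi> (x + k) = \<phi> x)"

definition level_set :: "('a \<Rightarrow> 'b) \<Rightarrow> 'b \<Rightarrow> 'a set" where
  "level_set \<phi> z = {x. \<phi> x = z}"

text \<open>In both cell problems an infimum over the empty set is \<open>\<infinity>\<close>.\<close>

definition psi_cz ::
    "(real^'m \<Rightarrow> real^'n) \<Rightarrow> real^'n \<Rightarrow> real \<Rightarrow> real \<Rightarrow> real^'m \<Rightarrow> ennreal" where
  "psi_cz \<phi> z c T w = ennreal (1 / T) *
     (INF u \<in> {u \<in> H1_path T. (\<forall>t\<in>{0..T}. norm (\<phi> (u t) - z) \<le> c) \<and>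
                 norm (u 0) \<le> sqrt (real CARD('m)) \<and>
                 norm (u T - T *\<^sub>R w) \<le> sqrt (real CARD('m))}.
        dirichlet_energy T u)"

definition psi_z ::
    "(real^'m \<Rightarrow> real^'n) \<Rightarrow> real^'n \<Rightarrow> real \<Rightarrow> real^'m \<Rightarrow> ennreal" where
  "psi_z \<phi> z T w = ennreal (1 / T) *
     (INF u \<in> {u \<in> H1_path T. (\<forall>t\<in>{0..T}. \<phi> (u t) = z) \<and>
                 norm (u 0) \<le> sqrt (real CARD('m)) \<and>
                 norm (u T - T *\<^sub>R w) \<le> sqrt (real CARD('m))}.
        dirichlet_energy T u)"

definition psi_hom_z ::
    "(real^'m \<Rightarrow> real^'n) \<Rightarrow> real^'n \<Rightarrow> real^'m \<Rightarrow> ennreal" where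
  "psi_hom_z \<phi> z w = Lim at_top (\<lambda>T. psi_z \<phi> z T w)"

definition psi_hom :: "(real^'m \<Rightarrow> real^'n) \<Rightarrow> real^'m \<Rightarrow> ennreal" where
  "psi_hom \<phi> = convex_envelope (\<lambda>w. INF z \<in> range \<phi>. psi_hom_z \<phi> z w)"

text \<open>The factor \<open>1 - \<omega> c\<close> may be negative for large \<open>c\<close>, hence the inequality lives in
  \<^typ>\<open>ereal\<close>.\<close>

definition geometrically_stable :: "(real^'m \<Rightarrow> real^'n) \<Rightarrow> bool" where
  "geometrically_stable \<phi> \<longleftrightarrow> (\<exists>(\<omega>::real \<Rightarrow> real) (k::real \<Rightarrow> real).
     continuous_on {0<..} \<omega> \<and> (\<omega> \<longlongrightarrow> 0) (at_right 0) \<and>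
     (\<forall>c>0. \<forall>T>0. \<forall>w. \<forall>z\<in>range \<phi>.
        psi_cz \<phi> z c T w = \<infinity> \<or>
        (\<exists>z'\<in>range \<phi>. \<exists>w'. norm (z - z') \<le> c \<and>
            norm (w - w') \<le> sqrt (real CARD('m)) / T \<and>
            enn2ereal (psi_cz \<phi> z c T w) \<ge>
              ereal (1 - \<omega> c) * enn2ereal (psi_z \<phi> z' T w') - ereal (k c / T))))"

definition controlled_length :: "(real^'m \<Rightarrow> real^'n) \<Rightarrow> bool" where
  "controlled_length \<phi> \<longleftrightarrow> (\<forall>z\<in>range \<phi>. connected (level_set \<phi> z) \<longrightarrow>
     (\<exists>C::real. \<forall>x\<in>level_set \<phi> z. \<forall>y\<in>level_set \<phi> z.
        \<exists>\<gamma>\<in>H1_path 1. \<gamma> 0 = x \<and> \<gamma> 1 = y \<and> (\<forall>t\<in>{0..1}. \<phi> (\<gamma> t) = z) \<and>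
          (LINT t|lebesgue_on {0..1}. norm (weak_deriv 1 \<gamma> t)) \<le> C * norm (x - y)))"

definition unbounded_level :: "(real^'m \<Rightarrow> real^'n) \<Rightarrow> real^'n \<Rightarrow> bool" where
  "unbounded_level \<phi> z \<longleftrightarrow> connected (level_set \<phi> z) \<and> \<not> bounded (level_set \<phi> z)"

definition nondegenerate_levels :: "(real^'m \<Rightarrow> real^'n) \<Rightarrow> bool" where
  "nondegenerate_levels \<phi> \<longleftrightarrow>
     (\<forall>z\<in>range \<phi>. unbounded_level \<phi> z \<or> (\<forall>K\<in>components (level_set \<phi> z). bounded K)) \<and>
     (\<exists>z\<in>range \<phi>. unbounded_level \<phi> z)"

text \<open>The a.e. derivative of \<open>\<phi> (u / \<epsilon>)\<close> stands for \<open>(1 / \<epsilon>) \<nabla>\<phi> (u / \<epsilon>) u'\<close>, so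
  \<open>\<nabla>\<phi> (u / \<epsilon>) u'\<close> itself is \<open>\<epsilon>\<close> times it.\<close>

definition grad_term ::
    "(real^'m \<Rightarrow> real^'n) \<Rightarrow> real \<Rightarrow> (real \<Rightarrow> real^'m) \<Rightarrow> real \<Rightarrow> real^'n" where
  "grad_term \<phi> \<epsilon> u t =
     \<epsilon> *\<^sub>R vector_derivative (\<lambda>s. \<phi> (cont_rep 1 u s /\<^sub>R \<epsilon>)) (at t within {0..1})"

definition F_eps ::
    "(real^'m \<Rightarrow> real^'n) \<Rightarrow> (real \<Rightarrow> real) \<Rightarrow> real \<Rightarrow> (real \<Rightarrow> real^'m) \<Rightarrow> ennreal" where
  "F_eps \<phi> \<delta> \<epsilon> u =
     (if u \<in> H1 1
      then \<integral>\<^sup>+ t. ennreal ((norm (weak_deriv 1 u t))\<^sup>2 +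
             (\<delta> \<epsilon> / \<epsilon>)\<^sup>2 * (norm (grad_term \<phi> \<epsilon> u t))\<^sup>2) \<partial>lebesgue_on {0..1}
      else \<infinity>)"

definition F_hom :: "(real^'m \<Rightarrow> real^'n) \<Rightarrow> (real \<Rightarrow> real^'m) \<Rightarrow> ennreal" where
  "F_hom \<phi> u =
     (if u \<in> H1 1
      then \<integral>\<^sup>+ t. psi_hom \<phi> (weak_deriv 1 u t) \<partial>lebesgue_on {0..1}
      else \<infinity>)"

end

theory Submission
  imports Defs "HOL-Complex_Analysis.Great_Picard" "HOL-Real_Asymp.Real_Asymp"
begin

text \<open>
  The proof rests on a derivative-free notion of energy. For any function \<open>u\<close> on an interval let
  \<open>energy a b u\<close> be the supremum of \<open>\<Sum> \<bar>u y - u x\<bar>\<^sup>2 / (y - x)\<close> over the partitions of \<open>{a..b}\<close>. It is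
  additive in the interval, scales explicitly, is lower semicontinuous under pointwise convergence,
  and it is finite exactly for the primitives of square integrable functions, where it equals the
  Dirichlet integral (\<open>energy_imp_primitive\<close>, \<open>primitive_energy\<close>). Hence both the cell problems and the
  functionals are statements about energies: for the continuous representative of \<open>u\<close>,
  \<open>F_eps\<close> is \<open>energy u + \<delta>\<^sup>2 energy (\<phi> (u / \<epsilon>))\<close> (\<open>F_eps_eq\<close>), and no chain rule for \<open>\<phi>\<close> is involved.

  The geometry of a level enters through a dichotomy (\<open>level_dichotomy\<close>). If the level is connected
  and unbounded, the controlled length condition joins any two of its points at a cost that depends
  only on their distance; by periodicity, level paths can then be concatenated at bounded extra cost
  (\<open>reach_join\<close>), so \<open>T \<psi>\<^sub>T\<close> is subadditive up to a constant, and the limit \<open>psi_hom_z\<close> exists and is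
  finite and convex. Otherwise all connected subsets of the level have uniformly bounded diameter
  (\<open>bounded_components_displacement\<close>), and \<open>psi_hom_z\<close> is \<open>0\<close> at \<open>0\<close> and \<open>\<infinity>\<close> elsewhere.

  Levels are compared through affine functions. Call a level path cheap if its energy is at most
  \<open>a \<bullet> displacement + \<beta> \<cdot> duration\<close>. Both sides add up along subdivisions, so a cheap path contains a
  cheap path of any duration that divides its own (\<open>cheap_divide\<close>); cheapness passes to limits of
  paths and of levels (\<open>cheap_limit\<close>), and the range of \<open>\<phi>\<close> is compact. If one level carries cheap paths
  of all integer durations, continuing a long one periodically shows that the affine function with a
  slightly larger constant is not below the integrand of that level (\<open>cheap_imp_not_minorant\<close>). Two
  consequences follow: the minimum over \<open>z\<close> is attained (\<open>psi_hom_z_attained\<close>), and an affine function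
  below all \<open>psi_hom_z\<close> is, up to a small loss, a lower bound for the energy of every path of some fixed
  duration \<open>T\<close> along which \<open>\<phi>\<close> oscillates by at most some \<open>c > 0\<close> (\<open>cell_lower_bound\<close>).

  For the lower bound, cut a path of bounded energy \<open>F_eps\<close> into pieces of length \<open>\<epsilon> T\<close>. Since \<open>\<delta>\<^sup>2\<close> times
  the energy of \<open>\<phi> (u / \<epsilon>)\<close> is bounded, the pieces on which \<open>\<phi> (u / \<epsilon>)\<close> oscillates by more than \<open>c\<close> have
  total length of order \<open>(\<epsilon> / \<delta>)\<^sup>2\<close>, which vanishes; the others obey the cell bound. Optimising over the
  affine minorants of the convex function \<open>psi_hom\<close> bounds the limiting energy on each interval by
  \<open>psi_hom\<close> at the mean slope, and Fatou's lemma along uniform partitions gives the integral.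

  For the upper bound, consider the slopes and costs that can be realised on every interval for all
  small \<open>\<epsilon>\<close> and \<open>\<delta>\<close> (\<open>achievable\<close>). Rescaled level paths with two short connecting segments realise
  \<open>psi_hom_z\<close>, and concatenation shows that the infimal cost is convex. It is therefore a convex function
  below all \<open>psi_hom_z\<close>, hence at most \<open>psi_hom\<close> (\<open>achievable_hom\<close>). Realising the slopes of the limit path
  on a fine partition, with the right cost by Jensen's inequality, gives the recovery sequence.
\<close>


section \<open>The energy of a path as a supremum over partitions\<close>

text \<open>The list of nodes may have repetitions: they contribute \<open>0 / 0 = 0\<close>. So a node can be inserted
  or duplicated without case distinctions.\<close>
fun partition_sum :: "(real \<Rightarrow> 'a::real_normed_vector) \<Rightarrow> real list \<Rightarrow> real" where
  "partition_sum u (x # y # xs) = (norm (u y - u x))\<^sup>2 / (y - x) + partition_sum u (y # xs)"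
| "partition_sum u _ = 0"

definition energy :: "real \<Rightarrow> real \<Rightarrow> (real \<Rightarrow> 'a::real_normed_vector) \<Rightarrow> ennreal" where
  "energy a b u = (SUP xs \<in> {xs. sorted xs \<and> set xs \<subseteq> {a..b}}. ennreal (partition_sum u xs))"

lemma partition_sum_nonneg: "sorted xs \<Longrightarrow> 0 \<le> partition_sum u xs"
  by (induction u xs rule: partition_sum.induct) auto

lemma energy_upper: "sorted xs \<Longrightarrow> set xs \<subseteq> {a..b} \<Longrightarrow> ennreal (partition_sum u xs) \<le> energy a b u"
  unfolding energy_def by (rule SUP_upper) auto

lemma energy_least:
  "(\<And>xs. sorted xs \<Longrightarrow> set xs \<subseteq> {a..b} \<Longrightarrow> ennreal (partition_sum u xs) \<le> K) \<Longrightarrow> energy a b u \<le> K"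
  unfolding energy_def by (rule SUP_least) auto

lemma energy_mono: "a' \<le> a \<Longrightarrow> b \<le> b' \<Longrightarrow> energy a b u \<le> energy a' b' u"
  by (intro energy_least energy_upper) auto

text \<open>The partition with the two nodes \<open>s\<close> and \<open>t\<close> alone shows that paths of finite energy are Hoelder
  continuous with exponent one half.\<close>
lemma energy_increment:
  assumes "s \<in> {a..b}" "t \<in> {a..b}" "energy a b u \<le> ennreal K" "0 \<le> K"
  shows "(norm (u t - u s))\<^sup>2 \<le> \<bar>t - s\<bar> * K"
proof -
  have *: "(norm (u y - u x))\<^sup>2 \<le> (y - x) * K" if "x \<in> {a..b}" "y \<in> {a..b}" "x \<le> y" for x y
  proof (cases "x = y")
    case False
    have "ennreal (partition_sum u [x, y]) \<le> ennreal K"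
      using that by (intro order_trans[OF energy_upper assms(3)]) auto
    then show ?thesis
      using False that assms(4) by (simp add: field_simps)
  qed auto
  show ?thesis
    using *[of s t] *[of t s] assms(1,2) by (cases "s \<le> t") (auto simp: norm_minus_commute)
qed

lemma partition_sum_Lipschitz:
  assumes "0 \<le> L" "sorted xs" "set xs \<subseteq> S"
    and "\<And>s t. s \<in> S \<Longrightarrow> t \<in> S \<Longrightarrow> s \<le> t \<Longrightarrow> norm (v t - v s) \<le> L * norm (u t - u s)"
  shows "partition_sum v xs \<le> L\<^sup>2 * partition_sum u xs"
  using assms(2,3)
proof (induction xs rule: induct_list012)
  case (3 x y xs)
  have "(norm (v y - v x))\<^sup>2 \<le> (L * norm (u y - u x))\<^sup>2"
    using "3.prems" by (intro power_mono assms(4)) auto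
  then have "(norm (v y - v x))\<^sup>2 / (y - x) \<le> L\<^sup>2 * ((norm (u y - u x))\<^sup>2 / (y - x))"
    using "3.prems" by (simp add: divide_right_mono power_mult_distrib)
  then show ?case
    using 3 by (auto simp: distrib_left)
qed auto

text \<open>Energies are compared through increments only; translation, scaling, composition with Lipschitz
  maps and the energy of Lipschitz paths are all instances.\<close>
lemma energy_Lipschitz_comp:
  assumes "0 \<le> L"
    and "\<And>s t. s \<in> {a..b} \<Longrightarrow> t \<in> {a..b} \<Longrightarrow> s \<le> t \<Longrightarrow> norm (v t - v s) \<le> L * norm (u t - u s)"
  shows "energy a b v \<le> ennreal (L\<^sup>2) * energy a b u"
proof (rule energy_least)
  fix xs assume xs: "sorted xs" "set xs \<subseteq> {a..b}"
  have "ennreal (partition_sum v xs) \<le> ennreal (L\<^sup>2 * partition_sum u xs)"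
    using xs assms by (intro ennreal_leI partition_sum_Lipschitz) auto
  also have "\<dots> \<le> ennreal (L\<^sup>2) * energy a b u"
    using xs by (auto simp: ennreal_mult' intro!: mult_left_mono energy_upper)
  finally show "ennreal (partition_sum v xs) \<le> ennreal (L\<^sup>2) * energy a b u" .
qed

lemma energy_increment_cong:
  assumes "\<And>s t. s \<in> {a..b} \<Longrightarrow> t \<in> {a..b} \<Longrightarrow> s \<le> t \<Longrightarrow> norm (v t - v s) = norm (u t - u s)"
  shows "energy a b v = energy a b u"
  using energy_Lipschitz_comp[of 1 a b v u] energy_Lipschitz_comp[of 1 a b u v] assms by (auto intro: antisym)

lemma energy_cong: "(\<And>t. t \<in> {a..b} \<Longrightarrow> v t = u t) \<Longrightarrow> energy a b v = energy a b u"
  by (rule energy_increment_cong) simp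

lemma energy_translate [simp]: "energy a b (\<lambda>t. u t + k) = energy a b u"
  by (rule energy_increment_cong) simp

lemma energy_scaleR:
  "energy a b (\<lambda>t. r *\<^sub>R u t) = ennreal (r\<^sup>2) * energy a b u"
proof (cases "r = 0")
  case True
  have "energy a b (\<lambda>t. 0 *\<^sub>R u t) \<le> ennreal (0\<^sup>2) * energy a b u"
    by (rule energy_Lipschitz_comp) auto
  then show ?thesis using True by simp
next
  case False
  have 1: "energy a b (\<lambda>t. r *\<^sub>R u t) \<le> ennreal (r\<^sup>2) * energy a b u"
    using energy_Lipschitz_comp[of "\<bar>r\<bar>" a b "\<lambda>t. r *\<^sub>R u t" u] by (simp flip: scaleR_diff_right)
  have "energy a b u \<le> ennreal ((1 / \<bar>r\<bar>)\<^sup>2) * energy a b (\<lambda>t. r *\<^sub>R u t)"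
    using False by (intro energy_Lipschitz_comp) (auto simp flip: scaleR_diff_right)
  then have "ennreal (r\<^sup>2) * energy a b u \<le> ennreal (r\<^sup>2) * (ennreal ((1 / \<bar>r\<bar>)\<^sup>2) * energy a b (\<lambda>t. r *\<^sub>R u t))"
    by (rule mult_left_mono) simp
  also have "\<dots> = energy a b (\<lambda>t. r *\<^sub>R u t)"
    using False by (simp add: mult.assoc[symmetric] ennreal_mult[symmetric] power_divide)
  finally show ?thesis using 1 by (intro antisym)
qed

lemma partition_sum_identity: "sorted xs \<Longrightarrow> xs \<noteq> [] \<Longrightarrow> partition_sum (\<lambda>t. t) xs = last xs - hd xs"
proof (induction "\<lambda>t::real. t" xs rule: partition_sum.induct)
  case (1 x y xs)
  then show ?case by (cases "x = y") (auto simp: power2_eq_square)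
qed auto

lemma energy_identity: "a \<le> b \<Longrightarrow> energy a b (\<lambda>t. t) \<le> ennreal (b - a)"
proof (rule energy_least)
  fix xs :: "real list" assume "a \<le> b" "sorted xs" "set xs \<subseteq> {a..b}"
  then show "ennreal (partition_sum (\<lambda>t. t) xs) \<le> ennreal (b - a)"
    by (cases "xs = []") (auto simp: partition_sum_identity subset_iff intro!: ennreal_leI diff_mono)
qed

lemma energy_Lipschitz:
  assumes "0 \<le> K" "a \<le> b"
    and "\<And>s t. s \<in> {a..b} \<Longrightarrow> t \<in> {a..b} \<Longrightarrow> s \<le> t \<Longrightarrow> norm (u t - u s) \<le> K * (t - s)"
  shows "energy a b u \<le> ennreal (K\<^sup>2 * (b - a))"
proof -
  have "energy a b u \<le> ennreal (K\<^sup>2) * energy a b (\<lambda>t. t)"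
    using assms by (intro energy_Lipschitz_comp) auto
  also have "\<dots> \<le> ennreal (K\<^sup>2) * ennreal (b - a)"
    using assms by (intro mult_left_mono energy_identity) auto
  finally show ?thesis by (simp add: ennreal_mult')
qed

lemma energy_const [simp]: "energy a b (\<lambda>t. k) = 0"
  using energy_scaleR[of a b 0 "\<lambda>t. k"] energy_increment_cong[of a b "\<lambda>t. k" "\<lambda>t. 0 *\<^sub>R k"] by simp

lemma partition_sum_reparam:
  "m > 0 \<Longrightarrow> partition_sum (\<lambda>t. u (m * t + c)) xs = m * partition_sum u (map (\<lambda>t. m * t + c) xs)"
proof (induction u xs rule: partition_sum.induct)
  case (1 u x y xs)
  have "m * y + c - (m * x + c) = m * (y - x)" by (simp add: algebra_simps)
  then show ?case using 1 by (simp add: distrib_left)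
qed auto

lemma energy_reparam_le:
  assumes "m > 0"
  shows "energy a b (\<lambda>t. u (m * t + c)) \<le> ennreal m * energy (m * a + c) (m * b + c) u"
proof (rule energy_least)
  fix xs :: "real list" assume xs: "sorted xs" "set xs \<subseteq> {a..b}"
  have "sorted (map (\<lambda>t. m * t + c) xs)"
    using xs(1) assms by (intro sorted_map_mono) (auto simp: mono_on_def)
  then have "ennreal (partition_sum u (map (\<lambda>t. m * t + c) xs)) \<le> energy (m * a + c) (m * b + c) u"
    using xs assms by (intro energy_upper) auto
  then show "ennreal (partition_sum (\<lambda>t. u (m * t + c)) xs) \<le> ennreal m * energy (m * a + c) (m * b + c) u"
    using assms by (simp add: partition_sum_reparam ennreal_mult' mult_left_mono)
qed

lemma energy_reparam:
  assumes "m > 0"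
  shows "energy a b (\<lambda>t. u (m * t + c)) = ennreal m * energy (m * a + c) (m * b + c) u"
proof (rule antisym[OF energy_reparam_le[OF assms]])
  let ?v = "\<lambda>t. u (m * t + c)"
  have "energy (m * a + c) (m * b + c) (\<lambda>t. ?v ((1/m) * t + (- c / m))) \<le> ennreal (1/m) * energy a b ?v"
    using energy_reparam_le[of "1/m" "m * a + c" "m * b + c" ?v "- c / m"] assms
    by (simp add: field_simps)
  moreover have "(\<lambda>t. ?v ((1/m) * t + (- c / m))) = u"
    using assms by (auto simp: field_simps)
  ultimately have "ennreal m * energy (m * a + c) (m * b + c) u \<le> ennreal m * (ennreal (1/m) * energy a b ?v)"
    by (intro mult_left_mono) auto
  also have "\<dots> = energy a b ?v"
    using assms by (simp add: mult.assoc[symmetric] ennreal_mult[symmetric])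
  finally show "ennreal m * energy (m * a + c) (m * b + c) u \<le> energy a b ?v" .
qed

lemma partition_sum_append:
  "partition_sum u (xs @ b # ys) = partition_sum u (xs @ [b]) + partition_sum u (b # ys)"
proof (induction xs)
  case (Cons x xs)
  then show ?case by (cases xs) auto
qed auto

text \<open>Convexity of the square, in the form that makes the partition sum grow under refinement.\<close>
lemma weighted_square_le:
  fixes p q :: real
  assumes "0 < s" "0 < t"
  shows "(p + q)\<^sup>2 / (s + t) \<le> p\<^sup>2 / s + q\<^sup>2 / t"
proof -
  have "(p\<^sup>2 / s + q\<^sup>2 / t) * (s + t) - (p + q)\<^sup>2 = (p * t - q * s)\<^sup>2 / (s * t)"
    using assms by (simp add: field_simps power2_eq_square)
  also have "\<dots> \<ge> 0" using assms by simp
  finally show ?thesis using assms by (simp add: pos_divide_le_eq)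
qed

lemma partition_sum_insert:
  assumes "x \<le> b" "b \<le> y"
  shows "(norm (u y - u x))\<^sup>2 / (y - x) \<le> (norm (u b - u x))\<^sup>2 / (b - x) + (norm (u y - u b))\<^sup>2 / (y - b)"
proof (cases "x = b \<or> b = y")
  case False
  have "(norm (u y - u x))\<^sup>2 \<le> (norm (u b - u x) + norm (u y - u b))\<^sup>2"
    using norm_triangle_ineq[of "u b - u x" "u y - u b"] by (intro power_mono) auto
  then have "(norm (u y - u x))\<^sup>2 / (y - x) \<le> (norm (u b - u x) + norm (u y - u b))\<^sup>2 / ((b - x) + (y - b))"
    using assms False by (simp add: divide_right_mono)
  also have "\<dots> \<le> (norm (u b - u x))\<^sup>2 / (b - x) + (norm (u y - u b))\<^sup>2 / (y - b)"
    using assms False by (intro weighted_square_le) auto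
  finally show ?thesis .
qed auto

lemma partition_sum_split:
  assumes "sorted (xs @ ys)" "\<And>x. x \<in> set xs \<Longrightarrow> x \<le> b" "\<And>y. y \<in> set ys \<Longrightarrow> b \<le> y"
  shows "partition_sum u (xs @ ys) \<le> partition_sum u (xs @ [b]) + partition_sum u (b # ys)"
  using assms
proof (induction xs)
  case Nil
  then show ?case by (cases ys) auto
next
  case (Cons x xs)
  show ?case
  proof (cases xs)
    case Nil
    then show ?thesis
      using Cons.prems partition_sum_insert[of x b _ u] by (cases ys) auto
  next
    case (Cons x' xs')
    then show ?thesis using Cons.IH Cons.prems by auto
  qed
qed

text \<open>Inserting the node \<open>b\<close> into a partition only increases its sum, and a partition with node \<open>b\<close> is
  a pair of partitions.\<close>
lemma energy_split:
  assumes "a \<le> b" "b \<le> c"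
  shows "energy a c u = energy a b u + energy b c u"
proof (rule antisym)
  show "energy a c u \<le> energy a b u + energy b c u"
  proof (rule energy_least)
    fix xs :: "real list" assume xs: "sorted xs" "set xs \<subseteq> {a..c}"
    define ys zs where "ys = filter (\<lambda>t. t \<le> b) xs" and "zs = filter (\<lambda>t. \<not> t \<le> b) xs"
    have eq: "xs = ys @ zs"
    proof -
      have "sorted xs \<Longrightarrow> xs = filter (\<lambda>t. t \<le> b) xs @ filter (\<lambda>t. \<not> t \<le> b) xs" for xs :: "real list"
      proof (induction xs)
        case (Cons x xs)
        show ?case
        proof (cases "x \<le> b")
          case False
          then have "\<forall>t\<in>set xs. \<not> t \<le> b" using Cons.prems by auto
          then show ?thesis using False by (simp add: filter_id_conv filter_empty_conv)
        qed (use Cons in auto)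
      qed auto
      then show ?thesis using xs(1) by (simp add: ys_def zs_def)
    qed
    have s: "sorted (ys @ [b])" "sorted (b # zs)"
      using xs(1) by (auto simp: ys_def zs_def sorted_append intro: sorted_filter sorted_wrt_filter)
    have "partition_sum u xs \<le> partition_sum u (ys @ [b]) + partition_sum u (b # zs)"
    proof -
      have "sorted (ys @ zs)" using xs(1) eq by simp
      then have "partition_sum u (ys @ zs) \<le> partition_sum u (ys @ [b]) + partition_sum u (b # zs)"
        by (rule partition_sum_split) (simp_all add: ys_def zs_def)
      then show ?thesis using eq by simp
    qed
    then have "ennreal (partition_sum u xs) \<le> ennreal (partition_sum u (ys @ [b])) + ennreal (partition_sum u (b # zs))"
      using s by (metis ennreal_leI ennreal_plus partition_sum_nonneg)
    also have "\<dots> \<le> energy a b u + energy b c u"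
      using s xs assms by (intro add_mono energy_upper) (auto simp: ys_def zs_def)
    finally show "ennreal (partition_sum u xs) \<le> energy a b u + energy b c u" .
  qed
  have *: "ennreal (partition_sum u xs) + ennreal (partition_sum u ys) \<le> energy a c u"
    if xs: "sorted xs" "set xs \<subseteq> {a..b}" and ys: "sorted ys" "set ys \<subseteq> {b..c}" for xs ys
  proof -
    have le: "x \<le> b" "b \<le> y" if "x \<in> set xs" "y \<in> set ys" for x y
      using that xs(2) ys(2) by auto
    have s: "sorted (xs @ b # ys)"
      using xs ys by (auto simp: sorted_append intro: order_trans[OF le(1) le(2)])
    have 1: "partition_sum u xs \<le> partition_sum u (xs @ [b])"
    proof -
      have "\<And>x. x \<in> set xs \<Longrightarrow> x \<le> b" using xs(2) by auto
      then show ?thesis using partition_sum_split[of xs "[]" b u] xs(1) by simp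
    qed
    have 2: "partition_sum u ys \<le> partition_sum u (b # ys)"
      using ys by (cases ys) auto
    have "ennreal (partition_sum u xs) + ennreal (partition_sum u ys) \<le> ennreal (partition_sum u (xs @ b # ys))"
      using 1 2 partition_sum_nonneg[OF xs(1), of u] partition_sum_nonneg[OF ys(1), of u]
      by (subst partition_sum_append) (simp flip: ennreal_plus)
    also have "\<dots> \<le> energy a c u"
      using s xs ys assms by (intro energy_upper) auto
    finally show ?thesis .
  qed
  have "energy a b u + energy b c u = (SUP xs \<in> {xs. sorted xs \<and> set xs \<subseteq> {a..b}}. ennreal (partition_sum u xs) + energy b c u)"
    unfolding energy_def[of a b] by (subst ennreal_SUP_add_left) (auto intro: exI[of _ "[]"])
  also have "\<dots> \<le> energy a c u"
  proof (rule SUP_least)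
    fix xs assume xs: "xs \<in> {xs. sorted xs \<and> set xs \<subseteq> {a..b}}"
    have "ennreal (partition_sum u xs) + energy b c u
      = (SUP ys \<in> {ys. sorted ys \<and> set ys \<subseteq> {b..c}}. ennreal (partition_sum u xs) + ennreal (partition_sum u ys))"
      unfolding energy_def[of b c] by (subst ennreal_SUP_add_right) (auto intro: exI[of _ "[]"])
    also have "\<dots> \<le> energy a c u"
      using xs * by (intro SUP_least) auto
    finally show "ennreal (partition_sum u xs) + energy b c u \<le> energy a c u" .
  qed
  finally show "energy a b u + energy b c u \<le> energy a c u" .
qed

lemma energy_uniform_split:
  assumes "0 \<le> h"
  shows "energy a (a + real N * h) u = (\<Sum>i<N. energy (a + real i * h) (a + real (Suc i) * h) u)"
proof (induction N)
  case 0
  have "energy a a u = 0"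
    using energy_cong[of a a u "\<lambda>_. u a"] by simp
  then show ?case by simp
next
  case (Suc N)
  have "energy a (a + real (Suc N) * h) u
      = energy a (a + real N * h) u + energy (a + real N * h) (a + real (Suc N) * h) u"
    using assms by (intro energy_split) (auto simp: algebra_simps)
  then show ?case using Suc by simp
qed

lemma tendsto_partition_sum:
  assumes "\<And>t. t \<in> set xs \<Longrightarrow> ((\<lambda>n. u n t) \<longlongrightarrow> g t) F"
  shows "((\<lambda>n. partition_sum (u n) xs) \<longlongrightarrow> partition_sum g xs) F"
  using assms
proof (induction g xs rule: partition_sum.induct)
  case (1 g x y xs)
  then show ?case by (auto simp: divide_inverse intro!: tendsto_intros)
qed auto

text \<open>Each partition sum depends continuously on finitely many values, and a supremum of continuous
  functions is lower semicontinuous.\<close>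
lemma energy_lsc:
  fixes u :: "nat \<Rightarrow> real \<Rightarrow> 'a::real_normed_vector"
  assumes lim: "\<And>t. t \<in> {a..b} \<Longrightarrow> (\<lambda>n. u n t) \<longlonglongrightarrow> g t"
    and le: "eventually (\<lambda>n. energy a b (u n) \<le> ennreal (K n)) sequentially" and K: "K \<longlonglongrightarrow> k"
  shows "energy a b g \<le> ennreal k"
proof (rule energy_least)
  fix xs :: "real list" assume xs: "sorted xs" "set xs \<subseteq> {a..b}"
  have "(\<lambda>n. partition_sum (u n) xs) \<longlonglongrightarrow> partition_sum g xs"
    using xs lim by (intro tendsto_partition_sum) auto
  then have 1: "(\<lambda>n. ennreal (partition_sum (u n) xs)) \<longlonglongrightarrow> ennreal (partition_sum g xs)"
    by (rule tendsto_ennrealI)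
  have 2: "(\<lambda>n. ennreal (K n)) \<longlonglongrightarrow> ennreal k"
    by (rule tendsto_ennrealI[OF K])
  show "ennreal (partition_sum g xs) \<le> ennreal k"
    using le by (intro tendsto_le[OF _ 2 1])
      (auto elim!: eventually_mono intro: order_trans[OF energy_upper[OF xs]])
qed

text \<open>A bound on the energies makes the paths equicontinuous, so the theorem of Arzela and Ascoli
  applies.\<close>
lemma energy_compactness:
  fixes u :: "nat \<Rightarrow> real \<Rightarrow> 'a::euclidean_space"
  assumes "a \<le> b" and R: "\<And>n. norm (u n a) \<le> R" and K: "\<And>n. energy a b (u n) \<le> ennreal K" "0 \<le> K"
  obtains g r where "strict_mono (r :: nat \<Rightarrow> nat)" "continuous_on {a..b} g"
    "\<And>t. t \<in> {a..b} \<Longrightarrow> (\<lambda>n. u (r n) t) \<longlonglongrightarrow> g t"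
proof -
  have inc: "norm (u n t - u n s) \<le> sqrt (\<bar>t - s\<bar> * K)" if "s \<in> {a..b}" "t \<in> {a..b}" for n s t
    using energy_increment[OF that K(1) K(2)] by (simp add: real_le_rsqrt)
  have 1: "norm (u n t) \<le> R + sqrt ((b - a) * K)" if "t \<in> {a..b}" for n t
  proof -
    have "norm (u n t - u n a) \<le> sqrt ((b - a) * K)"
      using that assms(1) K(2)
      by (intro order_trans[OF inc]) (auto intro!: mult_right_mono)
    moreover have "norm (u n t) \<le> norm (u n a) + norm (u n t - u n a)"
      by (rule norm_triangle_sub)
    ultimately show ?thesis using R[of n] by simp
  qed
  have 2: "\<exists>d>0. \<forall>n y. y \<in> {a..b} \<and> norm (x - y) < d \<longrightarrow> norm (u n x - u n y) < e"
    if "x \<in> {a..b}" "e > 0" for x e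
  proof (intro exI[of _ "e\<^sup>2 / (K + 1)"] conjI allI impI)
    fix n y assume y: "y \<in> {a..b} \<and> norm (x - y) < e\<^sup>2 / (K + 1)"
    have "\<bar>x - y\<bar> * K \<le> \<bar>x - y\<bar> * (K + 1)"
      using K(2) by (intro mult_left_mono) auto
    also have "\<dots> < e\<^sup>2" using y K(2) by (simp add: field_simps)
    finally have "sqrt (\<bar>x - y\<bar> * K) < e"
      using that(2) by (metis real_sqrt_less_iff real_sqrt_abs abs_of_pos)
    then show "norm (u n x - u n y) < e"
      using inc[of y x n] y that by auto
  qed (use that K in auto)
  obtain g r where g: "continuous_on {a..b} g" "strict_mono (r :: nat \<Rightarrow> nat)"
    "\<And>e. 0 < e \<Longrightarrow> \<exists>N. \<forall>n x. n \<ge> N \<and> x \<in> {a..b} \<longrightarrow> norm (u (r n) x - g x) < e"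
    using Arzela_Ascoli[of "{a..b}" u, OF compact_Icc 1 2] by blast
  have "(\<lambda>n. u (r n) t) \<longlonglongrightarrow> g t" if "t \<in> {a..b}" for t
    using g(3) that by (intro LIMSEQ_I) blast
  with g that show thesis by blast
qed

section \<open>Lebesgue differentiation of square integrable functions\<close>

text \<open>The set consists of the points where \<open>f\<close> is at most \<open>r - c\<close> although arbitrarily short
  intervals around the point have mean value above \<open>r\<close>. On such an interval \<open>J\<close> the integral of \<open>g = f - r\<close> is
  positive while \<open>g \<le> - c\<close> on \<open>A = {f \<le> r - c}\<close>, so \<open>c \<bar>J \<inter> A\<bar>\<close> is at most the integral of \<open>\<bar>g\<bar>\<close> over \<open>J - A\<close>.
  By Vitali's theorem disjoint intervals of this kind inside an open set \<open>U\<close> around \<open>A\<close> cover the set up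
  to a null set. Its measure is thus at most \<open>1 / c\<close> times the integral of \<open>\<bar>g\<bar>\<close> over \<open>U - A\<close>, which is
  small with the measure of \<open>U - A\<close>.\<close>
lemma negligible_steep_set:
  fixes f :: "real \<Rightarrow> real"
  assumes meas: "f \<in> borel_measurable lebesgue" and sq: "integrable lebesgue (\<lambda>t. (f t)\<^sup>2)" and "c > 0" "R > 0"
  shows "negligible {t. f t \<le> r - c \<and> \<bar>t\<bar> < R \<and>
    (\<forall>d>0. \<exists>x y. x \<le> t \<and> t \<le> y \<and> x < y \<and> y - x < d \<and> integral {x..y} f > r * (y - x))}" (is "negligible ?S")
proof -
  note [measurable] = meas
  have sets [measurable]: "{x..y} \<in> sets lebesgue" "{-R<..<R} \<in> sets lebesgue" for x y :: real by auto
  define A where "A = {t \<in> {-R<..<R}. f t \<le> r - c}"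
  have A [measurable]: "A \<in> sets lebesgue" unfolding A_def
  proof -
    have "{t. f t \<le> r - c} \<in> sets lebesgue"
      using measurable_sets[OF meas, of "{..r - c}"] by (simp add: vimage_def)
    then have "{-R<..<R} \<inter> {t. f t \<le> r - c} \<in> sets lebesgue" by auto
    then show "{t \<in> {-R<..<R}. f t \<le> r - c} \<in> sets lebesgue" by (simp add: Int_def)
  qed
  define g where "g t = f t - r" for t
  have g_meas [measurable]: "g \<in> borel_measurable lebesgue" by (simp add: g_def[abs_def])
  have fin: "integrable lebesgue (indicat_real {-R<..<R})"
  proof -
    have "{-R<..<R} \<in> lmeasurable" by (intro bounded_set_imp_lmeasurable) auto
    then show ?thesis by (simp add: fmeasurable_def)
  qed
  define Q where "Q = (LINT t|lebesgue. 2 * (f t)\<^sup>2 + 2 * r\<^sup>2 * indicat_real {-R<..<R} t)"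
  have Qint: "integrable lebesgue (\<lambda>t. 2 * (f t)\<^sup>2 + 2 * r\<^sup>2 * indicat_real {-R<..<R} t)"
    using sq fin by simp
  have Q0: "0 \<le> Q" unfolding Q_def by (intro integral_nonneg_AE) auto
  have g2: "(g t)\<^sup>2 \<le> 2 * (f t)\<^sup>2 + 2 * r\<^sup>2" for t
    using zero_le_power2[of "f t + r"] unfolding g_def by (simp add: power2_eq_square algebra_simps)
  show ?thesis
    unfolding negligible_outer_le
  proof (intro allI impI)
    fix e :: real assume e: "e > 0"
    \<comment> \<open>The bound \<open>\<bar>g\<bar> \<le> \<eta> g\<^sup>2 + 1 / (4 \<eta>)\<close> replaces absolute continuity of the integral: \<open>\<eta>\<close>
      controls the first term, and \<open>\<sigma>\<close>, the allowed measure of \<open>U - A\<close>, the second; each gets \<open>c e / 2\<close>.\<close>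
    define \<eta> where "\<eta> = c * e / (2 * (Q + 1))"
    have \<eta>: "\<eta> > 0" using e \<open>c > 0\<close> Q0 by (simp add: \<eta>_def)
    have \<eta>Q: "\<eta> * Q \<le> c * e / 2"
      using e \<open>c > 0\<close> Q0 by (simp add: \<eta>_def field_simps)
    define \<sigma> where "\<sigma> = 2 * c * e * \<eta>"
    have \<sigma>: "\<sigma> > 0" using e \<eta> \<open>c > 0\<close> by (simp add: \<sigma>_def)
    obtain T where T: "open T" "A \<subseteq> T" "T - A \<in> lmeasurable" "emeasure lebesgue (T - A) < ennreal \<sigma>"
      by (rule sets_lebesgue_outer_open[OF A \<sigma>])
    define U where "U = T \<inter> {-R<..<R}"
    have U: "open U" "A \<subseteq> U" "U \<subseteq> {-R<..<R}" using T(1,2) by (auto simp: U_def A_def)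
    have U_sets [measurable]: "U \<in> sets lebesgue" using U(1) by auto
    have UA: "U - A \<in> lmeasurable" "measure lebesgue (U - A) \<le> \<sigma>"
    proof -
      have m: "T - A \<in> lmeasurable" "measure lebesgue (T - A) \<le> \<sigma>"
        using T(3,4) \<sigma> by (auto simp: emeasure_eq_measure2 ennreal_less_iff)
      have "U - A \<in> sets lebesgue" by measurable
      have "U - A \<subseteq> T - A" by (auto simp: U_def)
      show "U - A \<in> lmeasurable"
        by (rule fmeasurableI2[OF m(1)]) fact+
      show "measure lebesgue (U - A) \<le> \<sigma>"
        using measure_mono_fmeasurable[OF \<open>U - A \<subseteq> T - A\<close> \<open>U - A \<in> sets lebesgue\<close> m(1)] m(2) by (rule order_trans)
    qed
    define K where "K = {(x, y). x < y \<and> {x..y} \<subseteq> U \<and> integral {x..y} f > r * (y - x)}"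
    define a where "a = (\<lambda>(x::real, y). (x + y) / 2)"
    define \<rho> where "\<rho> = (\<lambda>(x::real, y). (y - x) / 2)"
    have cball: "cball (a i) (\<rho> i) = {fst i..snd i}" for i
      by (cases i) (simp add: a_def \<rho>_def cball_eq_atLeastAtMost field_simps)
    have cover: "\<exists>i. i \<in> K \<and> t \<in> cball (a i) (\<rho> i) \<and> \<rho> i < d" if "t \<in> ?S" "0 < d" for t d
    proof -
      have "t \<in> U" using that U by (auto simp: A_def)
      then obtain d' where d': "d' > 0" "ball t d' \<subseteq> U" using U(1) openE by blast
      have "min d d' > 0" using d' that by auto
      moreover have "\<forall>d>0. \<exists>x y. x \<le> t \<and> t \<le> y \<and> x < y \<and> y - x < d \<and> integral {x..y} f > r * (y - x)"
        using that(1) unfolding mem_Collect_eq by (elim conjE)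
      ultimately have "\<exists>x y. x \<le> t \<and> t \<le> y \<and> x < y \<and> y - x < min d d' \<and> integral {x..y} f > r * (y - x)"
        by (elim allE[of _ "min d d'"]) (erule (1) mp)
      then obtain x y where xy: "x \<le> t" "t \<le> y" "x < y" "y - x < min d d'" "integral {x..y} f > r * (y - x)"
        by blast
      have "{x..y} \<subseteq> ball t d'" using xy by (auto simp: dist_real_def)
      then have "(x, y) \<in> K" using xy d' by (auto simp: K_def)
      moreover have "t \<in> cball (a (x, y)) (\<rho> (x, y))" unfolding cball using xy by simp
      moreover have "\<rho> (x, y) < d" using xy by (simp add: \<rho>_def)
      ultimately show ?thesis by blast
    qed
    obtain C where C: "countable C" "C \<subseteq> K"
       "pairwise (\<lambda>i j. disjnt (cball (a i) (\<rho> i)) (cball (a j) (\<rho> j))) C"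
       "negligible (?S - (\<Union>i \<in> C. cball (a i) (\<rho> i)))"
    proof (rule Vitali_covering_theorem_cballs[of K \<rho> ?S a])
      show "0 < \<rho> i" if "i \<in> K" for i using that by (auto simp: K_def \<rho>_def)
      show "\<exists>i. i \<in> K \<and> t \<in> cball (a i) (\<rho> i) \<and> \<rho> i < d" if "t \<in> ?S" "0 < d" for t d
        by (rule cover[OF that])
    qed (rule that)
    define \<nu> where "\<nu> = density lebesgue (\<lambda>t. ennreal (\<bar>g t\<bar> / c))"
    define J where "J i = {fst i..snd i}" for i :: "real \<times> real"
    have J [measurable]: "J i \<in> sets lebesgue" for i by (simp add: J_def)
    have disj: "disjoint_family_on J C"
      using C(3) unfolding disjoint_family_on_def pairwise_def disjnt_def J_def cball by blast
    have each: "emeasure lebesgue (J i \<inter> A) \<le> emeasure \<nu> (J i - A)" if "i \<in> C" for i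
    proof -
      obtain x y where i: "i = (x, y)" by (cases i)
      have xy: "x < y" "{x..y} \<subseteq> U" "integral {x..y} f > r * (y - x)"
        using that C(2) i by (auto simp: K_def)
      have finJ: "integrable lebesgue (indicat_real {x..y})"
      proof -
        have "{x..y} \<in> lmeasurable" by (intro bounded_set_imp_lmeasurable) auto
        then show ?thesis by (simp add: fmeasurable_def)
      qed
      have Jf: "integrable lebesgue (\<lambda>t. indicat_real {x..y} t * f t)"
      proof (rule Bochner_Integration.integrable_bound)
        show "integrable lebesgue (\<lambda>t. (f t)\<^sup>2 + indicat_real {x..y} t)" using sq finJ by simp
        have "\<bar>f t\<bar> \<le> (f t)\<^sup>2 + 1" for t
        proof -
          have "2 * \<bar>f t\<bar> \<le> (f t)\<^sup>2 + 1" using zero_le_power2[of "\<bar>f t\<bar> - 1"] by (simp add: power2_diff)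
          then show ?thesis using abs_ge_zero[of "f t"] by linarith
        qed
        then show "AE t in lebesgue. norm (indicat_real {x..y} t * f t) \<le> norm ((f t)\<^sup>2 + indicat_real {x..y} t)"
          by (auto simp: indicator_def)
      qed measurable
      have Jg: "integrable lebesgue (\<lambda>t. indicat_real {x..y} t * g t)"
        using Jf finJ by (simp add: g_def right_diff_distrib)
      have "(LINT t|lebesgue. indicat_real {x..y} t * g t)
         = (LINT t|lebesgue. indicat_real {x..y} t * f t) - (LINT t|lebesgue. indicat_real {x..y} t * r)"
        using Jf finJ by (simp add: g_def right_diff_distrib)
      also have "(LINT t|lebesgue. indicat_real {x..y} t * f t) = integral {x..y} f"
        using set_lebesgue_integral_eq_integral(2)[of "{x..y}" f] Jf
        by (simp add: set_integrable_def set_lebesgue_integral_def)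
      finally have pos: "(LINT t|lebesgue. indicat_real {x..y} t * g t) > 0"
        using xy by (simp add: mult.commute)
      have mJA: "J i \<inter> A \<in> lmeasurable"
        by (rule fmeasurable_Int_fmeasurable) (auto simp: J_def)
      have 1: "integrable lebesgue (\<lambda>t. indicat_real (J i - A) t * \<bar>g t\<bar>)"
      proof (rule Bochner_Integration.integrable_bound[OF Jg])
        show "(\<lambda>t. indicat_real (J i - A) t * \<bar>g t\<bar>) \<in> borel_measurable lebesgue"
          by (intro borel_measurable_times borel_measurable_indicator borel_measurable_abs g_meas sets.Diff J A)
      qed (auto simp: indicator_def J_def i)
      have 2: "integrable lebesgue (\<lambda>t. indicat_real (J i \<inter> A) t)"
        using mJA by (simp add: fmeasurable_def)
      have "(LINT t|lebesgue. indicat_real {x..y} t * g t)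
         \<le> (LINT t|lebesgue. indicat_real (J i - A) t * \<bar>g t\<bar> - c * indicat_real (J i \<inter> A) t)"
        using 1 2 Jg by (intro integral_mono) (auto simp: indicator_def J_def i A_def g_def)
      also have "\<dots> = (LINT t|lebesgue. indicat_real (J i - A) t * \<bar>g t\<bar>) - c * measure lebesgue (J i \<inter> A)"
        using 1 2 by simp
      finally have le: "measure lebesgue (J i \<inter> A) \<le> (LINT t|lebesgue. indicat_real (J i - A) t * (\<bar>g t\<bar> / c))"
        using pos \<open>c > 0\<close> by (simp add: field_simps)
      have "emeasure lebesgue (J i \<inter> A) = ennreal (measure lebesgue (J i \<inter> A))"
        using mJA by (simp add: emeasure_eq_measure2)
      also have "\<dots> \<le> ennreal (LINT t|lebesgue. indicat_real (J i - A) t * (\<bar>g t\<bar> / c))"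
        by (rule ennreal_leI[OF le])
      also have "\<dots> = (\<integral>\<^sup>+t. ennreal (indicat_real (J i - A) t * (\<bar>g t\<bar> / c)) \<partial>lebesgue)"
        using integrable_divide[OF 1, of c] \<open>c > 0\<close> by (intro nn_integral_eq_integral[symmetric]) auto
      also have "\<dots> = emeasure \<nu> (J i - A)"
        unfolding \<nu>_def by (subst emeasure_density) (auto simp: indicator_def intro!: nn_integral_cong)
      finally show ?thesis .
    qed
    have disjA: "disjoint_family_on (\<lambda>i. J i \<inter> A) C" "disjoint_family_on (\<lambda>i. J i - A) C"
      using disj unfolding disjoint_family_on_def by blast+
    have JU: "J i \<subseteq> U" if "i \<in> C" for i
    proof -
      have "i \<in> K" using that C(2) by blast
      then show ?thesis by (cases i) (simp add: K_def J_def)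
    qed
    define B where "B = (\<Union>i\<in>C. J i \<inter> A)"
    have B_sets [measurable]: "B \<in> sets lebesgue" unfolding B_def using C(1) by (intro sets.countable_UN') auto
    have "emeasure lebesgue B = (\<integral>\<^sup>+i. emeasure lebesgue (J i \<inter> A) \<partial>count_space C)"
      unfolding B_def by (intro emeasure_UN_countable disjA C(1)) auto
    also have "\<dots> \<le> (\<integral>\<^sup>+i. emeasure \<nu> (J i - A) \<partial>count_space C)"
      using each by (intro nn_integral_mono) auto
    also have "\<dots> = emeasure \<nu> (\<Union>i\<in>C. J i - A)"
      by (intro emeasure_UN_countable[symmetric] disjA C(1)) (auto simp: \<nu>_def)
    also have "\<dots> \<le> emeasure \<nu> (U - A)"
      using JU by (intro emeasure_mono) (auto simp: \<nu>_def)
    also have "\<dots> = (\<integral>\<^sup>+t. ennreal (\<bar>g t\<bar> / c * indicat_real (U - A) t) \<partial>lebesgue)"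
      unfolding \<nu>_def by (subst emeasure_density) (auto simp: indicator_def intro!: nn_integral_cong)
    also have "\<dots> \<le> (\<integral>\<^sup>+t. ennreal (1/c * (\<eta> * (2 * (f t)\<^sup>2 + 2 * r\<^sup>2 * indicat_real {-R<..<R} t)
                        + 1 / (4 * \<eta>) * indicat_real (U - A) t)) \<partial>lebesgue)"
    proof (intro nn_integral_mono ennreal_leI)
      fix t
      show "\<bar>g t\<bar> / c * indicat_real (U - A) t \<le> 1/c * (\<eta> * (2 * (f t)\<^sup>2 + 2 * r\<^sup>2 * indicat_real {-R<..<R} t)
                        + 1 / (4 * \<eta>) * indicat_real (U - A) t)"
      proof (cases "t \<in> U - A")
        case True
        have "0 \<le> (2 * \<eta> * \<bar>g t\<bar> - 1)\<^sup>2" by simp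
        then have "\<bar>g t\<bar> \<le> \<eta> * (g t)\<^sup>2 + 1 / (4 * \<eta>)"
          using \<eta> by (simp add: power2_eq_square field_simps)
        also have "\<dots> \<le> \<eta> * (2 * (f t)\<^sup>2 + 2 * r\<^sup>2) + 1 / (4 * \<eta>)"
          using g2[of t] \<eta> by simp
        finally show ?thesis using True U(3) \<open>c > 0\<close> by (auto simp: field_simps)
      next
        case False
        then show ?thesis using \<eta> \<open>c > 0\<close> by (auto simp: indicator_def)
      qed
    qed
    also have "\<dots> = ennreal (LINT t|lebesgue. 1/c * (\<eta> * (2 * (f t)\<^sup>2 + 2 * r\<^sup>2 * indicat_real {-R<..<R} t)
                        + 1 / (4 * \<eta>) * indicat_real (U - A) t))"
      using \<eta> \<open>c > 0\<close> Qint UA by (intro nn_integral_eq_integral) (auto simp: fmeasurable_def)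
    also have "(LINT t|lebesgue. 1/c * (\<eta> * (2 * (f t)\<^sup>2 + 2 * r\<^sup>2 * indicat_real {-R<..<R} t)
                        + 1 / (4 * \<eta>) * indicat_real (U - A) t))
       = 1/c * (\<eta> * Q + 1 / (4 * \<eta>) * measure lebesgue (U - A))"
    proof -
      have i: "integrable lebesgue (indicat_real (U - A))" using UA by (simp add: fmeasurable_def)
      have "(LINT t|lebesgue. 1/c * (\<eta> * (2 * (f t)\<^sup>2 + 2 * r\<^sup>2 * indicat_real {-R<..<R} t)
                        + 1 / (4 * \<eta>) * indicat_real (U - A) t))
        = 1/c * ((LINT t|lebesgue. \<eta> * (2 * (f t)\<^sup>2 + 2 * r\<^sup>2 * indicat_real {-R<..<R} t))
            + (LINT t|lebesgue. 1 / (4 * \<eta>) * indicat_real (U - A) t))"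
        unfolding integral_mult_right_zero
        using Bochner_Integration.integral_add[OF integrable_mult_right[OF Qint, of \<eta>] integrable_mult_right[OF i, of "1 / (4 * \<eta>)"]]
        by (simp only: integral_mult_right_zero)
      then show ?thesis by (simp add: Q_def)
    qed
    also have "ennreal \<dots> \<le> ennreal e"
    proof (rule ennreal_leI)
      have "1 / (4 * \<eta>) * measure lebesgue (U - A) \<le> 1 / (4 * \<eta>) * \<sigma>"
        using UA(2) \<eta> by (intro mult_left_mono) auto
      also have "\<dots> = c * e / 2" using \<eta> by (simp add: \<sigma>_def)
      finally show "1 / c * (\<eta> * Q + 1 / (4 * \<eta>) * measure lebesgue (U - A)) \<le> e"
        using \<eta>Q \<open>c > 0\<close> by (simp add: field_simps)
    qed
    finally have Be: "emeasure lebesgue B \<le> ennreal e" .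
    then have Bm: "B \<in> lmeasurable" "measure lebesgue B \<le> e"
      using e by (auto intro!: fmeasurableI simp: measure_def top.not_eq_extremum[symmetric] top_unique enn2real_leI)
    define N where "N = ?S - (\<Union>i \<in> C. cball (a i) (\<rho> i))"
    have N: "negligible N" using C(4) unfolding N_def .
    then have "N \<in> null_sets lebesgue" by (simp add: negligible_iff_null_sets)
    then have "measure lebesgue (B \<union> N) \<le> e"
      using Bm(2) by (simp add: measure_Un_null_set)
    moreover have "B \<union> N \<in> lmeasurable"
      by (rule fmeasurable.Un[OF Bm(1) negligible_imp_measurable[OF N]])
    moreover have "?S \<subseteq> B \<union> N"
      by (auto simp: N_def B_def J_def cball A_def)
    ultimately show "\<exists>T. ?S \<subseteq> T \<and> T \<in> lmeasurable \<and> measure lebesgue T \<le> e" by blast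
  qed
qed

text \<open>A countable union of steep sets, for rational \<open>r\<close>, of \<open>f\<close> and of \<open>- f\<close>, is exceptional. The intervals
  are only required to contain \<open>t\<close>, so that the result applies to the cells of a partition.\<close>
lemma AE_lebesgue_differentiation_real:
  fixes f :: "real \<Rightarrow> real"
  assumes meas: "f \<in> borel_measurable lebesgue" and sq: "integrable lebesgue (\<lambda>t. (f t)\<^sup>2)"
  shows "AE t in lebesgue. \<forall>e>0. \<exists>d>0. \<forall>x y. x \<le> t \<and> t \<le> y \<and> x < y \<and> y - x < d \<longrightarrow>
           \<bar>integral {x..y} f - f t * (y - x)\<bar> \<le> e * (y - x)"
proof -
  define steep where "steep f = (\<lambda>(r::real, k::nat, n::nat). {t. f t \<le> r - 1 / Suc k \<and> \<bar>t\<bar> < real (Suc n) \<and>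
    (\<forall>d>0. \<exists>x y. x \<le> t \<and> t \<le> y \<and> x < y \<and> y - x < d \<and> integral {x..y} f > r * (y - x))})" for f :: "real \<Rightarrow> real"
  define I where "I = (\<rat> :: real set) \<times> (UNIV :: (nat \<times> nat) set)"
  have cI: "countable I" unfolding I_def by (intro countable_SIGMA countable_rat) auto
  have neg: "negligible (steep f i)" if "f \<in> borel_measurable lebesgue" "integrable lebesgue (\<lambda>t. (f t)\<^sup>2)" for f i
  proof (cases i)
    case (fields r k n)
    show ?thesis
      using negligible_steep_set[OF that, of "1 / real (Suc k)" "real (Suc n)" r]
      unfolding steep_def fields prod.case by simp
  qed
  define N where "N = (\<Union>i\<in>I. steep f i) \<union> (\<Union>i\<in>I. steep (\<lambda>t. - f t) i)"
  have "negligible N"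
    unfolding N_def using cI assms
    by (intro negligible_Un negligible_countable_Union) (auto intro!: neg)
  have upper: "\<exists>d>0. \<forall>x y. x \<le> t \<and> t \<le> y \<and> x < y \<and> y - x < d \<longrightarrow> integral {x..y} f \<le> (f t + e) * (y - x)"
    if t: "t \<notin> (\<Union>i\<in>I. steep f i)" and e: "e > 0" for f t e
  proof -
    obtain r where r: "r \<in> \<rat>" "f t < r" "r < f t + e"
      using Rats_dense_in_real[of "f t" "f t + e"] e by auto
    obtain k where k: "1 / real (Suc k) < r - f t"
      using reals_Archimedean[of "r - f t"] r by (auto simp: inverse_eq_divide)
    obtain n where n: "\<bar>t\<bar> < real (Suc n)" using reals_Archimedean2[of "\<bar>t\<bar>"] by (metis less_Suc_eq of_nat_less_iff order.strict_trans lessI)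
    have "(r, k, n) \<in> I" using r by (simp add: I_def)
    then have "t \<notin> steep f (r, k, n)" using t by blast
    moreover have "f t \<le> r - 1 / Suc k" using k by simp
    ultimately have "\<not> (\<forall>d>0. \<exists>x y. x \<le> t \<and> t \<le> y \<and> x < y \<and> y - x < d \<and> integral {x..y} f > r * (y - x))"
      using n unfolding steep_def prod.case mem_Collect_eq by blast
    then obtain d where "d > 0" and d: "\<And>x y. x \<le> t \<Longrightarrow> t \<le> y \<Longrightarrow> x < y \<Longrightarrow> y - x < d \<Longrightarrow> integral {x..y} f \<le> r * (y - x)"
      by (meson not_less)
    have "r * (y - x) \<le> (f t + e) * (y - x)" if "x < y" for x y
      using that r by (intro mult_right_mono) auto
    then show ?thesis using \<open>d > 0\<close> d by (meson order_trans)
  qed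
  show ?thesis
  proof (rule AE_I')
    show "N \<in> null_sets lebesgue" using \<open>negligible N\<close> by (simp add: negligible_iff_null_sets)
    show "{t \<in> space lebesgue. \<not> (\<forall>e>0. \<exists>d>0. \<forall>x y. x \<le> t \<and> t \<le> y \<and> x < y \<and> y - x < d \<longrightarrow>
           \<bar>integral {x..y} f - f t * (y - x)\<bar> \<le> e * (y - x))} \<subseteq> N"
    proof (rule ccontr)
      assume "\<not> ?thesis"
      then obtain t e where t: "t \<notin> N" "e > 0" and
        no: "\<not> (\<exists>d>0. \<forall>x y. x \<le> t \<and> t \<le> y \<and> x < y \<and> y - x < d \<longrightarrow> \<bar>integral {x..y} f - f t * (y - x)\<bar> \<le> e * (y - x))"
        by auto
      obtain d1 where d1: "d1 > 0" "\<And>x y. x \<le> t \<and> t \<le> y \<and> x < y \<and> y - x < d1 \<longrightarrow> integral {x..y} f \<le> (f t + e) * (y - x)"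
        using upper[of t f e] t by (auto simp: N_def)
      obtain d2 where d2: "d2 > 0" "\<And>x y. x \<le> t \<and> t \<le> y \<and> x < y \<and> y - x < d2 \<longrightarrow> integral {x..y} (\<lambda>t. - f t) \<le> (- f t + e) * (y - x)"
        using upper[of t "\<lambda>t. - f t" e] t by (auto simp: N_def)
      have "\<bar>integral {x..y} f - f t * (y - x)\<bar> \<le> e * (y - x)"
        if "x \<le> t" "t \<le> y" "x < y" "y - x < min d1 d2" for x y
        using d1(2)[of x y] d2(2)[of x y] that by (simp add: integral_neg algebra_simps abs_le_iff)
      moreover have "min d1 d2 > 0" using d1 d2 by simp
      ultimately show False using no by blast
    qed
  qed
qed

section \<open>Primitives of square integrable functions\<close>

lemma integrable_lebesgue_on_iff:
  fixes f :: "'a::euclidean_space \<Rightarrow> 'b::euclidean_space"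
  shows "S \<in> sets lebesgue \<Longrightarrow> integrable (lebesgue_on S) f \<longleftrightarrow> f absolutely_integrable_on S"
  by (simp add: integrable_restrict_space set_integrable_def)

lemma L2_measurable: "v \<in> L2 T \<Longrightarrow> v \<in> borel_measurable (lebesgue_on {0..T})"
  by (simp add: L2_def)

lemma L2_square_integrable: "v \<in> L2 T \<Longrightarrow> (\<lambda>t. (norm (v t))\<^sup>2) absolutely_integrable_on {0..T}"
  by (simp add: L2_def integrable_lebesgue_on_iff)

lemma measurable_square_integrable_imp_absolutely_integrable:
  fixes v :: "real \<Rightarrow> 'a::euclidean_space"
  assumes "v \<in> borel_measurable (lebesgue_on {a..b})" "(\<lambda>t. (norm (v t))\<^sup>2) integrable_on {a..b}"
  shows "v absolutely_integrable_on {a..b}"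
proof (rule measurable_bounded_by_integrable_imp_absolutely_integrable)
  show "(\<lambda>t. 1 + (norm (v t))\<^sup>2) integrable_on {a..b}"
    using assms(2) by (intro integrable_add) auto
  show "norm (v t) \<le> 1 + (norm (v t))\<^sup>2" for t
    by (smt (verit, best) power2_eq_square self_le_power mult_le_cancel_left1 zero_le_power2 norm_ge_zero)
qed (use assms in auto)

lemma L2_absolutely_integrable: "v \<in> L2 T \<Longrightarrow> v absolutely_integrable_on {0..T}"
  by (rule measurable_square_integrable_imp_absolutely_integrable)
    (auto simp: L2_measurable intro: set_lebesgue_integral_eq_integral(1) L2_square_integrable)

lemma L2_integrable_on:
  assumes "v \<in> L2 T" "{a..b} \<subseteq> {0..T}"
  shows "v integrable_on {a..b}" "(\<lambda>t. norm (v t)) integrable_on {a..b}" "(\<lambda>t. (norm (v t))\<^sup>2) integrable_on {a..b}"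
  using absolutely_integrable_on_subinterval[OF L2_absolutely_integrable[OF assms(1)] assms(2)]
    absolutely_integrable_on_subinterval[OF L2_square_integrable[OF assms(1)] assms(2)]
  by (auto simp: absolutely_integrable_on_def)

lemma nn_integral_L2:
  assumes "v \<in> L2 T"
  shows "(\<integral>\<^sup>+t. ennreal ((norm (v t))\<^sup>2) \<partial>lebesgue_on {0..T}) = ennreal (integral {0..T} (\<lambda>t. (norm (v t))\<^sup>2))"
proof -
  have "integrable (lebesgue_on {0..T}) (\<lambda>t. (norm (v t))\<^sup>2)" using assms by (simp add: L2_def)
  then show ?thesis
    by (subst nn_integral_eq_integral) (auto simp: lebesgue_integral_eq_integral)
qed

lemma L2_I:
  assumes "v \<in> borel_measurable (lebesgue_on {0..T})"
    "(\<integral>\<^sup>+t. ennreal ((norm (v t))\<^sup>2) \<partial>lebesgue_on {0..T}) < \<infinity>"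
  shows "v \<in> L2 T"
  using assms by (auto simp: L2_def integrable_iff_bounded)

lemma continuous_imp_L2:
  assumes "continuous_on {0..T} u"
  shows "u \<in> L2 T"
proof -
  have "(\<lambda>t. (norm (u t))\<^sup>2) absolutely_integrable_on {0..T}"
    using assms by (intro absolutely_integrable_continuous_real continuous_intros)
  then show ?thesis
    using assms by (auto simp: L2_def integrable_lebesgue_on_iff continuous_imp_measurable_on_sets_lebesgue)
qed

lemma L2_diff:
  assumes "u \<in> L2 T" "v \<in> L2 T"
  shows "(\<lambda>t. u t - v t) \<in> L2 T"
proof -
  have "integrable (lebesgue_on {0..T}) (\<lambda>t. (norm (u t - v t))\<^sup>2)"
  proof (rule Bochner_Integration.integrable_bound)
    show "integrable (lebesgue_on {0..T}) (\<lambda>t. 2 * (norm (u t))\<^sup>2 + 2 * (norm (v t))\<^sup>2)"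
      using assms by (simp add: L2_def)
    have "(norm (u t - v t))\<^sup>2 \<le> 2 * (norm (u t))\<^sup>2 + 2 * (norm (v t))\<^sup>2" for t
    proof -
      have "(norm (u t - v t))\<^sup>2 \<le> (norm (u t) + norm (v t))\<^sup>2"
        by (intro power_mono norm_triangle_ineq4) auto
      also have "\<dots> \<le> 2 * (norm (u t))\<^sup>2 + 2 * (norm (v t))\<^sup>2"
        using zero_le_power2[of "norm (u t) - norm (v t)"] by (simp add: power2_eq_square algebra_simps)
      finally show ?thesis .
    qed
    then show "AE t in lebesgue_on {0..T}. norm ((norm (u t - v t))\<^sup>2) \<le> norm (2 * (norm (u t))\<^sup>2 + 2 * (norm (v t))\<^sup>2)"
      by (auto simp: abs_of_nonneg)
    show "(\<lambda>t. (norm (u t - v t))\<^sup>2) \<in> borel_measurable (lebesgue_on {0..T})"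
      using L2_measurable[OF assms(1)] L2_measurable[OF assms(2)] by simp
  qed
  then show ?thesis using L2_measurable[OF assms(1)] L2_measurable[OF assms(2)] by (simp add: L2_def)
qed

text \<open>Cauchy-Schwarz, from integrating the square of the deviation of \<open>norm (f x)\<close> from its mean.\<close>
lemma integral_norm_square_le:
  fixes f :: "real \<Rightarrow> 'a::euclidean_space"
  assumes "f integrable_on {s..t}" "(\<lambda>x. norm (f x)) integrable_on {s..t}" "(\<lambda>x. (norm (f x))\<^sup>2) integrable_on {s..t}" "s \<le> t"
  shows "(norm (integral {s..t} f))\<^sup>2 \<le> (t - s) * integral {s..t} (\<lambda>x. (norm (f x))\<^sup>2)"
    and "(integral {s..t} (\<lambda>x. norm (f x)))\<^sup>2 \<le> (t - s) * integral {s..t} (\<lambda>x. (norm (f x))\<^sup>2)"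
proof -
  define I1 where "I1 = integral {s..t} (\<lambda>x. norm (f x))"
  define I2 where "I2 = integral {s..t} (\<lambda>x. (norm (f x))\<^sup>2)"
  have le: "norm (integral {s..t} f) \<le> I1"
    unfolding I1_def using assms by (intro integral_norm_bound_integral) auto
  have I1: "I1\<^sup>2 \<le> (t - s) * I2"
  proof (cases "s = t")
    case False
    then have st: "s < t" using assms by simp
    define m where "m = I1 / (t - s)"
    have "((\<lambda>x. (norm (f x))\<^sup>2 - 2 * m * norm (f x) + m\<^sup>2) has_integral
        I2 - 2 * m * I1 + (t - s) *\<^sub>R m\<^sup>2) {s..t}"
      unfolding I1_def I2_def using assms
      by (intro has_integral_add has_integral_diff has_integral_mult_right integrable_integral)
        (use has_integral_const_real[of "m\<^sup>2" s t] assms in \<open>simp_all\<close>)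
    then have "((\<lambda>x. (norm (f x) - m)\<^sup>2) has_integral I2 - 2 * m * I1 + (t - s) *\<^sub>R m\<^sup>2) {s..t}"
      by (rule has_integral_eq[rotated]) (simp add: power2_eq_square algebra_simps)
    then have "0 \<le> I2 - 2 * m * I1 + (t - s) *\<^sub>R m\<^sup>2"
      by (rule has_integral_nonneg) simp
    also have "(t - s) *\<^sub>R m\<^sup>2 = m * I1"
      using st by (simp add: m_def power2_eq_square)
    also have "I2 - 2 * m * I1 + m * I1 = I2 - I1\<^sup>2 / (t - s)"
      by (simp add: m_def power2_eq_square)
    finally show ?thesis using st by (simp add: field_simps)
  qed (simp add: I1_def I2_def)
  show "(integral {s..t} (\<lambda>x. norm (f x)))\<^sup>2 \<le> (t - s) * integral {s..t} (\<lambda>x. (norm (f x))\<^sup>2)"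
    using I1 by (simp add: I1_def I2_def)
  show "(norm (integral {s..t} f))\<^sup>2 \<le> (t - s) * integral {s..t} (\<lambda>x. (norm (f x))\<^sup>2)"
    using power_mono[OF le, of 2] I1 by (simp add: I2_def)
qed

definition primitive_of :: "real \<Rightarrow> (real \<Rightarrow> 'a::euclidean_space) \<Rightarrow> (real \<Rightarrow> 'a) \<Rightarrow> bool" where
  "primitive_of T v u \<longleftrightarrow> v \<in> L2 T \<and> (\<forall>t\<in>{0..T}. u t = u 0 + integral {0..t} v)"

lemma primitive_L2: "primitive_of T v u \<Longrightarrow> v \<in> L2 T"
  unfolding primitive_of_def by blast

lemma primitive_eq: "primitive_of T v u \<Longrightarrow> t \<in> {0..T} \<Longrightarrow> u t = u 0 + integral {0..t} v"
  unfolding primitive_of_def by blast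

lemma primitive_increment:
  assumes "primitive_of T v u" "0 \<le> s" "s \<le> t" "t \<le> T"
  shows "u t - u s = integral {s..t} v"
proof -
  have "integral {0..s} v + integral {s..t} v = integral {0..t} v"
    using assms(2-4) by (intro Henstock_Kurzweil_Integration.integral_combine L2_integrable_on[OF primitive_L2[OF assms(1)]]) auto
  moreover have "u s = u 0 + integral {0..s} v" "u t = u 0 + integral {0..t} v"
    using assms(2-4) by (auto intro!: primitive_eq[OF assms(1)])
  ultimately show ?thesis by (simp add: algebra_simps)
qed

lemma primitive_continuous:
  assumes "primitive_of T v u"
  shows "continuous_on {0..T} u"
proof -
  have "continuous_on {0..T} (\<lambda>t. u 0 + integral {0..t} v)"
    using L2_integrable_on[OF primitive_L2[OF assms], of 0 T]
    by (intro continuous_intros indefinite_integral_continuous_1) auto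
  then show ?thesis
    by (rule continuous_on_eq) (simp only: primitive_eq[OF assms])
qed

text \<open>By Cauchy-Schwarz each cell of a partition contributes at most its share of the integral.\<close>
lemma primitive_energy_le:
  assumes "primitive_of T v u"
  shows "energy 0 T u \<le> ennreal (integral {0..T} (\<lambda>t. (norm (v t))\<^sup>2))"
proof -
  define q where "q t = (norm (v t))\<^sup>2" for t
  have v: "v \<in> L2 T" by (rule primitive_L2[OF assms])
  have q_int: "q integrable_on {s..t}" if "0 \<le> s" "t \<le> T" for s t
    unfolding q_def using L2_integrable_on(3)[OF v] that by auto
  have *: "partition_sum u xs \<le> integral {hd xs..last xs} q" if "sorted xs" "set xs \<subseteq> {0..T}" "xs \<noteq> []" for xs
    using that
  proof (induction xs rule: induct_list012)
    case (3 x y zs)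
    have xy: "0 \<le> x" "x \<le> y" "y \<le> T" using 3 by auto
    have "(norm (u y - u x))\<^sup>2 \<le> (y - x) * integral {x..y} q"
      unfolding q_def primitive_increment[OF assms xy]
      using xy by (intro integral_norm_square_le(1) L2_integrable_on[OF v]) auto
    then have "(norm (u y - u x))\<^sup>2 / (y - x) \<le> integral {x..y} q"
      using xy by (cases "x = y") (auto simp: field_simps)
    moreover have "partition_sum u (y # zs) \<le> integral {y..last (y # zs)} q"
      using 3 by auto
    moreover have "last (y # zs) \<in> set (y # zs)" by (rule last_in_set) simp
    then have "y \<le> last (y # zs)" "last (y # zs) \<le> T" using 3 by auto
    then have "integral {x..y} q + integral {y..last (y # zs)} q = integral {x..last (y # zs)} q"
      using xy by (intro Henstock_Kurzweil_Integration.integral_combine q_int) auto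
    ultimately show ?case by simp
  qed auto
  show ?thesis
  proof (rule energy_least)
    fix xs :: "real list" assume xs: "sorted xs" "set xs \<subseteq> {0..T}"
    show "ennreal (partition_sum u xs) \<le> ennreal (integral {0..T} (\<lambda>t. (norm (v t))\<^sup>2))"
    proof (cases "xs = []")
      case True
      then show ?thesis by simp
    next
      case False
      have "hd xs \<in> {0..T}" "last xs \<in> {0..T}"
        using xs(2) False hd_in_set last_in_set by blast+
      then have "integral {hd xs..last xs} q \<le> integral {0..T} q"
        by (intro integral_subset_le q_int) (auto simp: q_def)
      then show ?thesis
        using *[OF xs False] by (intro ennreal_leI) (simp add: q_def[abs_def])
    qed
  qed
qed

text \<open>Lebesgue differentiation in each coordinate, for increments over all short intervals around \<open>t\<close> and
  not only over those with end point \<open>t\<close>.\<close>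
lemma primitive_AE_slope:
  fixes v :: "real \<Rightarrow> 'a::euclidean_space"
  assumes "primitive_of T v u"
  shows "AE t in lebesgue_on {0..T}. \<forall>e>0. \<exists>d>0. \<forall>x y. 0 \<le> x \<and> x \<le> t \<and> t \<le> y \<and> y \<le> T \<and> x < y \<and> y - x < d \<longrightarrow>
           norm (u y - u x - (y - x) *\<^sub>R v t) \<le> e * (y - x)"
proof -
  have v: "v \<in> L2 T" by (rule primitive_L2[OF assms])
  define f where "f b t = (if t \<in> {0..T} then v t \<bullet> b else 0)" for b t
  have AE1: "AE t in lebesgue. \<forall>e>0. \<exists>d>0. \<forall>x y. x \<le> t \<and> t \<le> y \<and> x < y \<and> y - x < d \<longrightarrow>
           \<bar>integral {x..y} (f b) - f b t * (y - x)\<bar> \<le> e * (y - x)" if b: "b \<in> Basis" for b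
  proof (rule AE_lebesgue_differentiation_real)
    have m: "(\<lambda>t. v t \<bullet> b) \<in> borel_measurable (lebesgue_on {0..T})"
      by (intro borel_measurable_inner L2_measurable[OF v]) simp
    then show "f b \<in> borel_measurable lebesgue"
      unfolding f_def by (subst borel_measurable_if) auto
    have "integrable (lebesgue_on {0..T}) (\<lambda>t. (v t \<bullet> b)\<^sup>2)"
    proof (rule Bochner_Integration.integrable_bound)
      show "integrable (lebesgue_on {0..T}) (\<lambda>t. (norm (v t))\<^sup>2)" using v by (simp add: L2_def)
      show "AE t in lebesgue_on {0..T}. norm ((v t \<bullet> b)\<^sup>2) \<le> norm ((norm (v t))\<^sup>2)"
      proof (rule AE_I2)
        fix t
        have "(\<bar>v t \<bullet> b\<bar>)\<^sup>2 \<le> (norm (v t))\<^sup>2" using b by (intro power_mono) (auto simp: Basis_le_norm)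
        then show "norm ((v t \<bullet> b)\<^sup>2) \<le> norm ((norm (v t))\<^sup>2)" by simp
      qed
    qed (intro borel_measurable_power m)
    then have "integrable lebesgue (\<lambda>t. if t \<in> {0..T} then (v t \<bullet> b)\<^sup>2 else 0)"
      by (subst Lebesgue_Measure.integrable_restrict_UNIV) auto
    also have "(\<lambda>t. if t \<in> {0..T} then (v t \<bullet> b)\<^sup>2 else 0) = (\<lambda>t. (f b t)\<^sup>2)" by (auto simp: f_def)
    finally show "integrable lebesgue (\<lambda>t. (f b t)\<^sup>2)" .
  qed
  have AE2: "AE t in lebesgue. \<forall>b\<in>Basis. \<forall>e>0. \<exists>d>0. \<forall>x y. x \<le> t \<and> t \<le> y \<and> x < y \<and> y - x < d \<longrightarrow>
           \<bar>integral {x..y} (f b) - f b t * (y - x)\<bar> \<le> e * (y - x)"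
    using AE1 by (intro AE_finite_allI) auto
  have S: "{0..T} \<inter> space lebesgue \<in> sets lebesgue" by simp
  show ?thesis
    unfolding AE_restrict_space_iff[OF S]
    using AE2
  proof eventually_elim
    case (elim t)
    show ?case
    proof (intro impI allI)
      fix e :: real assume t: "t \<in> {0..T}" and e: "e > 0"
      have e': "e / DIM('a) > 0" using e by simp
      have "\<forall>b\<in>Basis. \<exists>d>0. \<forall>x y. x \<le> t \<and> t \<le> y \<and> x < y \<and> y - x < d \<longrightarrow>
           \<bar>integral {x..y} (f b) - f b t * (y - x)\<bar> \<le> e / DIM('a) * (y - x)"
        using elim e' by blast
      from bchoice[OF this] obtain D where D: "\<And>b. b \<in> Basis \<Longrightarrow> D b > 0"
        "\<And>b x y. b \<in> Basis \<Longrightarrow> x \<le> t \<Longrightarrow> t \<le> y \<Longrightarrow> x < y \<Longrightarrow> y - x < D b \<Longrightarrow>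
           \<bar>integral {x..y} (f b) - f b t * (y - x)\<bar> \<le> e / DIM('a) * (y - x)" by metis
      show "\<exists>d>0. \<forall>x y. 0 \<le> x \<and> x \<le> t \<and> t \<le> y \<and> y \<le> T \<and> x < y \<and> y - x < d \<longrightarrow>
           norm (u y - u x - (y - x) *\<^sub>R v t) \<le> e * (y - x)"
      proof (intro exI[of _ "Min (D ` Basis)"] conjI allI impI)
        show "Min (D ` Basis) > 0" using D by simp
        fix x y assume xy: "0 \<le> x \<and> x \<le> t \<and> t \<le> y \<and> y \<le> T \<and> x < y \<and> y - x < Min (D ` Basis)"
        have inc: "u y - u x = integral {x..y} v" using xy by (intro primitive_increment[OF assms]) auto
        have vi: "v integrable_on {x..y}" using xy by (intro L2_integrable_on[OF v]) auto
        have "norm (u y - u x - (y - x) *\<^sub>R v t) \<le> (\<Sum>b\<in>Basis. \<bar>(u y - u x - (y - x) *\<^sub>R v t) \<bullet> b\<bar>)"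
          by (rule norm_le_l1)
        also have "\<dots> \<le> (\<Sum>b\<in>(Basis :: 'a set). e / DIM('a) * (y - x))"
        proof (rule sum_mono)
          fix b :: 'a assume b: "b \<in> Basis"
          have "integral {x..y} v \<bullet> b = integral {x..y} (\<lambda>s. v s \<bullet> b)"
            by (rule integral_component_eq[OF vi, symmetric])
          also have "\<dots> = integral {x..y} (f b)"
            using xy by (intro Henstock_Kurzweil_Integration.integral_cong) (auto simp: f_def)
          finally have "(u y - u x - (y - x) *\<^sub>R v t) \<bullet> b = integral {x..y} (f b) - f b t * (y - x)"
            using t by (simp add: inc f_def inner_diff_left)
          then show "\<bar>(u y - u x - (y - x) *\<^sub>R v t) \<bullet> b\<bar> \<le> e / DIM('a) * (y - x)"
            using D(2)[OF b, of x y] xy b by auto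
        qed
        also have "\<dots> = e * (y - x)" by simp
        finally show "norm (u y - u x - (y - x) *\<^sub>R v t) \<le> e * (y - x)" .
      qed
    qed
  qed
qed

lemma AE_lebesgue_on_interior:
  "AE t in lebesgue_on {a..b}. a < t \<and> t < b" for a b :: real
proof -
  have "{a, b} \<in> null_sets lebesgue" by (simp flip: negligible_iff_null_sets)
  then have "AE t in lebesgue. t \<notin> {a, b}" by (rule AE_not_in)
  then have "AE t in lebesgue. t \<in> {a..b} \<longrightarrow> a < t \<and> t < b"
    by (rule eventually_mono) auto
  then show ?thesis by (subst AE_restrict_space_iff) auto
qed

lemma primitive_AE_derivative:
  assumes "primitive_of T v u"
  shows "AE t in lebesgue_on {0..T}. (u has_vector_derivative v t) (at t within {0..T})"
  using primitive_AE_slope[OF assms] AE_lebesgue_on_interior[of 0 T]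
proof eventually_elim
  case (elim t)
  show ?case
    unfolding has_vector_derivative_def has_derivative_within_alt
  proof (intro conjI allI impI bounded_linear_scaleR_left)
    fix e :: real assume "e > 0"
    from spec[OF elim(1), THEN mp, OF this]
    obtain d where d0: "d > 0" "\<forall>x y. 0 \<le> x \<and> x \<le> t \<and> t \<le> y \<and> y \<le> T \<and> x < y \<and> y - x < d \<longrightarrow>
           norm (u y - u x - (y - x) *\<^sub>R v t) \<le> e * (y - x)" by (elim exE conjE)
    have d: "d > 0" "\<And>x y. 0 \<le> x \<Longrightarrow> x \<le> t \<Longrightarrow> t \<le> y \<Longrightarrow> y \<le> T \<Longrightarrow> x < y \<Longrightarrow> y - x < d \<Longrightarrow>
           norm (u y - u x - (y - x) *\<^sub>R v t) \<le> e * (y - x)"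
      using d0 by simp_all
    show "\<exists>d>0. \<forall>y\<in>{0..T}. norm (y - t) < d \<longrightarrow> norm (u y - u t - (y - t) *\<^sub>R v t) \<le> e * norm (y - t)"
    proof (intro exI[of _ d] conjI ballI impI)
      fix y assume y: "y \<in> {0..T}" "norm (y - t) < d"
      consider "y = t" | "y < t" | "t < y" by linarith
      then show "norm (u y - u t - (y - t) *\<^sub>R v t) \<le> e * norm (y - t)"
      proof cases
        case 2
        have "norm (u t - u y - (t - y) *\<^sub>R v t) \<le> e * (t - y)" using 2 y elim(2) by (intro d(2)) auto
        moreover have "u t - u y - (t - y) *\<^sub>R v t = - (u y - u t - (y - t) *\<^sub>R v t)" by (simp add: algebra_simps)
        ultimately show ?thesis using 2 by (metis norm_minus_cancel abs_minus_commute abs_of_pos diff_gt_0_iff_gt real_norm_def)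
      next
        case 3
        then show ?thesis using d(2)[of t y] y elim(2) by auto
      qed auto
    qed (use d in auto)
  qed
qed

lemma primitive_unique:
  assumes "primitive_of T v u" "primitive_of T v' u"
  shows "AE t in lebesgue_on {0..T}. v t = v' t"
  using primitive_AE_derivative[OF assms(1)] primitive_AE_derivative[OF assms(2)] AE_lebesgue_on_interior[of 0 T]
proof eventually_elim
  case (elim t)
  then have "(u has_vector_derivative v t) (at t)" "(u has_vector_derivative v' t) (at t)"
    by (auto simp: at_within_Icc_at)
  then show ?case by (rule vector_derivative_unique_at)
qed

section \<open>Paths of finite energy are primitives\<close>

definition step_fun :: "real \<Rightarrow> (nat \<Rightarrow> 'a) \<Rightarrow> real \<Rightarrow> 'a" where
  "step_fun h c t = c (nat \<lfloor>t / h\<rfloor>)"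

lemma step_fun_eq:
  assumes "h > 0" "real i * h \<le> t" "t < real (Suc i) * h"
  shows "step_fun h c t = c i"
proof -
  have "\<lfloor>t / h\<rfloor> = int i"
    using assms by (intro floor_unique) (auto simp: field_simps)
  then show ?thesis by (simp add: step_fun_def)
qed

lemma has_integral_step_fun:
  fixes c :: "nat \<Rightarrow> 'a::euclidean_space"
  assumes "h > 0"
  shows "(step_fun h c has_integral (\<Sum>i<N. h *\<^sub>R c i)) {0..real N * h}"
proof (induction N)
  case 0
  then show ?case by (simp add: has_integral_refl)
next
  case (Suc N)
  have "((\<lambda>t. c N) has_integral (real (Suc N) * h - real N * h) *\<^sub>R c N) {real N * h..real (Suc N) * h}"
    using has_integral_const_real[of "c N" "real N * h" "real (Suc N) * h"] assms by simp
  then have "(step_fun h c has_integral (real (Suc N) * h - real N * h) *\<^sub>R c N) {real N * h..real (Suc N) * h}"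
  proof (rule has_integral_spike_finite[rotated 2])
    show "finite {real (Suc N) * h}" by simp
    show "step_fun h c t = c N" if "t \<in> {real N * h..real (Suc N) * h} - {real (Suc N) * h}" for t
      using that assms by (intro step_fun_eq) auto
  qed
  also have "(real (Suc N) * h - real N * h) *\<^sub>R c N = h *\<^sub>R c N" by (simp add: algebra_simps)
  finally show ?case
    using assms has_integral_combine[OF _ _ Suc.IH, of "real (Suc N) * h" "h *\<^sub>R c N"] by simp
qed

lemma step_fun_absolutely_integrable:
  fixes c :: "nat \<Rightarrow> 'a::euclidean_space"
  assumes "h > 0"
  shows "step_fun h c absolutely_integrable_on {0..real N * h}"
proof (rule absolutely_integrable_onI)
  show "step_fun h c integrable_on {0..real N * h}"
    using has_integral_step_fun[OF assms] by blast
  have "(\<lambda>t. norm (step_fun h c t)) = step_fun h (\<lambda>i. norm (c i))"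
    by (auto simp: step_fun_def)
  then show "(\<lambda>t. norm (step_fun h c t)) integrable_on {0..real N * h}"
    using has_integral_step_fun[OF assms] by auto
qed

lemma step_fun_L2:
  fixes c :: "nat \<Rightarrow> 'a::euclidean_space"
  assumes "h > 0"
  shows "step_fun h c \<in> L2 (real N * h)"
proof -
  have "step_fun h (\<lambda>i. (norm (c i))\<^sup>2) absolutely_integrable_on {0..real N * h}"
    by (rule step_fun_absolutely_integrable[OF assms])
  moreover have "step_fun h (\<lambda>i. (norm (c i))\<^sup>2) = (\<lambda>t. (norm (step_fun h c t))\<^sup>2)"
    by (auto simp: step_fun_def)
  ultimately show ?thesis
    using step_fun_absolutely_integrable[OF assms, where c = c and N = N]
    by (auto simp: L2_def integrable_lebesgue_on_iff absolutely_integrable_imp_borel_measurable)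
qed

lemma nat_floor_div:
  assumes "0 \<le> x" "p > 0"
  shows "nat \<lfloor>x / real p\<rfloor> = nat \<lfloor>x\<rfloor> div p"
proof -
  have "\<lfloor>x / real p\<rfloor> = \<lfloor>x\<rfloor> div int p"
    using floor_divide_real_eq_div[of "int p" x] by simp
  then show ?thesis using assms by (simp add: nat_div_distrib)
qed

lemma sum_square_deviation:
  fixes x :: "'i \<Rightarrow> 'a::real_inner"
  assumes "finite B" "(\<Sum>j\<in>B. x j) = real (card B) *\<^sub>R m"
  shows "(\<Sum>j\<in>B. (norm (x j - m))\<^sup>2) = (\<Sum>j\<in>B. (norm (x j))\<^sup>2) - real (card B) * (norm m)\<^sup>2"
proof -
  have "(\<Sum>j\<in>B. (norm (x j - m))\<^sup>2) = (\<Sum>j\<in>B. (norm (x j))\<^sup>2 - 2 * (x j \<bullet> m) + (norm m)\<^sup>2)"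
    by (intro sum.cong refl) (simp add: power2_norm_eq_inner inner_diff_left inner_diff_right inner_commute algebra_simps)
  also have "\<dots> = (\<Sum>j\<in>B. (norm (x j))\<^sup>2) - 2 * ((\<Sum>j\<in>B. x j) \<bullet> m) + real (card B) * (norm m)\<^sup>2"
    by (simp add: sum.distrib sum_subtractf sum_distrib_left inner_sum_left)
  also have "\<dots> = (\<Sum>j\<in>B. (norm (x j))\<^sup>2) - real (card B) * (norm m)\<^sup>2"
    by (simp add: assms(2) power2_norm_eq_inner)
  finally show ?thesis .
qed

text \<open>Averaging over coarse cells is an orthogonal projection: the squared distance between a step
  function and its averages is the difference of the squared norms.\<close>
lemma refinement_deviation:
  fixes c :: "nat \<Rightarrow> 'a::real_inner"
  assumes "p > 0" and avg: "\<And>i. i < N \<Longrightarrow> (\<Sum>j\<in>{i * p..<i * p + p}. c j) = real p *\<^sub>R d i"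
  shows "(\<Sum>j<N * p. (norm (c j - d (j div p)))\<^sup>2) = (\<Sum>j<N * p. (norm (c j))\<^sup>2) - real p * (\<Sum>i<N. (norm (d i))\<^sup>2)"
proof -
  have "(\<Sum>j<N * p. (norm (c j - d (j div p)))\<^sup>2) = (\<Sum>i<N. \<Sum>j\<in>{i * p..<i * p + p}. (norm (c j - d (j div p)))\<^sup>2)"
    by (rule sum.nat_group[symmetric])
  also have "\<dots> = (\<Sum>i<N. (\<Sum>j\<in>{i * p..<i * p + p}. (norm (c j))\<^sup>2) - real p * (norm (d i))\<^sup>2)"
  proof (rule sum.cong[OF refl])
    fix i assume i: "i \<in> {..<N}"
    have "j div p = i" if "j \<in> {i * p..<i * p + p}" for j
      using that assms(1) by (intro div_nat_eqI) (auto simp: mult.commute)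
    then have "(\<Sum>j\<in>{i * p..<i * p + p}. (norm (c j - d (j div p)))\<^sup>2) = (\<Sum>j\<in>{i * p..<i * p + p}. (norm (c j - d i))\<^sup>2)"
      by (intro sum.cong) auto
    also have "\<dots> = (\<Sum>j\<in>{i * p..<i * p + p}. (norm (c j))\<^sup>2) - real p * (norm (d i))\<^sup>2"
      using sum_square_deviation[of "{i * p..<i * p + p}" c "d i"] avg[of i] i by simp
    finally show "(\<Sum>j\<in>{i * p..<i * p + p}. (norm (c j - d (j div p)))\<^sup>2) = (\<Sum>j\<in>{i * p..<i * p + p}. (norm (c j))\<^sup>2) - real p * (norm (d i))\<^sup>2" .
  qed
  also have "\<dots> = (\<Sum>j<N * p. (norm (c j))\<^sup>2) - real p * (\<Sum>i<N. (norm (d i))\<^sup>2)"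
    by (simp add: sum_subtractf sum.nat_group sum_distrib_left)
  finally show ?thesis .
qed

definition slope :: "(real \<Rightarrow> 'a::real_normed_vector) \<Rightarrow> real \<Rightarrow> nat \<Rightarrow> 'a" where
  "slope u h i = (u (real (Suc i) * h) - u (real i * h)) /\<^sub>R h"

lemma scaleR_slope: "h > 0 \<Longrightarrow> h *\<^sub>R slope u h i = u (real (Suc i) * h) - u (real i * h)"
  by (simp add: slope_def)

lemma sum_slope:
  assumes "h > 0"
  shows "(\<Sum>i<N. h *\<^sub>R slope u h i) = u (real N * h) - u 0"
  using sum_lessThan_telescope[of "\<lambda>i. u (real i * h)" N] assms by (simp add: scaleR_slope)

text \<open>The coarse difference quotients are the averages of the fine ones, so the difference quotients along
  nested partitions form a martingale.\<close>
lemma slope_refine: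
  assumes "h > 0" "p > 0"
  shows "(\<Sum>j\<in>{i * p..<i * p + p}. slope u (h / real p) j) = real p *\<^sub>R slope u h i"
proof -
  have "(\<Sum>j\<in>{i * p..<i * p + p}. (h / real p) *\<^sub>R slope u (h / real p) j)
     = (\<Sum>j\<in>{i * p..<i * p + p}. u (real (Suc j) * (h / real p)) - u (real j * (h / real p)))"
    using assms by (intro sum.cong refl scaleR_slope) simp
  also have "\<dots> = u (real (i * p + p) * (h / real p)) - u (real (i * p) * (h / real p))"
    by (rule sum_Suc_diff'[of _ _ "\<lambda>j. u (real j * (h / real p))"]) simp
  also have "real (i * p + p) * (h / real p) = real (Suc i) * h" using assms by (simp add: field_simps)
  also have "real (i * p) * (h / real p) = real i * h" using assms by (simp add: field_simps)
  finally have "(h / real p) *\<^sub>R (\<Sum>j\<in>{i * p..<i * p + p}. slope u (h / real p) j) = h *\<^sub>R slope u h i"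
    using assms by (simp add: scaleR_sum_right scaleR_slope)
  then have "(real p / h) *\<^sub>R ((h / real p) *\<^sub>R (\<Sum>j\<in>{i * p..<i * p + p}. slope u (h / real p) j)) = (real p / h) *\<^sub>R (h *\<^sub>R slope u h i)"
    by simp
  then show ?thesis using assms by simp
qed

lemma energy_slope_le:
  assumes "h > 0"
  shows "ennreal (\<Sum>i<N. h * (norm (slope u h i))\<^sup>2) \<le> energy 0 (real N * h) u"
proof -
  have "ennreal (h * (norm (slope u h i))\<^sup>2) \<le> energy (0 + real i * h) (0 + real (Suc i) * h) u" for i
  proof -
    have "h * (norm (slope u h i))\<^sup>2 = partition_sum u [real i * h, real (Suc i) * h]"
    proof -
      have 1: "norm (slope u h i) = norm (u (real (Suc i) * h) - u (real i * h)) / h"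
        using assms by (simp add: slope_def divide_inverse mult.commute)
      have 2: "real (Suc i) * h - real i * h = h" by (simp add: algebra_simps)
      have 3: "h * (x / h)\<^sup>2 = x\<^sup>2 / h" for x using assms by (simp add: power2_eq_square)
      show ?thesis unfolding 1 partition_sum.simps 2 3 by simp
    qed
    moreover have "ennreal (partition_sum u [real i * h, real (Suc i) * h]) \<le> energy (0 + real i * h) (0 + real (Suc i) * h) u"
      using assms by (intro energy_upper) (auto simp: algebra_simps)
    ultimately show ?thesis by simp
  qed
  then have "(\<Sum>i<N. ennreal (h * (norm (slope u h i))\<^sup>2)) \<le> (\<Sum>i<N. energy (0 + real i * h) (0 + real (Suc i) * h) u)"
    by (intro sum_mono)
  then show ?thesis
    using energy_uniform_split[of h 0 N u] assms by (subst (asm) sum_ennreal) auto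
qed

text \<open>The step functions \<open>V n\<close> of dyadic difference quotients form a martingale that is bounded in
  \<open>L\<^sup>2\<close> by the energy. Their squared norms \<open>A n\<close> increase, so by orthogonality the sequence is Cauchy; the
  derivative is the almost everywhere limit \<open>v\<close> of a subsequence, and Fatou's lemma gives the bound on its
  norm. The integral of \<open>V n\<close> up to a dyadic point is the exact increment of \<open>u\<close>, and dyadic points
  approximate every point because \<open>u\<close> is continuous.\<close>
lemma energy_imp_primitive:
  fixes u :: "real \<Rightarrow> 'a::euclidean_space"
  assumes "T > 0" "0 \<le> K" and energy: "energy 0 T u \<le> ennreal K"
  obtains v where "primitive_of T v u" "integral {0..T} (\<lambda>t. (norm (v t))\<^sup>2) \<le> K"
proof -
  define h where "h n = T / 2 ^ n" for n :: nat
  have h: "h n > 0" for n using assms by (simp add: h_def)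
  have Nh: "real (2 ^ n) * h n = T" for n by (simp add: h_def)
  define c where "c n = slope u (h n)" for n
  define V where "V n = step_fun (h n) (c n)" for n
  have VL2: "V n \<in> L2 T" for n
    using step_fun_L2[OF h[of n], where c = "c n" and N = "2 ^ n"] by (simp add: Nh V_def del: of_nat_power)
  define A where "A n = (\<Sum>i<2 ^ n. h n * (norm (c n i))\<^sup>2)" for n
  have A_le: "A n \<le> K" for n
  proof -
    have "ennreal (A n) \<le> ennreal K"
      unfolding A_def c_def using energy_slope_le[OF h[of n], where N = "2 ^ n" and u = u] energy
      by (auto simp: Nh simp del: of_nat_power)
    then show ?thesis using assms by (simp add: ennreal_le_iff)
  qed
  have intV: "integral {0..T} (\<lambda>t. (norm (V n t))\<^sup>2) = A n" for n
  proof -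
    have "(step_fun (h n) (\<lambda>i. (norm (c n i))\<^sup>2) has_integral (\<Sum>i<2 ^ n. h n *\<^sub>R (norm (c n i))\<^sup>2)) {0..T}"
      using has_integral_step_fun[OF h[of n], where c = "\<lambda>i. (norm (c n i))\<^sup>2" and N = "2 ^ n"] by (simp add: Nh del: of_nat_power)
    then show ?thesis by (intro integral_unique) (simp add: A_def V_def step_fun_def[abs_def])
  qed
  have hk: "h (n + k) = h n / real (2 ^ k)" for n k by (simp add: h_def power_add)
  have diff: "integral {0..T} (\<lambda>t. (norm (V (n + k) t - V n t))\<^sup>2) = A (n + k) - A n" for n k
  proof -
    have eq: "V (n + k) t - V n t = step_fun (h (n + k)) (\<lambda>j. c (n + k) j - c n (j div 2 ^ k)) t" if "t \<in> {0..T}" for t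
    proof -
      have "t / h n = t / h (n + k) / real (2 ^ k)" unfolding hk by simp
      then have "nat \<lfloor>t / h n\<rfloor> = nat \<lfloor>t / h (n + k)\<rfloor> div 2 ^ k"
        using nat_floor_div[of "t / h (n + k)" "2 ^ k"] that h[of "n + k"] by auto
      then show ?thesis by (simp add: V_def step_fun_def)
    qed
    have "integral {0..T} (\<lambda>t. (norm (V (n + k) t - V n t))\<^sup>2)
      = integral {0..T} (step_fun (h (n + k)) (\<lambda>j. (norm (c (n + k) j - c n (j div 2 ^ k)))\<^sup>2))"
      by (intro Henstock_Kurzweil_Integration.integral_cong) (simp add: eq, simp add: step_fun_def)
    also have "\<dots> = (\<Sum>j<2 ^ (n + k). h (n + k) *\<^sub>R (norm (c (n + k) j - c n (j div 2 ^ k)))\<^sup>2)"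
      using has_integral_step_fun[OF h[of "n + k"], where c = "\<lambda>j. (norm (c (n + k) j - c n (j div 2 ^ k)))\<^sup>2" and N = "2 ^ (n + k)"]
      by (intro integral_unique) (simp add: Nh del: of_nat_power)
    also have "\<dots> = h (n + k) * (\<Sum>j<2 ^ n * 2 ^ k. (norm (c (n + k) j - c n (j div 2 ^ k)))\<^sup>2)"
      by (simp add: sum_distrib_left power_add)
    also have "(\<Sum>j<2 ^ n * 2 ^ k. (norm (c (n + k) j - c n (j div 2 ^ k)))\<^sup>2)
      = (\<Sum>j<2 ^ n * 2 ^ k. (norm (c (n + k) j))\<^sup>2) - real (2 ^ k) * (\<Sum>i<2 ^ n. (norm (c n i))\<^sup>2)"
      unfolding c_def hk using slope_refine[OF h[of n], where p = "2 ^ k"] by (intro refinement_deviation) auto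
    also have "h (n + k) * \<dots> = A (n + k) - A n"
      by (simp add: A_def right_diff_distrib sum_distrib_left power_add hk)
    finally show ?thesis .
  qed
  have mono: "incseq A"
  proof (rule incseq_SucI)
    fix n
    have "0 \<le> integral {0..T} (\<lambda>t. (norm (V (n + 1) t - V n t))\<^sup>2)"
      by (cases "(\<lambda>t. (norm (V (n + 1) t - V n t))\<^sup>2) integrable_on {0..T}")
        (auto intro: integral_nonneg simp: not_integrable_integral)
    then show "A n \<le> A (Suc n)" unfolding diff by simp
  qed
  obtain a where a: "A \<longlonglongrightarrow> a" "\<And>n. A n \<le> a" using incseq_convergent[OF mono, of K] A_le by auto
  have L1: "integral {0..T} (\<lambda>t. norm (V m t - V n t)) \<le> sqrt (T * (a - A n))" if nm: "n \<le> m" for m n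
  proof -
    obtain k where m: "m = n + k" using le_Suc_ex[OF nm] by blast
    have meas: "(\<lambda>t. V m t - V n t) \<in> borel_measurable (lebesgue_on {0..T})"
      by (intro borel_measurable_diff L2_measurable VL2)
    have D: "(\<lambda>t. V m t - V n t) absolutely_integrable_on {0..T}"
      by (intro set_integral_diff L2_absolutely_integrable VL2)
    have sq: "(\<lambda>t. (norm (V m t - V n t))\<^sup>2) integrable_on {0..T}"
    proof (rule measurable_bounded_by_integrable_imp_integrable)
      show "(\<lambda>t. 2 * (norm (V m t))\<^sup>2 + 2 * (norm (V n t))\<^sup>2) integrable_on {0..T}"
        by (intro integrable_add integrable_on_mult_right L2_integrable_on[OF VL2]) auto
      show "(\<lambda>t. (norm (V m t - V n t))\<^sup>2) \<in> borel_measurable (lebesgue_on {0..T})"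
        using meas by simp
      fix t
      have "(norm (V m t - V n t))\<^sup>2 \<le> (norm (V m t) + norm (V n t))\<^sup>2"
        by (intro power_mono norm_triangle_ineq4) auto
      also have "\<dots> \<le> 2 * (norm (V m t))\<^sup>2 + 2 * (norm (V n t))\<^sup>2"
        using zero_le_power2[of "norm (V m t) - norm (V n t)"] by (simp add: power2_eq_square algebra_simps)
      finally show "norm ((norm (V m t - V n t))\<^sup>2) \<le> 2 * (norm (V m t))\<^sup>2 + 2 * (norm (V n t))\<^sup>2" by simp
    qed auto
    have "(integral {0..T} (\<lambda>t. norm (V m t - V n t)))\<^sup>2 \<le> (T - 0) * integral {0..T} (\<lambda>t. (norm (V m t - V n t))\<^sup>2)"
      using D sq assms by (intro integral_norm_square_le(2)) (auto simp: absolutely_integrable_on_def)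
    also have "\<dots> \<le> T * (a - A n)"
      unfolding m diff using a(2)[of "n + k"] assms by simp
    finally show ?thesis by (rule real_le_rsqrt)
  qed
  have lim0: "(\<lambda>n. sqrt (T * (a - A n))) \<longlonglongrightarrow> 0"
  proof -
    have "(\<lambda>n. sqrt (T * (a - A n))) \<longlonglongrightarrow> sqrt (T * (a - a))" by (intro tendsto_intros a(1))
    then show ?thesis by simp
  qed
  let ?M = "lebesgue_on {0..T}"
  have Vint: "integrable ?M (V n)" for n
    using L2_absolutely_integrable[OF VL2] by (simp add: integrable_lebesgue_on_iff)
  have LINT: "(LINT t|?M. norm (V m t - V n t)) = integral {0..T} (\<lambda>t. norm (V m t - V n t))" for m n
    using Vint by (intro lebesgue_integral_eq_integral integrable_norm Bochner_Integration.integrable_diff) auto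
  obtain r where r: "strict_mono r" "AE t in ?M. Cauchy (\<lambda>i. V (r i) t)"
  proof (rule cauchy_L1_AE_cauchy_subseq[of ?M V])
    fix e :: real assume "e > 0"
    then obtain N where N: "\<And>n. n \<ge> N \<Longrightarrow> sqrt (T * (a - A n)) < e"
      using order_tendstoD(2)[OF lim0, of e] by (auto simp: eventually_sequentially)
    have "(LINT t|?M. norm (V i t - V j t)) < e" if "i \<ge> N" "j \<ge> N" for i j
    proof (cases "j \<le> i")
      case True
      then show ?thesis unfolding LINT using L1[OF True] N[OF that(2)] by simp
    next
      case False
      then have "integral {0..T} (\<lambda>t. norm (V j t - V i t)) < e"
        using L1[of i j] N[OF that(1)] by simp
      then show ?thesis unfolding LINT by (simp add: norm_minus_commute)
    qed
    then show "\<exists>N. \<forall>i\<ge>N. \<forall>j\<ge>N. (LINT t|?M. norm (V i t - V j t)) < e" by blast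
  qed (use Vint in auto)
  define v where "v t = lim (\<lambda>i. V (r i) t)" for t
  have vmeas: "v \<in> borel_measurable ?M"
    unfolding v_def by (intro borel_measurable_lim_metric L2_measurable VL2)
  have vlim: "AE t in ?M. (\<lambda>i. V (r i) t) \<longlonglongrightarrow> v t"
    using r(2) by eventually_elim (simp add: v_def Cauchy_convergent_iff convergent_LIMSEQ_iff)
  have nnV: "(\<integral>\<^sup>+t. ennreal ((norm (V n t))\<^sup>2) \<partial>?M) = ennreal (A n)" for n
    using nn_integral_L2[OF VL2] by (simp add: intV)
  have fatou: "(\<integral>\<^sup>+t. ennreal ((norm (v t))\<^sup>2) \<partial>?M) \<le> ennreal K"
  proof -
    have "(\<integral>\<^sup>+t. ennreal ((norm (v t))\<^sup>2) \<partial>?M) = (\<integral>\<^sup>+t. liminf (\<lambda>i. ennreal ((norm (V (r i) t))\<^sup>2)) \<partial>?M)"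
    proof (rule nn_integral_cong_AE, use vlim in eventually_elim)
      case (elim t)
      then have "(\<lambda>i. ennreal ((norm (V (r i) t))\<^sup>2)) \<longlonglongrightarrow> ennreal ((norm (v t))\<^sup>2)"
        by (intro tendsto_ennrealI tendsto_intros)
      then show ?case by (rule lim_imp_Liminf[OF sequentially_bot, symmetric])
    qed
    also have "\<dots> \<le> liminf (\<lambda>i. \<integral>\<^sup>+t. ennreal ((norm (V (r i) t))\<^sup>2) \<partial>?M)"
      using L2_measurable[OF VL2] by (intro nn_integral_liminf) simp
    also have "\<dots> \<le> ennreal K"
      unfolding nnV using A_le by (intro Liminf_le) (auto intro!: always_eventually ennreal_leI)
    finally show ?thesis .
  qed
  have vL2: "v \<in> L2 T"
    using fatou by (intro L2_I vmeas) (auto intro: le_less_trans)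
  have vint: "integrable ?M v"
    using L2_absolutely_integrable[OF vL2] by (simp add: integrable_lebesgue_on_iff)
  have L1lim: "integral {0..T} (\<lambda>t. norm (v t - V n t)) \<le> sqrt (T * (a - A n))" for n
  proof -
    have Dint: "integrable ?M (\<lambda>t. norm (v t - V n t))" using vint Vint by auto
    have "ennreal (integral {0..T} (\<lambda>t. norm (v t - V n t))) = (\<integral>\<^sup>+t. ennreal (norm (v t - V n t)) \<partial>?M)"
      using nn_integral_eq_integral[OF Dint] lebesgue_integral_eq_integral[OF Dint] by simp
    also have "\<dots> = (\<integral>\<^sup>+t. liminf (\<lambda>i. ennreal (norm (V (r i) t - V n t))) \<partial>?M)"
    proof (rule nn_integral_cong_AE, use vlim in eventually_elim)
      case (elim t)
      then have "(\<lambda>i. ennreal (norm (V (r i) t - V n t))) \<longlonglongrightarrow> ennreal (norm (v t - V n t))"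
        by (intro tendsto_ennrealI tendsto_intros)
      then show ?case by (rule lim_imp_Liminf[OF sequentially_bot, symmetric])
    qed
    also have "\<dots> \<le> liminf (\<lambda>i. \<integral>\<^sup>+t. ennreal (norm (V (r i) t - V n t)) \<partial>?M)"
      using L2_measurable[OF VL2] by (intro nn_integral_liminf) simp
    also have "\<dots> \<le> ennreal (sqrt (T * (a - A n)))"
    proof (rule Liminf_le)
      have "(\<integral>\<^sup>+t. ennreal (norm (V (r i) t - V n t)) \<partial>?M) \<le> ennreal (sqrt (T * (a - A n)))" if "i \<ge> n" for i
      proof -
        have "integrable ?M (\<lambda>t. norm (V (r i) t - V n t))" using Vint by auto
        then have "(\<integral>\<^sup>+t. ennreal (norm (V (r i) t - V n t)) \<partial>?M) = ennreal (integral {0..T} (\<lambda>t. norm (V (r i) t - V n t)))"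
          by (subst nn_integral_eq_integral) (auto simp: LINT)
        moreover have "n \<le> r i" using seq_suble[OF r(1), of i] that by simp
        ultimately show ?thesis using L1[of n "r i"] by (simp add: ennreal_leI)
      qed
      then show "\<forall>\<^sub>F i in sequentially. (\<integral>\<^sup>+t. ennreal (norm (V (r i) t - V n t)) \<partial>?M) \<le> ennreal (sqrt (T * (a - A n)))"
        by (auto simp: eventually_sequentially)
    qed simp
    finally show ?thesis using a(2)[of n] assms by (subst (asm) ennreal_le_iff) auto
  qed
  have "u t = u 0 + integral {0..t} v" if t: "t \<in> {0..T}" for t
  proof -
    define k where "k n = nat \<lfloor>t / h n\<rfloor>" for n
    define s where "s n = real (k n) * h n" for n
    have s: "s n \<le> t" "t < s n + h n" "0 \<le> s n" for n
    proof -
      have "0 \<le> t / h n" using t h[of n] by simp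
      then have "real (k n) = of_int \<lfloor>t / h n\<rfloor>" by (simp add: k_def)
      then have "real (k n) \<le> t / h n" "t / h n < real (k n) + 1" by linarith+
      then show "s n \<le> t" "t < s n + h n" "0 \<le> s n"
        using h[of n] by (auto simp: s_def field_simps)
    qed
    have h0: "h \<longlonglongrightarrow> 0"
      unfolding h_def[abs_def] by (rule LIMSEQ_divide_realpow_zero) simp
    have slim: "s \<longlonglongrightarrow> t"
    proof (rule tendsto_sandwich)
      show "(\<lambda>n. t - h n) \<longlonglongrightarrow> t" using tendsto_diff[OF tendsto_const h0, of t] by simp
      show "\<forall>\<^sub>F n in sequentially. t - h n \<le> s n" using s(2) by (auto intro!: always_eventually simp: less_imp_le algebra_simps)
      show "\<forall>\<^sub>F n in sequentially. s n \<le> t" using s(1) by auto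
    qed auto
    have sT: "s n \<in> {0..T}" for n using s[of n] t by auto
    have ulim: "(\<lambda>n. u (s n)) \<longlonglongrightarrow> u t"
    proof (rule Lim_null_comparison[where g = "\<lambda>n. sqrt (\<bar>s n - t\<bar> * K)" and f = "\<lambda>n. u (s n) - u t", THEN LIM_zero_cancel])
      show "\<forall>\<^sub>F n in sequentially. norm (u (s n) - u t) \<le> sqrt (\<bar>s n - t\<bar> * K)"
        using energy_increment[OF t sT energy assms(2)] by (auto intro!: always_eventually real_le_rsqrt)
      have "(\<lambda>n. sqrt (\<bar>s n - t\<bar> * K)) \<longlonglongrightarrow> sqrt (\<bar>t - t\<bar> * K)" by (intro tendsto_intros slim)
      then show "(\<lambda>n. sqrt (\<bar>s n - t\<bar> * K)) \<longlonglongrightarrow> 0" by simp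
    qed
    have "continuous_on {0..T} (\<lambda>x. integral {0..x} v)"
      by (intro indefinite_integral_continuous_1 L2_integrable_on[OF vL2]) auto
    then have ilim: "(\<lambda>n. integral {0..s n} v) \<longlonglongrightarrow> integral {0..t} v"
      using sT t slim by (rule_tac continuous_on_tendsto_compose) auto
    have stepint: "integral {0..s n} (V n) = u (s n) - u 0" for n
      unfolding V_def s_def c_def using has_integral_step_fun[OF h[of n], where c = "slope u (h n)" and N = "k n"]
      by (intro integral_unique) (simp add: sum_slope[OF h[of n]])
    have "norm (integral {0..s n} v - (u (s n) - u 0)) \<le> sqrt (T * (a - A n))" for n
    proof -
      have sub: "{0..s n} \<subseteq> {0..T}" using sT[of n] by auto
      have i: "v integrable_on {0..s n}" "V n integrable_on {0..s n}"
        using L2_integrable_on[OF vL2 sub] L2_integrable_on[OF VL2 sub] by auto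
      have D: "(\<lambda>t. v t - V n t) absolutely_integrable_on {0..T}"
        by (intro set_integral_diff L2_absolutely_integrable VL2 vL2)
      have D': "(\<lambda>t. v t - V n t) absolutely_integrable_on {0..s n}"
        by (rule absolutely_integrable_on_subinterval[OF D sub])
      have "integral {0..s n} v - (u (s n) - u 0) = integral {0..s n} (\<lambda>t. v t - V n t)"
        using i by (simp add: integral_diff stepint)
      also have "norm \<dots> \<le> integral {0..s n} (\<lambda>t. norm (v t - V n t))"
        using D' by (intro integral_norm_bound_integral) (auto simp: absolutely_integrable_on_def)
      also have "\<dots> \<le> integral {0..T} (\<lambda>t. norm (v t - V n t))"
        using D D' sub by (intro integral_subset_le) (auto simp: absolutely_integrable_on_def)
      finally show ?thesis using L1lim[of n] by simp
    qed
    then have "(\<lambda>n. integral {0..s n} v - (u (s n) - u 0)) \<longlonglongrightarrow> 0"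
      by (intro Lim_null_comparison[OF _ lim0]) auto
    moreover have "(\<lambda>n. integral {0..s n} v - (u (s n) - u 0)) \<longlonglongrightarrow> integral {0..t} v - (u t - u 0)"
      by (intro tendsto_intros ilim ulim)
    ultimately have "integral {0..t} v - (u t - u 0) = 0" using LIMSEQ_unique by blast
    then show ?thesis by (simp add: algebra_simps)
  qed
  then have "primitive_of T v u" using vL2 unfolding primitive_of_def by blast
  moreover have "integral {0..T} (\<lambda>t. (norm (v t))\<^sup>2) \<le> K"
    using fatou assms(2) unfolding nn_integral_L2[OF vL2] by (subst (asm) ennreal_le_iff) auto
  ultimately show thesis by (rule that)
qed

text \<open>The energy is at most the integral by Cauchy-Schwarz. Conversely the derivative constructed from
  the energy has at most this squared norm, and it is \<open>v\<close> almost everywhere.\<close>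
lemma primitive_energy:
  assumes "T > 0" "primitive_of T v u"
  shows "energy 0 T u = (\<integral>\<^sup>+t. ennreal ((norm (v t))\<^sup>2) \<partial>lebesgue_on {0..T})"
proof -
  define K where "K = integral {0..T} (\<lambda>t. (norm (v t))\<^sup>2)"
  have K: "(\<integral>\<^sup>+t. ennreal ((norm (v t))\<^sup>2) \<partial>lebesgue_on {0..T}) = ennreal K"
    unfolding K_def by (rule nn_integral_L2[OF primitive_L2[OF assms(2)]])
  have le: "energy 0 T u \<le> ennreal K"
    unfolding K_def by (rule primitive_energy_le[OF assms(2)])
  then obtain E where E: "energy 0 T u = ennreal E" "0 \<le> E" by (cases "energy 0 T u") (auto simp: top_unique)
  obtain v' where v': "primitive_of T v' u" "integral {0..T} (\<lambda>t. (norm (v' t))\<^sup>2) \<le> E"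
    using energy_imp_primitive[of T E u] E assms(1) by auto
  have "(\<integral>\<^sup>+t. ennreal ((norm (v t))\<^sup>2) \<partial>lebesgue_on {0..T}) = (\<integral>\<^sup>+t. ennreal ((norm (v' t))\<^sup>2) \<partial>lebesgue_on {0..T})"
    using primitive_unique[OF assms(2) v'(1)] by (intro nn_integral_cong_AE) (auto elim!: eventually_mono)
  also have "\<dots> \<le> ennreal E"
    using v' nn_integral_L2[OF primitive_L2[OF v'(1)]] by (simp add: ennreal_leI)
  finally show ?thesis using le E K by (intro antisym) auto
qed

section \<open>Sobolev functions and their continuous representatives\<close>

text \<open>The hypothesis on increments covers products as well as sums, which is what integration by parts
  needs.\<close>
lemma energy_add_le:
  assumes "\<And>s t. s \<in> {a..b} \<Longrightarrow> t \<in> {a..b} \<Longrightarrow> s \<le> t \<Longrightarrow> norm (v t - v s) \<le> norm (u t - u s) + norm (w t - w s)"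
  shows "energy a b v \<le> 2 * energy a b u + 2 * energy a b w"
proof (rule energy_least)
  fix xs assume xs: "sorted xs" "set xs \<subseteq> {a..b}"
  have le: "partition_sum v xs \<le> 2 * partition_sum u xs + 2 * partition_sum w xs"
    using xs
  proof (induction xs rule: induct_list012)
    case (3 x y zs)
    have "(norm (v y - v x))\<^sup>2 \<le> (norm (u y - u x) + norm (w y - w x))\<^sup>2"
      using 3 by (intro power_mono assms) auto
    also have "\<dots> \<le> 2 * (norm (u y - u x))\<^sup>2 + 2 * (norm (w y - w x))\<^sup>2"
      using zero_le_power2[of "norm (u y - u x) - norm (w y - w x)"] by (simp add: power2_eq_square algebra_simps)
    finally have "(norm (v y - v x))\<^sup>2 / (y - x) \<le> (2 * (norm (u y - u x))\<^sup>2 + 2 * (norm (w y - w x))\<^sup>2) / (y - x)"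
      using 3 by (intro divide_right_mono) auto
    moreover have "partition_sum v (y # zs) \<le> 2 * partition_sum u (y # zs) + 2 * partition_sum w (y # zs)"
      using 3 by auto
    ultimately show ?case by (simp add: add_divide_distrib)
  qed auto
  have "ennreal (partition_sum v xs) \<le> ennreal (2 * partition_sum u xs + 2 * partition_sum w xs)"
    by (rule ennreal_leI[OF le])
  also have "\<dots> = 2 * ennreal (partition_sum u xs) + 2 * ennreal (partition_sum w xs)"
    using partition_sum_nonneg[OF xs(1), of u] partition_sum_nonneg[OF xs(1), of w] by (simp add: ennreal_plus ennreal_mult')
  also have "\<dots> \<le> 2 * energy a b u + 2 * energy a b w"
    using xs by (intro add_mono mult_left_mono energy_upper) auto
  finally show "ennreal (partition_sum v xs) \<le> 2 * energy a b u + 2 * energy a b w" .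
qed

lemma test_functionD:
  assumes "test_function T \<eta>"
  shows "(\<eta> has_real_derivative deriv \<eta> t) (at t)" "continuous_on UNIV (deriv \<eta>)" "continuous_on S \<eta>"
    "\<eta> 0 = 0" "\<eta> T = 0"
proof -
  obtain D where D: "\<And>x. (\<eta> has_vector_derivative D x) (at x)" "continuous_on UNIV D"
    using assms by (auto simp: test_function_def C1_differentiable_on_def)
  have der: "(\<eta> has_real_derivative D x) (at x)" for x
    using D(1) by (simp add: has_real_derivative_iff_has_vector_derivative)
  then have eq: "deriv \<eta> = D" by (intro ext DERIV_imp_deriv)
  show "(\<eta> has_real_derivative deriv \<eta> t) (at t)" "continuous_on UNIV (deriv \<eta>)"
    using der D(2) by (simp_all add: eq)
  show "continuous_on S \<eta>"
    using der by (meson DERIV_continuous continuous_at_imp_continuous_on)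
  show "\<eta> 0 = 0" "\<eta> T = 0"
    using assms by (auto simp: test_function_def)
qed

lemma test_function_Lipschitz:
  assumes "test_function T \<eta>"
  shows "\<exists>M\<ge>0. (\<forall>s\<in>{0..T}. \<forall>t\<in>{0..T}. \<bar>\<eta> t - \<eta> s\<bar> \<le> M * \<bar>t - s\<bar>) \<and>
    (\<forall>t\<in>{0..T}. \<bar>\<eta> t\<bar> \<le> M \<and> \<bar>deriv \<eta> t\<bar> \<le> M)"
proof -
  note \<eta> = test_functionD[OF assms]
  have "compact (deriv \<eta> ` {0..T})" "compact (\<eta> ` {0..T})"
    using \<eta>(2,3) by (intro compact_continuous_image continuous_on_subset[OF \<eta>(2)] \<eta>(3); simp)+
  then have "bounded (deriv \<eta> ` {0..T})" "bounded (\<eta> ` {0..T})" by (auto intro: compact_imp_bounded)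
  then obtain M1 M2 where "\<forall>x\<in>deriv \<eta> ` {0..T}. norm x \<le> M1" "\<forall>x\<in>\<eta> ` {0..T}. norm x \<le> M2"
    unfolding bounded_iff by (elim exE)
  then have M: "\<And>t. t \<in> {0..T} \<Longrightarrow> \<bar>deriv \<eta> t\<bar> \<le> M1" "\<And>t. t \<in> {0..T} \<Longrightarrow> \<bar>\<eta> t\<bar> \<le> M2"
    by auto
  define M where "M = max 0 (max M1 M2)"
  have "\<bar>\<eta> t - \<eta> s\<bar> \<le> M * \<bar>t - s\<bar>" if "s \<in> {0..T}" "t \<in> {0..T}" for s t
  proof -
    have "norm (\<eta> t - \<eta> s) \<le> M * norm (t - s)"
    proof (rule field_differentiable_bound[of "{0..T}"])
      show "(\<eta> has_field_derivative deriv \<eta> z) (at z within {0..T})" for z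
        by (rule has_field_derivative_at_within[OF \<eta>(1)])
      show "norm (deriv \<eta> z) \<le> M" if "z \<in> {0..T}" for z
        using M(1)[OF that] by (auto simp: M_def)
    qed (use that in auto)
    then show ?thesis by simp
  qed
  moreover have "\<bar>\<eta> t\<bar> \<le> M" "\<bar>deriv \<eta> t\<bar> \<le> M" if "t \<in> {0..T}" for t
    using M(1)[OF that] M(2)[OF that] by (auto simp: M_def)
  moreover have "M \<ge> 0" by (simp add: M_def)
  ultimately show ?thesis by blast
qed

lemma integrable_bounded_scaleR:
  fixes w :: "real \<Rightarrow> 'a::euclidean_space"
  assumes w: "w \<in> L2 T" and f: "f \<in> borel_measurable (lebesgue_on {0..T})" and M: "\<And>t. t \<in> {0..T} \<Longrightarrow> \<bar>f t\<bar> \<le> M"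
  shows "integrable (lebesgue_on {0..T}) (\<lambda>t. f t *\<^sub>R w t)"
proof (rule Bochner_Integration.integrable_bound)
  show "integrable (lebesgue_on {0..T}) (\<lambda>t. M * norm (w t))"
    using L2_absolutely_integrable[OF w] by (simp add: integrable_lebesgue_on_iff[symmetric])
  show "AE t in lebesgue_on {0..T}. norm (f t *\<^sub>R w t) \<le> norm (M * norm (w t))"
  proof (rule AE_I2)
    fix t assume "t \<in> space (lebesgue_on {0..T})"
    then have "\<bar>f t\<bar> \<le> M" using M by simp
    then show "norm (f t *\<^sub>R w t) \<le> norm (M * norm (w t))"
      by (auto simp: abs_mult intro!: mult_right_mono)
  qed
qed (use L2_measurable[OF w] f in simp)

lemma test_function_integrable:
  fixes w :: "real \<Rightarrow> 'a::euclidean_space"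
  assumes "test_function T \<eta>" "w \<in> L2 T"
  shows "integrable (lebesgue_on {0..T}) (\<lambda>t. deriv \<eta> t *\<^sub>R w t)" "integrable (lebesgue_on {0..T}) (\<lambda>t. \<eta> t *\<^sub>R w t)"
proof -
  obtain M where "M \<ge> 0" "\<And>s t. s \<in> {0..T} \<Longrightarrow> t \<in> {0..T} \<Longrightarrow> \<bar>\<eta> t - \<eta> s\<bar> \<le> M * \<bar>t - s\<bar>"
    and M: "\<And>t. t \<in> {0..T} \<Longrightarrow> \<bar>\<eta> t\<bar> \<le> M" "\<And>t. t \<in> {0..T} \<Longrightarrow> \<bar>deriv \<eta> t\<bar> \<le> M"
    using test_function_Lipschitz[OF assms(1)] by blast
  note \<eta> = test_functionD[OF assms(1)]
  show "integrable (lebesgue_on {0..T}) (\<lambda>t. deriv \<eta> t *\<^sub>R w t)"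
    by (rule integrable_bounded_scaleR[OF assms(2) continuous_imp_measurable_on_sets_lebesgue M(2)])
      (auto intro: continuous_on_subset[OF \<eta>(2)])
  show "integrable (lebesgue_on {0..T}) (\<lambda>t. \<eta> t *\<^sub>R w t)"
    by (rule integrable_bounded_scaleR[OF assms(2) continuous_imp_measurable_on_sets_lebesgue M(1)])
      (auto intro: \<eta>(3))
qed

text \<open>Integration by parts: the product \<open>\<eta> u\<close> has finite energy, so it is the primitive of its almost
  everywhere derivative, and it vanishes at both ends.\<close>
lemma primitive_has_weak_deriv:
  assumes "T > 0" "primitive_of T v u"
  shows "has_weak_deriv T u v"
  unfolding has_weak_deriv_def
proof (intro allI impI)
  fix \<eta> assume test: "test_function T \<eta>"
  note \<eta> = test_functionD[OF test]
  obtain M where M: "M \<ge> 0" "\<And>s t. s \<in> {0..T} \<Longrightarrow> t \<in> {0..T} \<Longrightarrow> \<bar>\<eta> t - \<eta> s\<bar> \<le> M * \<bar>t - s\<bar>"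
    "\<And>t. t \<in> {0..T} \<Longrightarrow> \<bar>\<eta> t\<bar> \<le> M" "\<And>t. t \<in> {0..T} \<Longrightarrow> \<bar>deriv \<eta> t\<bar> \<le> M"
    using test_function_Lipschitz[OF test] by blast
  have cu: "continuous_on {0..T} u" by (rule primitive_continuous[OF assms(2)])
  then have "bounded (u ` {0..T})"
    by (intro compact_imp_bounded compact_continuous_image) auto
  then obtain B where B: "\<And>t. t \<in> {0..T} \<Longrightarrow> norm (u t) \<le> B"
    unfolding bounded_iff by blast
  have B0: "B \<ge> 0" using B[of 0] assms(1) order_trans[OF norm_ge_zero] by force
  define g where "g t = \<eta> t *\<^sub>R u t" for t
  have "energy 0 T g \<le> 2 * energy 0 T (\<lambda>t. M *\<^sub>R u t) + 2 * energy 0 T (\<lambda>t. (B * M) *\<^sub>R t)"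
  proof (rule energy_add_le)
    fix s t assume st: "s \<in> {0..T}" "t \<in> {0..T}" "s \<le> t"
    have "g t - g s = \<eta> t *\<^sub>R (u t - u s) + (\<eta> t - \<eta> s) *\<^sub>R u s"
      by (simp add: g_def algebra_simps)
    then have "norm (g t - g s) \<le> \<bar>\<eta> t\<bar> * norm (u t - u s) + \<bar>\<eta> t - \<eta> s\<bar> * norm (u s)"
      using norm_triangle_ineq[of "\<eta> t *\<^sub>R (u t - u s)" "(\<eta> t - \<eta> s) *\<^sub>R u s"] by simp
    also have "\<dots> \<le> M * norm (u t - u s) + (M * \<bar>t - s\<bar>) * B"
      by (intro add_mono mult_right_mono mult_mono M(2) M(3) B) (use M(1) B0 st in auto)
    also have "\<dots> = norm (M *\<^sub>R u t - M *\<^sub>R u s) + norm ((B * M) *\<^sub>R t - (B * M) *\<^sub>R s)"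
      using M(1) B0 by (simp add: abs_mult mult.commute mult.left_commute flip: scaleR_diff_right right_diff_distrib)
    finally show "norm (g t - g s) \<le> norm (M *\<^sub>R u t - M *\<^sub>R u s) + norm ((B * M) *\<^sub>R t - (B * M) *\<^sub>R s)" .
  qed
  also have "\<dots> < \<infinity>"
  proof -
    have "energy 0 T u < \<infinity>" using primitive_energy_le[OF assms(2)] by (auto intro: le_less_trans)
    moreover have "energy 0 T (\<lambda>t. t) < \<infinity>" using energy_identity[of 0 T] assms(1) by (auto intro: le_less_trans)
    ultimately show ?thesis unfolding energy_scaleR by (auto simp: ennreal_mult_less_top)
  qed
  finally obtain K where "energy 0 T g = ennreal K" "K \<ge> 0" by (cases "energy 0 T g") auto
  then obtain vg where vg: "primitive_of T vg g"
    using energy_imp_primitive[of T K g] assms(1) by auto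
  have "AE t in lebesgue_on {0..T}. vg t = deriv \<eta> t *\<^sub>R u t + \<eta> t *\<^sub>R v t"
    using primitive_AE_derivative[OF assms(2)] primitive_AE_derivative[OF vg] AE_lebesgue_on_interior[of 0 T]
  proof eventually_elim
    case (elim t)
    then have "(u has_vector_derivative v t) (at t)" "(g has_vector_derivative vg t) (at t)"
      by (auto simp: at_within_Icc_at)
    moreover from this(1) have "(g has_vector_derivative (\<eta> t *\<^sub>R v t + deriv \<eta> t *\<^sub>R u t)) (at t)"
      unfolding g_def[abs_def] by (intro has_vector_derivative_scaleR \<eta>(1))
    ultimately show ?case using vector_derivative_unique_at by (metis add.commute)
  qed
  then have "(LINT t|lebesgue_on {0..T}. vg t) = (LINT t|lebesgue_on {0..T}. deriv \<eta> t *\<^sub>R u t + \<eta> t *\<^sub>R v t)"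
    using borel_measurable_integrable[OF test_function_integrable(1)[OF test continuous_imp_L2[OF cu]]]
      borel_measurable_integrable[OF test_function_integrable(2)[OF test primitive_L2[OF assms(2)]]]
    by (intro integral_cong_AE borel_measurable_add L2_measurable[OF primitive_L2[OF vg]])
  also have "\<dots> = (LINT t|lebesgue_on {0..T}. deriv \<eta> t *\<^sub>R u t) + (LINT t|lebesgue_on {0..T}. \<eta> t *\<^sub>R v t)"
    by (intro Bochner_Integration.integral_add test_function_integrable test continuous_imp_L2 cu primitive_L2[OF assms(2)])
  also have "(LINT t|lebesgue_on {0..T}. vg t) = integral {0..T} vg"
    using L2_absolutely_integrable[OF primitive_L2[OF vg]]
    by (intro lebesgue_integral_eq_integral) (auto simp: integrable_lebesgue_on_iff)
  also have "\<dots> = g T - g 0"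
    using primitive_increment[OF vg, of 0 T] assms(1) by simp
  also have "\<dots> = 0" by (simp add: g_def \<eta>)
  finally show "(LINT t|lebesgue_on {0..T}. deriv \<eta> t *\<^sub>R u t) = - (LINT t|lebesgue_on {0..T}. \<eta> t *\<^sub>R v t)"
    by (simp add: eq_neg_iff_add_eq_0)
qed

text \<open>A \<open>C\<^sup>1\<close> primitive of the positive part, the building block of explicit test functions.\<close>
definition pos_square :: "real \<Rightarrow> real" where
  "pos_square x = (max 0 x)\<^sup>2 / 2"

lemma pos_square_deriv: "(pos_square has_real_derivative max 0 x) (at x)"
proof -
  consider "x < 0" | "x = 0" | "x > 0" by linarith
  then show ?thesis
  proof cases
    case 1
    have "((\<lambda>_. 0) has_real_derivative 0) (at x)" by simp
    then have "(pos_square has_real_derivative 0) (at x)"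
      by (rule has_field_derivative_transform_within_open[where S = "{..<0}"]) (use 1 in \<open>auto simp: pos_square_def\<close>)
    then show ?thesis using 1 by simp
  next
    case 2
    have "(\<lambda>h. pos_square h / h) \<midarrow>0\<rightarrow> 0"
    proof (rule Lim_null_comparison)
      show "\<forall>\<^sub>F h in at 0. norm (pos_square h / h) \<le> \<bar>h\<bar>"
      proof (rule always_eventually, rule allI)
        fix h :: real show "norm (pos_square h / h) \<le> \<bar>h\<bar>"
          by (cases "h \<le> 0") (auto simp: pos_square_def max_def power2_eq_square)
      qed
      show "((\<lambda>h::real. \<bar>h\<bar>) \<longlongrightarrow> 0) (at 0)" by (rule tendsto_rabs_zero) simp
    qed
    then show ?thesis using 2 by (simp add: DERIV_def pos_square_def)
  next
    case 3
    have "((\<lambda>x. x\<^sup>2 / 2) has_real_derivative x) (at x)" by (auto intro!: derivative_eq_intros)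
    then have "(pos_square has_real_derivative x) (at x)"
      by (rule has_field_derivative_transform_within_open[where S = "{0<..}"]) (use 3 in \<open>auto simp: pos_square_def\<close>)
    then show ?thesis using 3 by simp
  qed
qed

text \<open>Piecewise linear approximation of the indicator function of \<open>{a<..}\<close>: zero up to \<open>a\<close> and one from
  \<open>a + 1 / n\<close> on.\<close>
definition ramp :: "real \<Rightarrow> real \<Rightarrow> real \<Rightarrow> real" where
  "ramp n a t = n * (max 0 (t - a) - max 0 (t - a - 1 / n))"

definition ramp_primitive :: "real \<Rightarrow> real \<Rightarrow> real \<Rightarrow> real" where
  "ramp_primitive n a t = n * (pos_square (t - a) - pos_square (t - a - 1 / n))"

lemma ramp_primitive_deriv: "(ramp_primitive n a has_real_derivative ramp n a t) (at t)"
proof -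
  have "((\<lambda>t. pos_square (t - c)) has_real_derivative max 0 (t - c)) (at t)" for c
  proof -
    have "((\<lambda>t. t - c) has_real_derivative 1) (at t)" by (auto intro!: derivative_eq_intros)
    from DERIV_chain2[OF pos_square_deriv this] show ?thesis by simp
  qed
  from this[of a] this[of "a + 1 / n"] show ?thesis
    unfolding ramp_primitive_def[abs_def] ramp_def
    by (auto intro!: derivative_eq_intros simp: diff_diff_eq)
qed

lemma max_diff:
  fixes p x :: real
  assumes "0 < p"
  shows "0 \<le> max 0 x - max 0 (x - p)" "max 0 x - max 0 (x - p) \<le> p"
    "p \<le> x \<Longrightarrow> max 0 x - max 0 (x - p) = p" "x \<le> 0 \<Longrightarrow> max 0 x - max 0 (x - p) = 0"
  using assms by (auto simp: max_def)

lemma ramp_bounds: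
  assumes "n > 0"
  shows "0 \<le> ramp n a t \<and> ramp n a t \<le> 1"
proof -
  have "0 < 1 / n" using assms by simp
  from mult_left_mono[OF max_diff(1)[OF this, of "t - a"], of n] mult_left_mono[OF max_diff(2)[OF this, of "t - a"], of n]
  show ?thesis
    using assms by (simp add: ramp_def)
qed

lemma ramp_eq_1:
  assumes "n > 0" "a + 1 / n \<le> t"
  shows "ramp n a t = 1"
proof -
  have "0 < 1 / n" using assms by simp
  from max_diff(3)[OF this, of "t - a"] have "max 0 (t - a) - max 0 (t - a - 1 / n) = 1 / n" using assms(2) by simp
  then show ?thesis using assms(1) by (simp add: ramp_def)
qed

lemma ramp_eq_0:
  assumes "n > 0" "t \<le> a"
  shows "ramp n a t = 0"
proof -
  have "0 < 1 / n" using assms by simp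
  from max_diff(4)[OF this, of "t - a"] have "max 0 (t - a) - max 0 (t - a - 1 / n) = 0" using assms(2) by simp
  then show ?thesis by (simp add: ramp_def)
qed

lemma ramp_primitive_left: "n > 0 \<Longrightarrow> t \<le> a \<Longrightarrow> ramp_primitive n a t = 0"
proof -
  assume "n > 0" "t \<le> a"
  then have "t - a \<le> 0" "t - a - 1 / n \<le> 0" by (auto intro: order_trans[of _ 0])
  then show ?thesis by (simp add: ramp_primitive_def pos_square_def)
qed

lemma ramp_primitive_right:
  assumes "n > 0" "a + 1 / n \<le> t"
  shows "ramp_primitive n a t = t - a - 1 / (2 * n)"
proof -
  have "0 \<le> t - a - 1 / n" "0 < 1 / n" using assms by auto
  then have "max 0 (t - a) = t - a" "max 0 (t - a - 1 / n) = t - a - 1 / n" by linarith+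
  moreover have "n * ((t - a)\<^sup>2 / 2 - (t - a - 1 / n)\<^sup>2 / 2) = t - a - 1 / (2 * n)"
    using assms(1) by (simp add: power2_eq_square field_simps)
  ultimately show ?thesis by (simp add: ramp_primitive_def pos_square_def)
qed

lemma ramp_limit: "t \<noteq> a \<Longrightarrow> (\<lambda>k. ramp (real (Suc k)) a t) \<longlonglongrightarrow> (if a < t then 1 else 0)"
proof -
  assume ta: "t \<noteq> a"
  show ?thesis
  proof (cases "a < t")
    case True
    then obtain N where "1 / real (Suc N) < t - a"
      using reals_Archimedean[of "t - a"] by (auto simp: inverse_eq_divide)
    then have "ramp (real (Suc k)) a t = 1" if "k \<ge> N" for k
    proof -
      have "1 / real (Suc k) \<le> 1 / real (Suc N)" using that by (intro divide_left_mono) auto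
      then show ?thesis using \<open>1 / real (Suc N) < t - a\<close> by (intro ramp_eq_1) auto
    qed
    then show ?thesis using True by (intro tendsto_eventually) (auto simp: eventually_sequentially)
  next
    case False
    then show ?thesis using ramp_eq_0[of _ t a] by (intro tendsto_eventually always_eventually) auto
  qed
qed

lemma continuous_ramp: "continuous_on S (ramp n a)"
  unfolding ramp_def[abs_def] by (intro continuous_intros)

text \<open>The difference of the indicator functions of two intervals of equal length is a limit of derivatives
  of test functions: its primitive has compact support because the two integrals cancel.\<close>
lemma orthogonal_to_derivatives_shift:
  fixes w :: "real \<Rightarrow> 'a::euclidean_space"
  assumes w: "w \<in> L2 T" and orth: "\<And>\<eta>. test_function T \<eta> \<Longrightarrow> (LINT t|lebesgue_on {0..T}. deriv \<eta> t *\<^sub>R w t) = 0"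
    and ab: "0 < a" "a + l < T" "0 < b" "b + l < T" "l > 0"
  shows "integral {a..a + l} w = integral {b..b + l} w"
proof -
  define g where "g k t = ramp (real (Suc k)) a t - ramp (real (Suc k)) (a + l) t
      - ramp (real (Suc k)) b t + ramp (real (Suc k)) (b + l) t" for k t
  define G where "G k t = ramp_primitive (real (Suc k)) a t - ramp_primitive (real (Suc k)) (a + l) t
      - ramp_primitive (real (Suc k)) b t + ramp_primitive (real (Suc k)) (b + l) t" for k t
  define f where "f t = (if a < t then 1 else 0) - (if a + l < t then 1 else 0) - (if b < t then 1 else 0) + (if b + l < t then 1 else 0 :: real)" for t
  have "f \<in> borel_measurable borel" unfolding f_def by measurable
  then have fm: "f \<in> borel_measurable (lebesgue_on {0..T})"
    by (intro measurable_restrict_space1 measurable_completion) simp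
  have Gder: "(G k has_real_derivative g k t) (at t)" for k t
    unfolding G_def[abs_def] g_def by (intro derivative_intros ramp_primitive_deriv)
  then have Gderiv: "deriv (G k) = g k" for k by (intro ext DERIV_imp_deriv)
  have gcont: "continuous_on S (g k)" for k S
    unfolding g_def[abs_def] by (intro continuous_intros continuous_ramp)
  obtain N where N: "1 / real (Suc N) < T - max (a + l) (b + l)"
    using reals_Archimedean[of "T - max (a + l) (b + l)"] ab by (auto simp: inverse_eq_divide)
  have test: "test_function T (G k)" if "k \<ge> N" for k
    unfolding test_function_def
  proof (intro conjI exI allI impI)
    show "G k C1_differentiable_on UNIV"
      unfolding C1_differentiable_on_def using Gder gcont
      by (intro exI[of _ "g k"]) (auto simp: has_real_derivative_iff_has_vector_derivative[symmetric])
    show "0 < min a b" using ab by simp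
    have "1 / real (Suc k) \<le> 1 / real (Suc N)" using that by (intro divide_left_mono) auto
    then show "max (a + l) (b + l) + 1 / real (Suc k) < T" using N by simp
    fix t assume t: "t \<notin> {min a b..max (a + l) (b + l) + 1 / real (Suc k)}"
    show "G k t = 0"
    proof (cases "t < min a b")
      case True
      then show ?thesis using ab by (simp add: G_def ramp_primitive_left)
    next
      case False
      then have "t > max (a + l) (b + l) + 1 / real (Suc k)" using t by auto
      then show ?thesis using ab unfolding G_def
        by (subst (1 2 3 4) ramp_primitive_right) auto
    qed
  qed
  have "(\<lambda>k. LINT t|lebesgue_on {0..T}. g k t *\<^sub>R w t) \<longlonglongrightarrow> (LINT t|lebesgue_on {0..T}. f t *\<^sub>R w t)"
  proof (rule integral_dominated_convergence)
    show "(\<lambda>t. f t *\<^sub>R w t) \<in> borel_measurable (lebesgue_on {0..T})"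
      using L2_measurable[OF w] fm by simp
    show "(\<lambda>t. g k t *\<^sub>R w t) \<in> borel_measurable (lebesgue_on {0..T})" for k
      using L2_measurable[OF w] continuous_imp_measurable_on_sets_lebesgue[OF gcont, of "{0..T}" k] by simp
    show "integrable (lebesgue_on {0..T}) (\<lambda>t. 4 * norm (w t))"
      using L2_absolutely_integrable[OF w] by (simp add: integrable_lebesgue_on_iff[symmetric])
    show "AE t in lebesgue_on {0..T}. norm (g k t *\<^sub>R w t) \<le> 4 * norm (w t)" for k
    proof (rule AE_I2)
      fix t
      have "\<bar>g k t\<bar> \<le> 4"
        using ramp_bounds[of "real (Suc k)" a t] ramp_bounds[of "real (Suc k)" "a + l" t]
          ramp_bounds[of "real (Suc k)" b t] ramp_bounds[of "real (Suc k)" "b + l" t] unfolding g_def abs_le_iff by linarith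
      then show "norm (g k t *\<^sub>R w t) \<le> 4 * norm (w t)" by (simp add: mult_right_mono)
    qed
    have "{a, a + l, b, b + l} \<in> null_sets lebesgue" by (simp flip: negligible_iff_null_sets)
    then have "AE t in lebesgue. t \<notin> {a, a + l, b, b + l}" by (rule AE_not_in)
    then have "AE t in lebesgue. t \<in> {0..T} \<longrightarrow> (\<lambda>k. g k t *\<^sub>R w t) \<longlonglongrightarrow> f t *\<^sub>R w t"
    proof eventually_elim
      case (elim t)
      then have "(\<lambda>k. g k t) \<longlonglongrightarrow> f t"
        unfolding g_def f_def by (intro tendsto_intros ramp_limit) auto
      then show ?case by (auto intro!: tendsto_intros)
    qed
    then show "AE t in lebesgue_on {0..T}. (\<lambda>k. g k t *\<^sub>R w t) \<longlonglongrightarrow> f t *\<^sub>R w t"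
      by (subst AE_restrict_space_iff) auto
  qed
  moreover have "(\<lambda>k. LINT t|lebesgue_on {0..T}. g k t *\<^sub>R w t) \<longlonglongrightarrow> 0"
    using orth[OF test] by (intro tendsto_eventually) (auto simp: Gderiv eventually_sequentially)
  ultimately have 0: "(LINT t|lebesgue_on {0..T}. f t *\<^sub>R w t) = 0"
    using LIMSEQ_unique by blast
  have piece: "((\<lambda>t. (if c < t then 1 else 0 :: real) *\<^sub>R w t) has_integral integral {c..T} w) {0..T}" if "0 < c" "c < T" for c
  proof -
    have "w integrable_on {c..T}" using that by (intro L2_integrable_on[OF w]) auto
    then have "(w has_integral integral {c..T} w) {c..T}" by (rule integrable_integral)
    then have "((\<lambda>t. if t \<in> {c..T} then w t else 0) has_integral integral {c..T} w) {0..T}"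
      using that by (subst has_integral_restrict) auto
    then show ?thesis
      by (rule has_integral_spike_finite[rotated 2, where S = "{c}"]) auto
  qed
  have "((\<lambda>t. f t *\<^sub>R w t) has_integral
     integral {a..T} w - integral {a + l..T} w - integral {b..T} w + integral {b + l..T} w) {0..T}"
    unfolding f_def scaleR_add_left scaleR_diff_left
    using ab by (intro has_integral_add has_integral_diff piece) auto
  moreover have "(LINT t|lebesgue_on {0..T}. f t *\<^sub>R w t) = integral {0..T} (\<lambda>t. f t *\<^sub>R w t)"
  proof (intro lebesgue_integral_eq_integral integrable_bounded_scaleR[OF w])
    show "f \<in> borel_measurable (lebesgue_on {0..T})" by (rule fm)
    show "\<bar>f t\<bar> \<le> 4" for t by (auto simp: f_def)
  qed auto
  ultimately have "integral {a..T} w - integral {a + l..T} w - integral {b..T} w + integral {b + l..T} w = 0"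
    using 0 by (simp add: integral_unique)
  then have "integral {a..T} w - integral {a + l..T} w = integral {b..T} w - integral {b + l..T} w"
    by (simp add: algebra_simps)
  moreover have "integral {c..c + l} w + integral {c + l..T} w = integral {c..T} w" if "0 < c" "c + l < T" for c
    using that ab by (intro Henstock_Kurzweil_Integration.integral_combine L2_integrable_on[OF w]) auto
  from this[of a] this[of b] have "integral {a..a + l} w + integral {a + l..T} w = integral {a..T} w"
     "integral {b..b + l} w + integral {b + l..T} w = integral {b..T} w" using ab by auto
  then have "integral {a..a + l} w = integral {a..T} w - integral {a + l..T} w"
     "integral {b..b + l} w = integral {b..T} w - integral {b + l..T} w" by (simp_all add: eq_diff_eq)
  ultimately show ?thesis by simp
qed

lemma primitive_integral:
  assumes "w \<in> L2 T"
  shows "primitive_of T w (\<lambda>t. c + integral {0..t} w)"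
  using assms unfolding primitive_of_def by simp

text \<open>The lemma of du Bois-Reymond. The means of \<open>w\<close> over short intervals of equal length agree, and at
  almost every point they converge to the value of \<open>w\<close>.\<close>
lemma orthogonal_to_derivatives_const:
  fixes w :: "real \<Rightarrow> 'a::euclidean_space"
  assumes "T > 0" and w: "w \<in> L2 T" and orth: "\<And>\<eta>. test_function T \<eta> \<Longrightarrow> (LINT t|lebesgue_on {0..T}. deriv \<eta> t *\<^sub>R w t) = 0"
  obtains c where "AE t in lebesgue_on {0..T}. w t = c"
proof -
  define good where "good t \<longleftrightarrow> (0 < t \<and> t < T) \<and> (\<forall>e>0. \<exists>d>0. \<forall>l. 0 < l \<and> l < d \<and> t + l < T \<longrightarrow> norm (integral {t..t + l} w - l *\<^sub>R w t) \<le> e * l)" for t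
  have good: "AE t in lebesgue_on {0..T}. good t"
    using primitive_AE_slope[OF primitive_integral[OF w, of 0]] AE_lebesgue_on_interior[of 0 T]
  proof eventually_elim
    case (elim t)
    show ?case unfolding good_def
    proof (intro conjI allI impI)
      fix e :: real assume "e > 0"
      from spec[OF elim(1), THEN mp, OF this] obtain d where d: "d > 0"
        "\<forall>x y. 0 \<le> x \<and> x \<le> t \<and> t \<le> y \<and> y \<le> T \<and> x < y \<and> y - x < d \<longrightarrow>
           norm (0 + integral {0..y} w - (0 + integral {0..x} w) - (y - x) *\<^sub>R w t) \<le> e * (y - x)" by (elim exE conjE)
      have "norm (integral {t..t + l} w - l *\<^sub>R w t) \<le> e * l" if l: "0 < l" "l < d" "t + l < T" for l
        using d(2)[rule_format, of t "t + l"] l elim(2)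
          primitive_increment[OF primitive_integral[OF w, of 0], of t "t + l"] by simp
      then show "\<exists>d>0. \<forall>l. 0 < l \<and> l < d \<and> t + l < T \<longrightarrow> norm (integral {t..t + l} w - l *\<^sub>R w t) \<le> e * l"
        using d(1) by blast
    qed (use elim in auto)
  qed
  have "emeasure (lebesgue_on {0..T}) (space (lebesgue_on {0..T})) \<noteq> 0"
    using assms(1) by (simp add: emeasure_restrict_space)
  then have "ae_filter (lebesgue_on {0..T}) \<noteq> bot" by (simp add: ae_filter_eq_bot_iff)
  then obtain t0 where t0: "good t0" using good eventually_happens' by blast
  have "w t = w t0" if t: "good t" for t
  proof (rule ccontr)
    assume "w t \<noteq> w t0"
    define e where "e = norm (w t - w t0) / 3"
    have e: "e > 0" using \<open>w t \<noteq> w t0\<close> by (simp add: e_def)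
    obtain d where d: "d > 0" "\<And>l. 0 < l \<Longrightarrow> l < d \<Longrightarrow> t + l < T \<Longrightarrow> norm (integral {t..t + l} w - l *\<^sub>R w t) \<le> e * l"
      using t e unfolding good_def by meson
    obtain d0 where d0: "d0 > 0" "\<And>l. 0 < l \<Longrightarrow> l < d0 \<Longrightarrow> t0 + l < T \<Longrightarrow> norm (integral {t0..t0 + l} w - l *\<^sub>R w t0) \<le> e * l"
      using t0 e unfolding good_def by meson
    define \<mu> where "\<mu> = min (min d d0) (min (T - t) (T - t0))"
    have \<mu>: "\<mu> > 0" "\<mu> \<le> d" "\<mu> \<le> d0" "\<mu> \<le> T - t" "\<mu> \<le> T - t0"
      using t t0 d(1) d0(1) by (auto simp: \<mu>_def good_def)
    define l where "l = \<mu> / 2"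
    have l: "0 < l" "l < d" "l < d0" "t + l < T" "t0 + l < T"
      using \<mu> by (auto simp: l_def)
    have "integral {t..t + l} w = integral {t0..t0 + l} w"
      using t t0 l by (intro orthogonal_to_derivatives_shift[OF w orth]) (auto simp: good_def)
    then have "l *\<^sub>R w t - l *\<^sub>R w t0 = (integral {t0..t0 + l} w - l *\<^sub>R w t0) - (integral {t..t + l} w - l *\<^sub>R w t)" by simp
    then have "norm (l *\<^sub>R w t - l *\<^sub>R w t0) \<le> e * l + e * l"
      using d(2)[of l] d0(2)[of l] l norm_triangle_ineq4 by (smt (verit, ccfv_SIG))
    moreover have "norm (l *\<^sub>R w t - l *\<^sub>R w t0) = l * (3 * e)"
      using l(1) by (simp add: e_def flip: scaleR_diff_right)
    ultimately show False using l(1) e by (simp add: mult.commute)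
  qed
  then show thesis using good by (intro that[of "w t0"]) (auto elim: eventually_mono)
qed

text \<open>The function and the primitive of its weak derivative have the same weak derivative, so their
  difference is constant.\<close>
lemma weak_deriv_imp_primitive:
  fixes u :: "real \<Rightarrow> 'a::euclidean_space"
  assumes "T > 0" "u \<in> L2 T" "v \<in> L2 T" "has_weak_deriv T u v"
  obtains w where "primitive_of T v w" "AE t in lebesgue_on {0..T}. w t = u t"
proof -
  define U where "U t = 0 + integral {0..t} v" for t
  have U: "primitive_of T v U" unfolding U_def[abs_def] by (rule primitive_integral[OF assms(3)])
  have UL2: "U \<in> L2 T" by (rule continuous_imp_L2[OF primitive_continuous[OF U]])
  have DL2: "(\<lambda>t. u t - U t) \<in> L2 T" by (rule L2_diff[OF assms(2) UL2])
  obtain c where c: "AE t in lebesgue_on {0..T}. u t - U t = c"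
  proof (rule orthogonal_to_derivatives_const[OF assms(1) DL2])
    fix \<eta> assume \<eta>: "test_function T \<eta>"
    have "(LINT t|lebesgue_on {0..T}. deriv \<eta> t *\<^sub>R (u t - U t))
      = (LINT t|lebesgue_on {0..T}. deriv \<eta> t *\<^sub>R u t) - (LINT t|lebesgue_on {0..T}. deriv \<eta> t *\<^sub>R U t)"
      unfolding scaleR_diff_right by (intro Bochner_Integration.integral_diff test_function_integrable \<eta> assms UL2)
    also have "\<dots> = 0"
      using assms(4) primitive_has_weak_deriv[OF assms(1) U] \<eta> by (simp add: has_weak_deriv_def)
    finally show "(LINT t|lebesgue_on {0..T}. deriv \<eta> t *\<^sub>R (u t - U t)) = 0" .
  qed (rule that)
  show thesis
  proof (rule that)
    show "primitive_of T v (\<lambda>t. c + integral {0..t} v)" by (rule primitive_integral[OF assms(3)])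
    show "AE t in lebesgue_on {0..T}. c + integral {0..t} v = u t"
      using c by eventually_elim (auto simp: U_def algebra_simps)
  qed
qed

lemma continuous_AE_eq:
  fixes f g :: "real \<Rightarrow> 'a::euclidean_space"
  assumes "T > 0" "continuous_on {0..T} f" "continuous_on {0..T} g" "AE t in lebesgue_on {0..T}. f t = g t" "t \<in> {0..T}"
  shows "f t = g t"
proof -
  have c: "continuous_on {0..T} (\<lambda>t. norm (f t - g t))" using assms by (intro continuous_intros)
  have "integrable (lebesgue_on {0..T}) (\<lambda>t. norm (f t - g t))"
    using absolutely_integrable_continuous_real[OF c] by (simp add: integrable_lebesgue_on_iff)
  then have "integral {0..T} (\<lambda>t. norm (f t - g t)) = (LINT t|lebesgue_on {0..T}. norm (f t - g t))"
    by (simp add: lebesgue_integral_eq_integral)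
  also have "\<dots> = 0" using assms(4) by (intro integral_eq_zero_AE) (auto elim: eventually_mono)
  finally show ?thesis
    using integral_eq_0_iff[OF c assms(1)] assms(5) by auto
qed

lemma primitive_cong:
  assumes "T > 0" "primitive_of T v u" "\<And>t. t \<in> {0..T} \<Longrightarrow> u' t = u t"
  shows "primitive_of T v u'"
  unfolding primitive_of_def
proof (intro conjI ballI primitive_L2[OF assms(2)])
  fix t assume t: "t \<in> {0..T}"
  have "u' 0 = u 0" "u' t = u t" using assms t by auto
  then show "u' t = u' 0 + integral {0..t} v" using primitive_eq[OF assms(2) t] by simp
qed

text \<open>Both \<open>weak_deriv\<close> and \<open>cont_rep\<close> are arbitrary choices. They fit together because two continuous
  functions that agree almost everywhere agree everywhere.\<close>
lemma H1_cont_rep: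
  fixes u :: "real \<Rightarrow> 'a::euclidean_space"
  assumes "T > 0" "u \<in> H1 T"
  shows "primitive_of T (weak_deriv T u) (cont_rep T u)" "AE t in lebesgue_on {0..T}. cont_rep T u t = u t"
proof -
  have uL2: "u \<in> L2 T" and "\<exists>v. v \<in> L2 T \<and> has_weak_deriv T u v"
    using assms(2) by (auto simp: H1_def)
  from someI_ex[OF this(2)] have wd: "weak_deriv T u \<in> L2 T" "has_weak_deriv T u (weak_deriv T u)"
    by (simp_all add: weak_deriv_def)
  obtain w where w: "primitive_of T (weak_deriv T u) w" "AE t in lebesgue_on {0..T}. w t = u t"
    by (rule weak_deriv_imp_primitive[OF assms(1) uL2 wd])
  have cw: "continuous_on {0..T} w" by (rule primitive_continuous[OF w(1)])
  from someI[where P = "\<lambda>w. continuous_on {0..T} w \<and> (AE t in lebesgue_on {0..T}. w t = u t)", OF conjI[OF cw w(2)]]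
  have cr: "continuous_on {0..T} (cont_rep T u)" "AE t in lebesgue_on {0..T}. cont_rep T u t = u t"
    by (simp_all add: cont_rep_def)
  show "AE t in lebesgue_on {0..T}. cont_rep T u t = u t" by (rule cr(2))
  have "AE t in lebesgue_on {0..T}. cont_rep T u t = w t" using cr(2) w(2) by eventually_elim simp
  then have "cont_rep T u t = w t" if "t \<in> {0..T}" for t
    using continuous_AE_eq[OF assms(1) cr(1) cw _ that] by blast
  then show "primitive_of T (weak_deriv T u) (cont_rep T u)"
    by (rule primitive_cong[OF assms(1) w(1)])
qed

lemma finite_energy_imp_H1_path:
  fixes u :: "real \<Rightarrow> 'a::euclidean_space"
  assumes "T > 0" "energy 0 T u < \<infinity>"
  shows "u \<in> H1_path T"
proof -
  obtain K where "energy 0 T u = ennreal K" "K \<ge> 0" using assms(2) by (cases "energy 0 T u") auto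
  then obtain v where v: "primitive_of T v u" using energy_imp_primitive[of T K u] assms(1) by auto
  then have "continuous_on {0..T} u" by (rule primitive_continuous)
  then show ?thesis
    using continuous_imp_L2 primitive_L2[OF v] primitive_has_weak_deriv[OF assms(1) v]
    by (auto simp: H1_path_def H1_def)
qed

lemma H1_path_cont_rep:
  assumes "T > 0" "u \<in> H1_path T" "t \<in> {0..T}"
  shows "cont_rep T u t = u t"
  using assms by (intro continuous_AE_eq[OF assms(1) primitive_continuous[OF H1_cont_rep(1)]])
    (auto simp: H1_path_def H1_cont_rep)

lemma H1_path_primitive:
  assumes "T > 0" "u \<in> H1_path T"
  shows "primitive_of T (weak_deriv T u) u"
  using assms by (intro primitive_cong[OF assms(1) H1_cont_rep(1)]) (auto simp: H1_path_def H1_path_cont_rep)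

lemma dirichlet_energy_eq_energy:
  assumes "T > 0" "u \<in> H1_path T"
  shows "dirichlet_energy T u = energy 0 T u"
  unfolding dirichlet_energy_def by (rule primitive_energy[OF assms(1) H1_path_primitive[OF assms], symmetric])

lemma primitive_finite_energy: "primitive_of T v u \<Longrightarrow> energy 0 T u < \<infinity>"
  by (rule le_less_trans[OF primitive_energy_le]) simp_all

text \<open>The functional of the theorem on an interval, with \<open>d\<close> and \<open>e\<close> for the values of \<open>\<delta>\<close> and \<open>\<epsilon>\<close>.\<close>
definition fast_energy :: "('a::real_normed_vector \<Rightarrow> 'b::real_normed_vector) \<Rightarrow> real \<Rightarrow> real \<Rightarrow> real \<Rightarrow> real \<Rightarrow> (real \<Rightarrow> 'a) \<Rightarrow> ennreal" where
  "fast_energy \<phi> d e a b u = energy a b u + ennreal (d\<^sup>2) * energy a b (\<lambda>t. \<phi> (u t /\<^sub>R e))"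

lemma energy_Lipschitz_rescaled:
  assumes "L-lipschitz_on UNIV \<phi>" "e > 0"
  shows "energy a b (\<lambda>t. \<phi> (u t /\<^sub>R e)) \<le> ennreal ((L / e)\<^sup>2) * energy a b u"
proof (rule energy_Lipschitz_comp)
  show "0 \<le> L / e" using lipschitz_on_nonneg[OF assms(1)] assms(2) by simp
  fix s t
  have "norm (\<phi> (u t /\<^sub>R e) - \<phi> (u s /\<^sub>R e)) \<le> L * norm (u t /\<^sub>R e - u s /\<^sub>R e)"
    using lipschitz_onD[OF assms(1)] by (simp add: dist_norm)
  also have "norm (u t /\<^sub>R e - u s /\<^sub>R e) = norm (u t - u s) / e"
    using assms(2) by (simp add: divide_inverse mult.commute flip: scaleR_diff_right)
  finally show "norm (\<phi> (u t /\<^sub>R e) - \<phi> (u s /\<^sub>R e)) \<le> L / e * norm (u t - u s)" by simp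
qed

text \<open>The path \<open>\<phi> (u / e)\<close> has finite energy because \<open>\<phi>\<close> is Lipschitz. Its almost everywhere derivative is
  therefore its weak derivative, and the second term of \<open>F_eps\<close> is a multiple of its energy.\<close>
lemma F_eps_eq:
  fixes \<phi> :: "real^'m \<Rightarrow> real^'n"
  assumes L: "L-lipschitz_on UNIV \<phi>" and e: "e > 0" and u: "u \<in> H1 1"
  shows "F_eps \<phi> \<delta> e u = fast_energy \<phi> (\<delta> e) e 0 1 (cont_rep 1 u)"
proof -
  let ?M = "lebesgue_on {0..1::real}"
  define W where "W s = \<phi> (cont_rep 1 u s /\<^sub>R e)" for s
  have pu: "primitive_of 1 (weak_deriv 1 u) (cont_rep 1 u)" by (rule H1_cont_rep(1)[OF _ u]) simp
  have "energy 0 1 W \<le> ennreal ((L / e)\<^sup>2) * energy 0 1 (cont_rep 1 u)"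
    unfolding W_def by (rule energy_Lipschitz_rescaled[OF L e])
  also have "\<dots> < \<infinity>" using primitive_finite_energy[OF pu] by (simp add: ennreal_mult_less_top)
  finally have "W \<in> H1_path 1" by (intro finite_energy_imp_H1_path) auto
  then have pW: "primitive_of 1 (weak_deriv 1 W) W" by (intro H1_path_primitive) auto
  have AEg: "AE t in ?M. grad_term \<phi> e u t = e *\<^sub>R weak_deriv 1 W t"
    using primitive_AE_derivative[OF pW] AE_lebesgue_on_interior[of 0 1]
  proof eventually_elim
    case (elim t)
    have "vector_derivative W (at t within cbox 0 1) = weak_deriv 1 W t"
      using elim by (intro vector_derivative_within_cbox) auto
    then show ?case by (simp add: grad_term_def W_def[abs_def])
  qed
  have "F_eps \<phi> \<delta> e u = (\<integral>\<^sup>+ t. ennreal ((norm (weak_deriv 1 u t))\<^sup>2 + (\<delta> e / e)\<^sup>2 * (norm (grad_term \<phi> e u t))\<^sup>2) \<partial>?M)"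
    using u by (simp add: F_eps_def)
  also have "\<dots> = (\<integral>\<^sup>+ t. ennreal ((norm (weak_deriv 1 u t))\<^sup>2) + ennreal ((\<delta> e)\<^sup>2) * ennreal ((norm (weak_deriv 1 W t))\<^sup>2) \<partial>?M)"
  proof (rule nn_integral_cong_AE, use AEg in eventually_elim)
    case (elim t)
    have "(\<delta> e / e)\<^sup>2 * (norm (grad_term \<phi> e u t))\<^sup>2 = (\<delta> e)\<^sup>2 * (norm (weak_deriv 1 W t))\<^sup>2"
      unfolding elim using e by (simp add: power_mult_distrib power_divide)
    then show ?case by (simp add: ennreal_plus ennreal_mult')
  qed
  also have "\<dots> = (\<integral>\<^sup>+ t. ennreal ((norm (weak_deriv 1 u t))\<^sup>2) \<partial>?M) + ennreal ((\<delta> e)\<^sup>2) * (\<integral>\<^sup>+ t. ennreal ((norm (weak_deriv 1 W t))\<^sup>2) \<partial>?M)"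
    using L2_measurable[OF primitive_L2[OF pu]] L2_measurable[OF primitive_L2[OF pW]]
    by (simp add: nn_integral_add nn_integral_cmult)
  also have "\<dots> = energy 0 1 (cont_rep 1 u) + ennreal ((\<delta> e)\<^sup>2) * energy 0 1 W"
    using primitive_energy[OF _ pu] primitive_energy[OF _ pW] by simp
  finally show ?thesis by (simp add: fast_energy_def W_def[abs_def])
qed

lemma F_eps_path:
  fixes \<phi> :: "real^'m \<Rightarrow> real^'n"
  assumes L: "L-lipschitz_on UNIV \<phi>" and e: "e > 0" and u: "energy 0 1 u < \<infinity>"
  shows "u \<in> H1 1" "F_eps \<phi> \<delta> e u = fast_energy \<phi> (\<delta> e) e 0 1 u"
proof -
  have path: "u \<in> H1_path 1" using u by (intro finite_energy_imp_H1_path) auto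
  then show "u \<in> H1 1" by (simp add: H1_path_def)
  then have "F_eps \<phi> \<delta> e u = fast_energy \<phi> (\<delta> e) e 0 1 (cont_rep 1 u)" by (rule F_eps_eq[OF L e])
  also have "\<dots> = fast_energy \<phi> (\<delta> e) e 0 1 u"
    unfolding fast_energy_def using H1_path_cont_rep[OF _ path] by (intro arg_cong2[where f = "(+)"] arg_cong2[where f = "(*)"] energy_cong) auto
  finally show "F_eps \<phi> \<delta> e u = fast_energy \<phi> (\<delta> e) e 0 1 u" .
qed

text \<open>Paths of infinite energy do not affect the infimum, so the regularity constraint can be dropped.\<close>
lemma psi_z_eq:
  fixes \<phi> :: "real^'m \<Rightarrow> real^'n"
  assumes "T > 0"
  shows "psi_z \<phi> z T w = ennreal (1 / T) * (INF u \<in> {u. (\<forall>t\<in>{0..T}. \<phi> (u t) = z) \<and>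
                 norm (u 0) \<le> sqrt (real CARD('m)) \<and> norm (u T - T *\<^sub>R w) \<le> sqrt (real CARD('m))}. energy 0 T u)"
  (is "_ = _ * (INF u \<in> ?A. _)")
proof -
  let ?B = "{u \<in> H1_path T. (\<forall>t\<in>{0..T}. \<phi> (u t) = z) \<and>
                 norm (u 0) \<le> sqrt (real CARD('m)) \<and> norm (u T - T *\<^sub>R w) \<le> sqrt (real CARD('m))}"
  have "(INF u \<in> ?B. dirichlet_energy T u) = (INF u \<in> ?A. energy 0 T u)"
  proof (rule antisym)
    show "(INF u \<in> ?B. dirichlet_energy T u) \<le> (INF u \<in> ?A. energy 0 T u)"
    proof (rule INF_greatest)
      fix u assume u: "u \<in> ?A"
      show "(INF u \<in> ?B. dirichlet_energy T u) \<le> energy 0 T u"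
      proof (cases "energy 0 T u < \<infinity>")
        case True
        then have "u \<in> ?B" using u finite_energy_imp_H1_path[OF assms] by auto
        moreover have "dirichlet_energy T u = energy 0 T u"
          using calculation by (intro dirichlet_energy_eq_energy assms) auto
        ultimately show ?thesis by (metis (no_types, lifting) INF_lower)
      next
        case False
        then have "energy 0 T u = top" by (simp add: not_less top_unique)
        then show ?thesis by simp
      qed
    qed
    show "(INF u \<in> ?A. energy 0 T u) \<le> (INF u \<in> ?B. dirichlet_energy T u)"
      by (rule INF_greatest) (auto intro!: INF_lower simp: dirichlet_energy_eq_energy[OF assms])
  qed
  then show ?thesis by (simp add: psi_z_def)
qed

text \<open>The controlled length condition bounds lengths, whereas the cell problems measure energies; a path
  of length \<open>l\<close> that is run through in time \<open>\<tau>\<close> at constant speed has energy \<open>l\<^sup>2 / \<tau>\<close>. Arc length need not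
  be injective where the path rests, so a multiple \<open>\<eta> t\<close> of time is added to it.\<close>
lemma constant_speed_reparametrization:
  fixes \<gamma> :: "real \<Rightarrow> 'a::euclidean_space"
  assumes \<gamma>: "\<gamma> \<in> H1_path 1" and len: "(LINT t|lebesgue_on {0..1}. norm (weak_deriv 1 \<gamma> t)) \<le> l" and "\<tau> > 0" "\<eta> > 0"
  obtains \<sigma> where "\<sigma> 0 = \<gamma> 0" "\<sigma> \<tau> = \<gamma> 1" "\<And>t. t \<in> {0..\<tau>} \<Longrightarrow> \<sigma> t \<in> \<gamma> ` {0..1}"
    "energy 0 \<tau> \<sigma> \<le> ennreal ((l + \<eta>)\<^sup>2 / \<tau>)"
proof -
  define v where "v = weak_deriv 1 \<gamma>"
  have p: "primitive_of 1 v \<gamma>" unfolding v_def by (rule H1_path_primitive[OF _ \<gamma>]) simp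
  note vL2 = primitive_L2[OF p]
  define s where "s t = integral {0..t} (\<lambda>x. norm (v x)) + \<eta> * t" for t
  have s_cont: "continuous_on {0..1} s"
    unfolding s_def by (intro continuous_intros indefinite_integral_continuous_1 L2_integrable_on[OF vL2]) auto
  have s_inc: "norm (\<gamma> y - \<gamma> x) + \<eta> * (y - x) \<le> s y - s x" if "0 \<le> x" "x \<le> y" "y \<le> 1" for x y
  proof -
    have i: "v integrable_on {x..y}" "(\<lambda>t. norm (v t)) integrable_on {x..y}"
      using that by (auto intro!: L2_integrable_on[OF vL2])
    have "norm (\<gamma> y - \<gamma> x) \<le> integral {x..y} (\<lambda>t. norm (v t))"
      unfolding primitive_increment[OF p that] using i by (intro integral_norm_bound_integral) auto
    also have "\<dots> = integral {0..y} (\<lambda>t. norm (v t)) - integral {0..x} (\<lambda>t. norm (v t))"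
      using Henstock_Kurzweil_Integration.integral_combine[of 0 x y "\<lambda>t. norm (v t)"] that L2_integrable_on(2)[OF vL2, of 0 y] by simp
    finally show ?thesis by (simp add: s_def algebra_simps)
  qed
  define S where "S = s 1"
  have s0: "s 0 = 0" by (simp add: s_def)
  have S_pos: "S > 0"
  proof -
    have "norm (\<gamma> 1 - \<gamma> 0) + \<eta> * (1 - 0) \<le> s 1 - s 0" by (rule s_inc) auto
    then have "norm (\<gamma> 1 - \<gamma> 0) + \<eta> \<le> s 1" by (simp add: s0)
    moreover have "0 < norm (\<gamma> 1 - \<gamma> 0) + \<eta>" using \<open>\<eta> > 0\<close> by (simp add: add_nonneg_pos)
    ultimately show ?thesis unfolding S_def by (rule less_le_trans[rotated])
  qed
  have "(LINT t|lebesgue_on {0..1}. norm (v t)) = integral {0..1} (\<lambda>t. norm (v t))"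
    using L2_absolutely_integrable[OF vL2] by (intro lebesgue_integral_eq_integral) (auto simp: integrable_lebesgue_on_iff[symmetric])
  then have S_le: "S \<le> l + \<eta>" using len by (simp add: S_def s_def v_def)
  define inv where "inv t = (SOME x. x \<in> {0..1} \<and> s x = t * S / \<tau>)" for t
  have inv: "inv t \<in> {0..1}" "s (inv t) = t * S / \<tau>" if "t \<in> {0..\<tau>}" for t
  proof -
    have "0 \<le> t * S / \<tau>" "t * S / \<tau> \<le> S"
      using that S_pos \<open>\<tau> > 0\<close> by (auto simp: field_simps)
    then have "\<exists>x. x \<in> {0..1} \<and> s x = t * S / \<tau>"
      using IVT'[of s 0 "t * S / \<tau>" 1] s_cont by (auto simp: s0 S_def)
    from someI_ex[OF this] show "inv t \<in> {0..1}" "s (inv t) = t * S / \<tau>" by (auto simp: inv_def)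
  qed
  define \<sigma> where "\<sigma> t = \<gamma> (inv t)" for t
  have "s (inv 0) = 0" "inv 0 \<in> {0..1}" using inv[of 0] \<open>\<tau> > 0\<close> by auto
  then have "inv 0 = 0"
    using s_inc[of 0 "inv 0"] \<open>\<eta> > 0\<close> norm_ge_zero[of "\<gamma> (inv 0) - \<gamma> 0"] s0
    by (smt (verit) atLeastAtMost_iff mult_pos_pos)
  moreover have "inv \<tau> = 1"
  proof -
    have "s (inv \<tau>) = S" "inv \<tau> \<in> {0..1}" using inv[of \<tau>] \<open>\<tau> > 0\<close> by auto
    then show ?thesis
      using s_inc[of "inv \<tau>" 1] \<open>\<eta> > 0\<close> norm_ge_zero[of "\<gamma> 1 - \<gamma> (inv \<tau>)"]
      by (smt (verit) S_def atLeastAtMost_iff mult_pos_pos)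
  qed
  moreover have "energy 0 \<tau> \<sigma> \<le> ennreal ((S / \<tau>)\<^sup>2 * (\<tau> - 0))"
  proof (rule energy_Lipschitz)
    fix x y assume xy: "x \<in> {0..\<tau>}" "y \<in> {0..\<tau>}" "x \<le> y"
    have "norm (\<gamma> b - \<gamma> a) \<le> \<bar>s b - s a\<bar>" if "a \<in> {0..1}" "b \<in> {0..1}" for a b
      using s_inc[of a b] s_inc[of b a] that \<open>\<eta> > 0\<close>
      by (smt (verit) atLeastAtMost_iff mult_nonneg_nonneg norm_minus_commute)
    then have "norm (\<sigma> y - \<sigma> x) \<le> \<bar>y * S / \<tau> - x * S / \<tau>\<bar>"
      using inv[OF xy(1)] inv[OF xy(2)] by (metis \<sigma>_def)
    also have "\<dots> = S / \<tau> * (y - x)"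
    proof -
      have "y * S / \<tau> - x * S / \<tau> = S / \<tau> * (y - x)" using \<open>\<tau> > 0\<close> by (simp add: field_simps)
      then show ?thesis using xy S_pos \<open>\<tau> > 0\<close> by simp
    qed
    finally show "norm (\<sigma> y - \<sigma> x) \<le> S / \<tau> * (y - x)" .
  qed (use S_pos \<open>\<tau> > 0\<close> in auto)
  moreover have "(S / \<tau>)\<^sup>2 * (\<tau> - 0) \<le> (l + \<eta>)\<^sup>2 / \<tau>"
  proof -
    have "S\<^sup>2 \<le> (l + \<eta>)\<^sup>2" using S_le S_pos by (intro power_mono) auto
    then show ?thesis using \<open>\<tau> > 0\<close> by (simp add: power2_eq_square field_simps)
  qed
  ultimately show thesis
    using inv by (intro that[of \<sigma>]) (auto simp: \<sigma>_def intro: order_trans ennreal_leI)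
qed

section \<open>The cell problem on a single level\<close>

definition lattice :: "(real^'m) set" where
  "lattice = {k. \<forall>i. k $ i \<in> \<int>}"

lemma lattice_closed: "0 \<in> lattice" "k \<in> lattice \<Longrightarrow> l \<in> lattice \<Longrightarrow> k + l \<in> lattice" "k \<in> lattice \<Longrightarrow> - k \<in> lattice"
  by (auto simp: lattice_def)

lemma periodic_add: "one_periodic \<phi> \<Longrightarrow> k \<in> lattice \<Longrightarrow> \<phi> (x + k) = \<phi> x"
  by (auto simp: one_periodic_def lattice_def)

lemma periodic_diff: "one_periodic \<phi> \<Longrightarrow> k \<in> lattice \<Longrightarrow> \<phi> (x - k) = \<phi> x"
  using periodic_add[of \<phi> "- k" x] lattice_closed(3)[of k] by simp

lemma lattice_near:
  fixes p :: "real^'m"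
  obtains k where "k \<in> lattice" "norm (p - k) \<le> sqrt (real CARD('m))"
proof
  define k :: "real^'m" where "k = (\<chi> i. of_int \<lfloor>p $ i\<rfloor>)"
  show "k \<in> lattice" by (simp add: lattice_def k_def)
  have "((p - k) $ i)\<^sup>2 \<le> 1" for i
  proof -
    have "0 \<le> (p - k) $ i" "(p - k) $ i \<le> 1" by (simp_all add: k_def) linarith+
    then show ?thesis by (simp add: power_le_one)
  qed
  then have "(\<Sum>i\<in>UNIV. ((p - k) $ i)\<^sup>2) \<le> (\<Sum>i\<in>(UNIV :: 'm set). 1)" by (intro sum_mono)
  then show "norm (p - k) \<le> sqrt (real CARD('m))"
    by (simp add: norm_vec_def L2_set_def)
qed

definition concat_path :: "real \<Rightarrow> (real \<Rightarrow> 'a) \<Rightarrow> (real \<Rightarrow> 'a) \<Rightarrow> real \<Rightarrow> 'a" where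
  "concat_path S u v t = (if t \<le> S then u t else v (t - S))"

lemma energy_concat_path:
  assumes "0 \<le> S" "0 \<le> T" "u S = v 0"
  shows "energy 0 (S + T) (concat_path S u v) = energy 0 S u + energy 0 T v"
proof -
  have "energy 0 (S + T) (concat_path S u v) = energy 0 S (concat_path S u v) + energy S (S + T) (concat_path S u v)"
    using assms by (intro energy_split) auto
  also have "energy 0 S (concat_path S u v) = energy 0 S u"
    by (intro energy_cong) (auto simp: concat_path_def)
  also have "energy S (S + T) (concat_path S u v) = energy S (S + T) (\<lambda>t. v (1 * t + - S))"
    using assms(3) by (intro energy_cong) (auto simp: concat_path_def)
  also have "\<dots> = energy 0 T v"
    by (subst energy_reparam) auto
  finally show ?thesis .
qed

text \<open>A path in the level of \<open>z\<close> from \<open>x\<close> to \<open>y\<close> of duration \<open>T\<close> and energy at most \<open>E\<close>: the cell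
  problem for fixed end points.\<close>
definition reach :: "('a::real_normed_vector \<Rightarrow> 'b) \<Rightarrow> 'b \<Rightarrow> real \<Rightarrow> 'a \<Rightarrow> 'a \<Rightarrow> real \<Rightarrow> bool" where
  "reach \<phi> z T x y E \<longleftrightarrow> (\<exists>u. u 0 = x \<and> u T = y \<and> (\<forall>t\<in>{0..T}. \<phi> (u t) = z) \<and> energy 0 T u \<le> ennreal E)"

lemma reach_refl: "\<phi> x = z \<Longrightarrow> reach \<phi> z T x x 0"
  unfolding reach_def by (intro exI[of _ "\<lambda>_. x"]) simp

lemma reach_mono: "reach \<phi> z T x y E \<Longrightarrow> E \<le> E' \<Longrightarrow> reach \<phi> z T x y E'"
  unfolding reach_def by (blast intro: order_trans[OF _ ennreal_leI])

lemma reach_endpoints: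
  assumes "reach \<phi> z T x y E" "0 \<le> T"
  shows "\<phi> x = z" "\<phi> y = z"
  using assms by (auto simp: reach_def)

lemma reach_trans:
  assumes "reach \<phi> z S x y E" "reach \<phi> z T y w F" "0 \<le> S" "0 \<le> T" "0 \<le> E" "0 \<le> F"
  shows "reach \<phi> z (S + T) x w (E + F)"
proof -
  obtain u where u: "u 0 = x" "u S = y" "\<forall>t\<in>{0..S}. \<phi> (u t) = z" "energy 0 S u \<le> ennreal E"
    using assms(1) by (auto simp: reach_def)
  obtain v where v: "v 0 = y" "v T = w" "\<forall>t\<in>{0..T}. \<phi> (v t) = z" "energy 0 T v \<le> ennreal F"
    using assms(2) by (auto simp: reach_def)
  have "energy 0 (S + T) (concat_path S u v) = energy 0 S u + energy 0 T v"
    using u v assms by (intro energy_concat_path) auto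
  also have "\<dots> \<le> ennreal (E + F)"
    using u v assms by (simp add: ennreal_plus add_mono)
  finally show ?thesis
    unfolding reach_def using u v assms(3,4)
    by (intro exI[of _ "concat_path S u v"]) (auto simp: concat_path_def)
qed

lemma reach_translate:
  fixes \<phi> :: "real^'m \<Rightarrow> 'b"
  assumes "one_periodic \<phi>" "k \<in> lattice" "reach \<phi> z T x y E"
  shows "reach \<phi> z T (x + k) (y + k) E"
proof -
  obtain u where u: "u 0 = x" "u T = y" "\<forall>t\<in>{0..T}. \<phi> (u t) = z" "energy 0 T u \<le> ennreal E"
    using assms(3) by (auto simp: reach_def)
  then show ?thesis
    unfolding reach_def using assms(1,2)
    by (intro exI[of _ "\<lambda>t. u t + k"]) (auto simp: one_periodic_def lattice_def)
qed

lemma psi_z_le_of_reach: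
  fixes \<phi> :: "real^'m \<Rightarrow> real^'n"
  assumes "T > 0" "reach \<phi> z T x y E" "norm x \<le> sqrt (real CARD('m))" "norm (y - T *\<^sub>R w) \<le> sqrt (real CARD('m))" "0 \<le> E"
  shows "psi_z \<phi> z T w \<le> ennreal (E / T)"
proof -
  obtain u where u: "u 0 = x" "u T = y" "\<forall>t\<in>{0..T}. \<phi> (u t) = z" "energy 0 T u \<le> ennreal E"
    using assms(2) by (auto simp: reach_def)
  have "psi_z \<phi> z T w \<le> ennreal (1 / T) * ennreal E"
    unfolding psi_z_eq[OF assms(1)]
    by (intro mult_left_mono INF_lower2[of u]) (use u assms in auto)
  then show ?thesis using assms by (simp add: ennreal_mult[symmetric])
qed

lemma psi_z_less_imp_reach:
  fixes \<phi> :: "real^'m \<Rightarrow> real^'n"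
  assumes "T > 0" "psi_z \<phi> z T w < ennreal B"
  obtains x y E where "reach \<phi> z T x y E" "norm x \<le> sqrt (real CARD('m))"
    "norm (y - T *\<^sub>R w) \<le> sqrt (real CARD('m))" "0 \<le> E" "E \<le> B * T"
proof -
  let ?A = "{u. (\<forall>t\<in>{0..T}. \<phi> (u t) = z) \<and> norm (u 0) \<le> sqrt (real CARD('m)) \<and> norm (u T - T *\<^sub>R w) \<le> sqrt (real CARD('m))}"
  have "\<exists>u\<in>?A. energy 0 T u < ennreal (B * T)"
  proof (rule ccontr)
    assume "\<not> ?thesis"
    then have "ennreal (B * T) \<le> (INF u \<in> ?A. energy 0 T u)"
      by (intro INF_greatest) (meson not_less)
    then have "ennreal (1 / T) * ennreal (B * T) \<le> psi_z \<phi> z T w"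
      unfolding psi_z_eq[OF assms(1)] by (rule mult_left_mono) simp
    also have "ennreal (1 / T) * ennreal (B * T) = ennreal B"
      using assms(1) by (simp add: ennreal_mult'[symmetric])
    finally show False using assms(2) by simp
  qed
  then obtain u where u: "u \<in> ?A" "energy 0 T u < ennreal (B * T)" by blast
  then obtain E where E: "energy 0 T u = ennreal E" "0 \<le> E" by (cases "energy 0 T u") auto
  have "reach \<phi> z T (u 0) (u T) E" using u(1) E by (auto simp: reach_def)
  moreover have "E \<le> B * T" using u(2) E by (simp add: ennreal_less_iff)
  ultimately show thesis using u(1) E by (intro that[of "u 0" "u T" E]) auto
qed

lemma psi_z_zero:
  fixes \<phi> :: "real^'m \<Rightarrow> real^'n"
  assumes "one_periodic \<phi>" "z \<in> range \<phi>" "T > 0"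
  shows "psi_z \<phi> z T 0 = 0"
proof -
  obtain p where p: "\<phi> p = z" using assms(2) by auto
  obtain k where k: "k \<in> lattice" "norm (p - k) \<le> sqrt (real CARD('m))" by (rule lattice_near)
  have "\<phi> (p - k) = z" using periodic_diff[OF assms(1) k(1)] p by simp
  then have "reach \<phi> z T (p - k) (p - k) 0" by (rule reach_refl)
  from psi_z_le_of_reach[OF assms(3) this] k show ?thesis by simp
qed

lemma level_point_near:
  fixes \<phi> :: "real^'m \<Rightarrow> 'b"
  assumes "one_periodic \<phi>" "z \<in> range \<phi>"
  obtains x where "\<phi> x = z" "norm (x - p) \<le> sqrt (real CARD('m))"
proof -
  obtain q where q: "\<phi> q = z" using assms(2) by auto
  obtain k where k: "k \<in> lattice" "norm ((p - q) - k) \<le> sqrt (real CARD('m))" by (rule lattice_near)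
  have "\<phi> (q + k) = z" using assms(1) k(1) q by (simp add: one_periodic_def lattice_def)
  moreover have "norm (q + k - p) \<le> sqrt (real CARD('m))"
    using k(2) by (metis norm_minus_commute diff_diff_eq2 diff_diff_eq add.commute)
  ultimately show thesis by (rule that)
qed

text \<open>The bound is the energy of constant speed along a path of length \<open>C * norm (x - y)\<close>.\<close>
definition connecting_const :: "('a::real_normed_vector \<Rightarrow> 'b) \<Rightarrow> 'b \<Rightarrow> real \<Rightarrow> bool" where
  "connecting_const \<phi> z C \<longleftrightarrow> 0 \<le> C \<and> (\<forall>x y \<tau>. \<phi> x = z \<longrightarrow> \<phi> y = z \<longrightarrow> 0 < \<tau> \<longrightarrow> reach \<phi> z \<tau> x y ((C * norm (x - y))\<^sup>2 / \<tau>))"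

lemma connecting_constD:
  assumes "connecting_const \<phi> z C" "\<phi> x = z" "\<phi> y = z" "0 < \<tau>" "norm (x - y) \<le> r"
  shows "reach \<phi> z \<tau> x y ((C * r)\<^sup>2 / \<tau>)"
proof -
  have "reach \<phi> z \<tau> x y ((C * norm (x - y))\<^sup>2 / \<tau>)" using assms by (auto simp: connecting_const_def)
  moreover have "C * norm (x - y) \<le> C * r" "0 \<le> C * norm (x - y)"
    using assms by (auto simp: connecting_const_def intro: mult_left_mono)
  then have "(C * norm (x - y))\<^sup>2 / \<tau> \<le> (C * r)\<^sup>2 / \<tau>"
    using assms(4) by (intro divide_right_mono power_mono) auto
  ultimately show ?thesis by (rule reach_mono)
qed

lemma unbounded_level_connecting_const:
  fixes \<phi> :: "real^'m \<Rightarrow> real^'n"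
  assumes "controlled_length \<phi>" "z \<in> range \<phi>" "unbounded_level \<phi> z"
  obtains C where "connecting_const \<phi> z C"
proof -
  have "connected (level_set \<phi> z)" using assms(3) by (simp add: unbounded_level_def)
  with assms(1,2) obtain C0 where "\<forall>x\<in>level_set \<phi> z. \<forall>y\<in>level_set \<phi> z. \<exists>\<gamma>\<in>H1_path 1. \<gamma> 0 = x \<and> \<gamma> 1 = y \<and>
      (\<forall>t\<in>{0..1}. \<phi> (\<gamma> t) = z) \<and> (LINT t|lebesgue_on {0..1}. norm (weak_deriv 1 \<gamma> t)) \<le> C0 * norm (x - y)"
    unfolding controlled_length_def by blast
  then have C0: "\<And>x y. \<phi> x = z \<Longrightarrow> \<phi> y = z \<Longrightarrow> \<exists>\<gamma>\<in>H1_path 1. \<gamma> 0 = x \<and> \<gamma> 1 = y \<and> (\<forall>t\<in>{0..1}. \<phi> (\<gamma> t) = z) \<and>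
          (LINT t|lebesgue_on {0..1}. norm (weak_deriv 1 \<gamma> t)) \<le> C0 * norm (x - y)"
    by (simp add: level_set_def)
  define C where "C = max 0 C0 + 1"
  have "reach \<phi> z \<tau> x y ((C * norm (x - y))\<^sup>2 / \<tau>)" if xy: "\<phi> x = z" "\<phi> y = z" "0 < \<tau>" for x y \<tau>
  proof (cases "x = y")
    case True
    then show ?thesis using reach_refl[of \<phi> x z \<tau>] xy by simp
  next
    case False
    obtain \<gamma> where \<gamma>: "\<gamma> \<in> H1_path 1" "\<gamma> 0 = x" "\<gamma> 1 = y" "\<forall>t\<in>{0..1}. \<phi> (\<gamma> t) = z"
      "(LINT t|lebesgue_on {0..1}. norm (weak_deriv 1 \<gamma> t)) \<le> C0 * norm (x - y)"
      using C0[OF xy(1,2)] by blast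
    have "C0 * norm (x - y) \<le> max 0 C0 * norm (x - y)" by (intro mult_right_mono) auto
    then have "(LINT t|lebesgue_on {0..1}. norm (weak_deriv 1 \<gamma> t)) \<le> max 0 C0 * norm (x - y)" using \<gamma>(5) by linarith
    then obtain \<sigma> where \<sigma>: "\<sigma> 0 = \<gamma> 0" "\<sigma> \<tau> = \<gamma> 1" "\<And>t. t \<in> {0..\<tau>} \<Longrightarrow> \<sigma> t \<in> \<gamma> ` {0..1}"
      "energy 0 \<tau> \<sigma> \<le> ennreal ((max 0 C0 * norm (x - y) + norm (x - y))\<^sup>2 / \<tau>)"
      using constant_speed_reparametrization[OF \<gamma>(1) _ xy(3), of "max 0 C0 * norm (x - y)" "norm (x - y)"] False by auto
    then show ?thesis
      unfolding reach_def using \<gamma> by (intro exI[of _ \<sigma>]) (force simp: C_def distrib_right)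
  qed
  then have "connecting_const \<phi> z C" by (auto simp: connecting_const_def C_def)
  then show thesis by (rule that)
qed

lemma psi_z_upper:
  fixes \<phi> :: "real^'m \<Rightarrow> real^'n"
  assumes "one_periodic \<phi>" "z \<in> range \<phi>" "connecting_const \<phi> z C" "T > 0"
  shows "psi_z \<phi> z T w \<le> ennreal ((C * (T * norm w + 2 * sqrt (real CARD('m))))\<^sup>2 / T / T)"
proof -
  let ?r = "sqrt (real CARD('m))"
  obtain x where x: "\<phi> x = z" "norm (x - 0) \<le> ?r" using level_point_near[OF assms(1,2)] by blast
  obtain y where y: "\<phi> y = z" "norm (y - T *\<^sub>R w) \<le> ?r" using level_point_near[OF assms(1,2)] by blast
  have "norm (x - y) \<le> norm x + (norm (y - T *\<^sub>R w) + norm (T *\<^sub>R w))"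
    using norm_triangle_ineq4[of x y] norm_triangle_sub[of y "T *\<^sub>R w"] by linarith
  then have "norm (x - y) \<le> T * norm w + 2 * ?r" using x y assms(4) by simp
  then have "reach \<phi> z T x y ((C * (T * norm w + 2 * ?r))\<^sup>2 / T)"
    by (intro connecting_constD assms x y)
  then show ?thesis using x y assms(4) by (intro psi_z_le_of_reach) auto
qed

text \<open>Both paths start in the fundamental cell; the second is moved by a lattice vector to where the first
  one ends. Two unit time connections close the gaps between the paths and at the end, over distances
  that depend on \<open>R\<close> but not on the durations. With equal slopes this is almost subadditivity of
  \<open>T \<psi>\<^sub>T\<close>, with different slopes it gives convexity.\<close>
lemma reach_join:
  fixes \<phi> :: "real^'m \<Rightarrow> real^'n" and w w1 w2 :: "real^'m"
  defines "r \<equiv> sqrt (real CARD('m))"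
  assumes per: "one_periodic \<phi>" "z \<in> range \<phi>" and C: "connecting_const \<phi> z C"
    and T: "T1 > 0" "T2 > 0"
    and p1: "reach \<phi> z T1 x1 y1 E1" "norm x1 \<le> r" "norm (y1 - T1 *\<^sub>R w1) \<le> r" "0 \<le> E1"
    and p2: "reach \<phi> z T2 x2 y2 E2" "norm x2 \<le> r" "norm (y2 - T2 *\<^sub>R w2) \<le> r" "0 \<le> E2"
    and R: "norm ((T1 + T2 + 2) *\<^sub>R w - (T1 *\<^sub>R w1 + T2 *\<^sub>R w2)) \<le> R"
  obtains y where "reach \<phi> z (T1 + T2 + 2) x1 y (E1 + E2 + ((C * (3 * r))\<^sup>2 + (C * (3 * r + R))\<^sup>2))"
    "norm (y - (T1 + T2 + 2) *\<^sub>R w) \<le> r"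
proof -
  obtain k where k: "k \<in> lattice" "norm (T1 *\<^sub>R w1 - k) \<le> r" unfolding r_def by (rule lattice_near)
  obtain y where y: "\<phi> y = z" "norm (y - (T1 + T2 + 2) *\<^sub>R w) \<le> r"
    unfolding r_def using level_point_near[OF per] by blast
  have q2: "reach \<phi> z T2 (x2 + k) (y2 + k) E2" by (rule reach_translate[OF per(1) k(1) p2(1)])
  have ends: "\<phi> y1 = z" "\<phi> (x2 + k) = z" "\<phi> (y2 + k) = z"
    using reach_endpoints[OF p1(1)] reach_endpoints[OF q2] T by auto
  have "norm (y1 - (x2 + k)) \<le> norm (y1 - T1 *\<^sub>R w1) + norm (T1 *\<^sub>R w1 - k) + norm x2"
  proof -
    have "norm (y1 - (x2 + k)) = norm ((y1 - T1 *\<^sub>R w1) + (T1 *\<^sub>R w1 - k) - x2)" by (simp add: algebra_simps)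
    then show ?thesis using norm_triangle_ineq4[of "(y1 - T1 *\<^sub>R w1) + (T1 *\<^sub>R w1 - k)" x2]
        norm_triangle_ineq[of "y1 - T1 *\<^sub>R w1" "T1 *\<^sub>R w1 - k"] by linarith
  qed
  then have d1: "norm (y1 - (x2 + k)) \<le> 3 * r" using p1 p2 k by simp
  have "norm ((y2 + k) - y) \<le> 3 * r + R"
  proof -
    have "norm ((y2 + k) - y) = norm ((y2 - T2 *\<^sub>R w2) - (T1 *\<^sub>R w1 - k) - ((T1 + T2 + 2) *\<^sub>R w - (T1 *\<^sub>R w1 + T2 *\<^sub>R w2)) - (y - (T1 + T2 + 2) *\<^sub>R w))"
      by (simp add: algebra_simps)
    then show ?thesis
      using norm_triangle_ineq4[of "(y2 - T2 *\<^sub>R w2) - (T1 *\<^sub>R w1 - k) - ((T1 + T2 + 2) *\<^sub>R w - (T1 *\<^sub>R w1 + T2 *\<^sub>R w2))" "y - (T1 + T2 + 2) *\<^sub>R w"]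
        norm_triangle_ineq4[of "(y2 - T2 *\<^sub>R w2) - (T1 *\<^sub>R w1 - k)" "(T1 + T2 + 2) *\<^sub>R w - (T1 *\<^sub>R w1 + T2 *\<^sub>R w2)"]
        norm_triangle_ineq4[of "y2 - T2 *\<^sub>R w2" "T1 *\<^sub>R w1 - k"] p2(3) k(2) R y(2) by linarith
  qed
  then have c2: "reach \<phi> z 1 (y2 + k) y ((C * (3 * r + R))\<^sup>2 / 1)"
    using ends y by (intro connecting_constD[OF C]) auto
  have c1: "reach \<phi> z 1 y1 (x2 + k) ((C * (3 * r))\<^sup>2 / 1)"
    using ends d1 by (intro connecting_constD[OF C]) auto
  have "reach \<phi> z (T1 + 1 + T2 + 1) x1 y (E1 + (C * (3 * r))\<^sup>2 / 1 + E2 + (C * (3 * r + R))\<^sup>2 / 1)"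
    using T p1(4) p2(4) by (intro reach_trans[OF reach_trans[OF reach_trans[OF p1(1) c1] q2] c2]) auto
  then have "reach \<phi> z (T1 + T2 + 2) x1 y (E1 + E2 + ((C * (3 * r))\<^sup>2 + (C * (3 * r + R))\<^sup>2))"
    by (simp add: algebra_simps)
  then show thesis using y(2) by (rule that)
qed

lemma block_length_pos: "T \<ge> 1 \<Longrightarrow> 0 < real (Suc n) * (T + 2) - 2"
proof -
  assume "T \<ge> 1"
  then have "0 < real n * (T + 2) + T" by (intro add_nonneg_pos mult_nonneg_nonneg) auto
  then show ?thesis by (simp add: algebra_simps)
qed

lemma norm_excess_time:
  fixes w :: "'a::real_normed_vector"
  shows "norm ((S + T + 2) *\<^sub>R w - (S *\<^sub>R w + T *\<^sub>R w)) \<le> 2 * norm w"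
  by (simp add: scaleR_add_left)

text \<open>An almost optimal path of duration \<open>T\<close> is repeated as often as it fits into a long duration \<open>S\<close>; each
  repetition costs at most \<open>K0\<close> on top of its energy.\<close>
lemma psi_z_limsup_le:
  fixes \<phi> :: "real^'m \<Rightarrow> real^'n"
  assumes per: "one_periodic \<phi>" "z \<in> range \<phi>" and C: "connecting_const \<phi> z C"
  obtains K where "0 \<le> K" "\<And>T. T \<ge> 1 \<Longrightarrow> Limsup at_top (\<lambda>S. psi_z \<phi> z S w) \<le> psi_z \<phi> z T w + ennreal (K / T)"
proof -
  define r where "r = sqrt (real CARD('m))"
  define K0 where "K0 = (C * (3 * r))\<^sup>2 + (C * (3 * r + 2 * norm w))\<^sup>2"
  have K0: "0 \<le> K0" by (simp add: K0_def)
  have "Limsup at_top (\<lambda>S. psi_z \<phi> z S w) \<le> psi_z \<phi> z T w + ennreal ((K0 + 2) / T)" if T: "T \<ge> 1" for T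
  proof -
    have "psi_z \<phi> z T w \<le> ennreal ((C * (T * norm w + 2 * sqrt (real CARD('m))))\<^sup>2 / T / T)"
      using T by (intro psi_z_upper assms) auto
    then obtain f where f: "psi_z \<phi> z T w = ennreal f" "0 \<le> f" by (cases "psi_z \<phi> z T w") (auto simp: top_unique)
    then have "psi_z \<phi> z T w < ennreal (f + 1 / T)" using T by (simp add: ennreal_less_iff)
    then obtain x y E where xy: "reach \<phi> z T x y E" "norm x \<le> r" "norm (y - T *\<^sub>R w) \<le> r" "0 \<le> E" "E \<le> (f + 1 / T) * T"
      using psi_z_less_imp_reach[of T \<phi> z w "f + 1 / T"] T unfolding r_def by auto
    have E: "E \<le> f * T + 1" using xy(5) T by (simp add: distrib_right)
    \<comment> \<open>The final two time units are missing because \<open>Suc n\<close> copies are joined only \<open>n\<close> times.\<close>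
    have step: "\<exists>y'. reach \<phi> z (real (Suc n) * (T + 2) - 2) x y' (real (Suc n) * (E + K0)) \<and> norm (y' - (real (Suc n) * (T + 2) - 2) *\<^sub>R w) \<le> r" for n
    proof (induction n)
      case 0
      show ?case using xy K0 by (intro exI[of _ y]) (auto intro: reach_mono)
    next
      case (Suc n)
      let ?S = "real (Suc n) * (T + 2) - 2"
      have S: "?S > 0" by (rule block_length_pos[OF T])
      obtain y' where y': "reach \<phi> z ?S x y' (real (Suc n) * (E + K0))" "norm (y' - ?S *\<^sub>R w) \<le> r" using Suc by blast
      have "norm ((?S + T + 2) *\<^sub>R w - (?S *\<^sub>R w + T *\<^sub>R w)) \<le> 2 * norm w"
        by (rule norm_excess_time)
      then obtain y'' where "reach \<phi> z (?S + T + 2) x y'' (real (Suc n) * (E + K0) + E + K0)" "norm (y'' - (?S + T + 2) *\<^sub>R w) \<le> r"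
        using reach_join[OF per C S, of T x y' "real (Suc n) * (E + K0)" w x y E w w "2 * norm w"] T xy y' K0
        unfolding r_def[symmetric] K0_def[symmetric] by auto
      moreover have "?S + T + 2 = real (Suc (Suc n)) * (T + 2) - 2" by (simp add: algebra_simps)
      moreover have "real (Suc n) * (E + K0) + E + K0 = real (Suc (Suc n)) * (E + K0)" by (simp add: algebra_simps)
      ultimately show ?case by metis
    qed
    define D where "D = (C * ((T + 3) * norm w + 2 * r))\<^sup>2"
    have bound: "psi_z \<phi> z S w \<le> ennreal (f + (K0 + 1) / T + (D + K0) / S)" if S: "S \<ge> 2 * (T + 3)" for S
    proof -
      \<comment> \<open>The number of copies is chosen so that the remaining time \<open>\<rho>\<close> lies between \<open>1\<close> and \<open>T + 3\<close>; it is
        filled with a single connection, whose energy is at most \<open>D\<close>, uniformly in \<open>S\<close>.\<close>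
      define n where "n = nat \<lfloor>(S - 1) / (T + 2)\<rfloor> - 1"
      have "2 \<le> (S - 1) / (T + 2)"
        using S T by (simp add: field_simps)
      then have nS: "real (Suc n) = of_int \<lfloor>(S - 1) / (T + 2)\<rfloor>"
        unfolding n_def by (simp add: of_nat_diff)
      then have "real (Suc n) \<le> (S - 1) / (T + 2)" "(S - 1) / (T + 2) < real (Suc n) + 1" by linarith+
      then have n: "real (Suc n) * (T + 2) \<le> S - 1" "S - 1 < (real (Suc n) + 1) * (T + 2)"
        using T by (simp_all add: field_simps)
      define S1 where "S1 = real (Suc n) * (T + 2) - 2"
      have S1: "S1 > 0" unfolding S1_def by (rule block_length_pos[OF T])
      define \<rho> where "\<rho> = S - S1 - 2"
      have \<rho>: "1 \<le> \<rho>" "\<rho> \<le> T + 3" using n by (auto simp: \<rho>_def S1_def algebra_simps)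
      obtain y' where y': "reach \<phi> z S1 x y' (real (Suc n) * (E + K0))" "norm (y' - S1 *\<^sub>R w) \<le> r"
        using step[of n] unfolding S1_def by blast
      obtain a where a: "\<phi> a = z" "norm (a - 0) \<le> r" unfolding r_def using level_point_near[OF per] by blast
      obtain b where b: "\<phi> b = z" "norm (b - \<rho> *\<^sub>R w) \<le> r" unfolding r_def using level_point_near[OF per] by blast
      have "norm (a - b) \<le> norm a + (norm (b - \<rho> *\<^sub>R w) + norm (\<rho> *\<^sub>R w))"
        using norm_triangle_ineq4[of a b] norm_triangle_sub[of b "\<rho> *\<^sub>R w"] by linarith
      also have "\<dots> \<le> (T + 3) * norm w + 2 * r"
        using a b \<rho> mult_right_mono[OF \<rho>(2) norm_ge_zero[of w]] by simp
      finally have "reach \<phi> z \<rho> a b ((C * ((T + 3) * norm w + 2 * r))\<^sup>2 / \<rho>)"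
        using \<rho> by (intro connecting_constD C a b) auto
      moreover have "(C * ((T + 3) * norm w + 2 * r))\<^sup>2 / \<rho> \<le> D"
        using \<rho> unfolding D_def by (simp add: divide_le_eq mult_le_cancel_left1)
      ultimately have ab: "reach \<phi> z \<rho> a b D" by (rule reach_mono)
      have "norm ((S1 + \<rho> + 2) *\<^sub>R w - (S1 *\<^sub>R w + \<rho> *\<^sub>R w)) \<le> 2 * norm w" by (simp add: algebra_simps)
      then obtain y'' where y'': "reach \<phi> z (S1 + \<rho> + 2) x y'' (real (Suc n) * (E + K0) + D + K0)" "norm (y'' - (S1 + \<rho> + 2) *\<^sub>R w) \<le> r"
        using reach_join[OF per C S1, of \<rho> x y' "real (Suc n) * (E + K0)" w a b D w w "2 * norm w"] \<rho> xy y' K0 a b ab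
        unfolding r_def[symmetric] K0_def[symmetric] by (auto simp: D_def)
      have Seq: "S1 + \<rho> + 2 = S" by (simp add: \<rho>_def)
      have "psi_z \<phi> z S w \<le> ennreal ((real (Suc n) * (E + K0) + D + K0) / S)"
        using S T xy K0 y''(1,2) unfolding Seq by (intro psi_z_le_of_reach) (auto simp: r_def D_def)
      also have "(real (Suc n) * (E + K0) + D + K0) / S \<le> f + (K0 + 1) / T + (D + K0) / S"
      proof -
        have "real (Suc n) * T \<le> S" using n(1) T by (simp add: algebra_simps)
        then have "real (Suc n) * T * (E + K0) \<le> S * (f * T + 1 + K0)"
          using E K0 xy S T by (intro mult_mono) auto
        then have "real (Suc n) * (E + K0) / S \<le> (f * T + 1 + K0) / T"
          using S T by (simp add: field_simps)
        also have "\<dots> = f + (K0 + 1) / T" using T by (simp add: field_simps)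
        finally show ?thesis by (simp add: add_divide_distrib)
      qed
      finally show ?thesis by (simp add: ennreal_leI)
    qed
    have "Limsup at_top (\<lambda>S. psi_z \<phi> z S w) \<le> ennreal (f + (K0 + 2) / T)"
    proof (rule Limsup_bounded)
      have "\<forall>\<^sub>F S in at_top. (D + K0) / S < 1 / T"
      proof (rule order_tendstoD(2))
        show "((\<lambda>S. (D + K0) / S) \<longlongrightarrow> 0) at_top" by (intro tendsto_divide_0[OF tendsto_const] filterlim_at_top_imp_at_infinity filterlim_ident)
      qed (use T in simp)
      then show "\<forall>\<^sub>F S in at_top. psi_z \<phi> z S w \<le> ennreal (f + (K0 + 2) / T)"
        using eventually_ge_at_top[of "2 * (T + 3)"]
      proof eventually_elim
        case (elim S)
        have "f + (K0 + 1) / T + (D + K0) / S \<le> f + (K0 + 2) / T"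
          using elim(1) by (simp add: add_divide_distrib)
        then show ?case using bound[OF elim(2)] by (meson ennreal_leI order_trans)
      qed
    qed
    then show ?thesis using f K0 T by (simp add: ennreal_plus)
  qed
  then show thesis using K0 by (intro that[of "K0 + 2"]) auto
qed

text \<open>Let \<open>T\<close> tend to infinity along values of \<open>f\<close> close to its lower limit.\<close>
lemma tendsto_of_almost_subadditive:
  fixes f :: "real \<Rightarrow> ennreal"
  assumes "\<And>T. T \<ge> 1 \<Longrightarrow> Limsup at_top f \<le> f T + ennreal (K / T)" "0 \<le> K"
  shows "(f \<longlongrightarrow> Limsup at_top f) at_top"
proof -
  have "Limsup at_top f \<le> Liminf at_top f"
    unfolding le_Liminf_iff
  proof (intro allI impI)
    fix y assume y: "y < Limsup at_top f"
    then obtain y' where y': "y < y'" "y' < Limsup at_top f" using dense by blast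
    obtain a where a: "y = ennreal a" "0 \<le> a" using y by (cases y) auto
    obtain b where b: "y' = ennreal b" "0 \<le> b" using y' by (cases y') auto
    have ab: "a < b" using y' a b by (simp add: ennreal_less_iff)
    have "\<forall>\<^sub>F T in at_top. K / T < b - a"
    proof (rule order_tendstoD(2))
      show "((\<lambda>S. K / S) \<longlongrightarrow> 0) at_top" by (intro tendsto_divide_0[OF tendsto_const] filterlim_at_top_imp_at_infinity filterlim_ident)
    qed (use ab in simp)
    then show "\<forall>\<^sub>F T in at_top. y < f T"
      using eventually_ge_at_top[of 1]
    proof eventually_elim
      case (elim T)
      show ?case
      proof (rule ccontr)
        assume "\<not> y < f T"
        then have "Limsup at_top f \<le> ennreal a + ennreal (K / T)"
          using assms(1)[OF elim(2)] a by (meson add_right_mono not_less order_trans)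
        also have "\<dots> = ennreal (a + K / T)" using a assms(2) elim by simp
        also have "\<dots> \<le> y'" using elim b by (simp add: ennreal_leI)
        finally show False using y' by simp
      qed
    qed
  qed
  then have "Liminf at_top f = Limsup at_top f" by (intro antisym Liminf_le_Limsup) auto
  then show ?thesis by (subst tendsto_iff_Liminf_eq_Limsup) auto
qed

text \<open>By the theorem of Sura-Bura each point of the level has a bounded neighbourhood that is open and
  closed relative to the level, so a connected subset of the level that meets it stays in it. Finitely
  many of them cover the part of the level near the origin, and by periodicity every connected subset
  can be moved so as to meet this part.\<close>
lemma bounded_components_displacement:
  fixes \<phi> :: "real^'m \<Rightarrow> real^'n"
  assumes per: "one_periodic \<phi>" and cont: "continuous_on UNIV \<phi>"
    and comp: "\<And>K. K \<in> components (level_set \<phi> z) \<Longrightarrow> bounded K"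
  shows "\<exists>D\<ge>0. \<forall>S x y. connected S \<longrightarrow> S \<subseteq> level_set \<phi> z \<longrightarrow> x \<in> S \<longrightarrow> y \<in> S \<longrightarrow> norm (y - x) \<le> D"
proof -
  define r where "r = sqrt (real CARD('m))"
  define Z where "Z = level_set \<phi> z"
  have "level_set \<phi> z = \<phi> -` {z} \<inter> UNIV" by (auto simp: level_set_def)
  then have Zc: "closed Z" unfolding Z_def
    using continuous_closed_preimage[OF cont closed_UNIV closed_singleton, of z] by simp
  have "\<exists>V. open V \<and> x \<in> V \<and> bounded (Z \<inter> V) \<and> closed (Z \<inter> V)" if "x \<in> Z" for x
  proof -
    define Cx where "Cx = connected_component_set Z x"
    have Cx: "Cx \<in> components Z" "x \<in> Cx" unfolding Cx_def using that by (auto intro: componentsI)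
    have "compact Cx"
      using comp Cx(1) Zc by (auto simp: compact_eq_bounded_closed Z_def intro: closed_components)
    then obtain K where K: "openin (top_of_set Z) K" "compact K" "Cx \<subseteq> K"
      using Sura_Bura_clopen_subset[OF closed_imp_locally_compact[OF Zc] Cx(1) _ open_UNIV] by auto
    then obtain V where "open V" "K = Z \<inter> V" by (auto simp: openin_open)
    then show ?thesis using K Cx by (intro exI[of _ V]) (auto simp: compact_eq_bounded_closed)
  qed
  then obtain V where V: "\<And>x. x \<in> Z \<Longrightarrow> open (V x) \<and> x \<in> V x \<and> bounded (Z \<inter> V x) \<and> closed (Z \<inter> V x)" by metis
  define K where "K x = Z \<inter> V x" for x
  have VK: "\<And>x. x \<in> Z \<Longrightarrow> open (V x)" "\<And>x. x \<in> Z \<Longrightarrow> x \<in> V x" "\<And>x. x \<in> Z \<Longrightarrow> bounded (K x)"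
    "\<And>x. x \<in> Z \<Longrightarrow> closed (K x)" "\<And>x. x \<in> Z \<Longrightarrow> K x = Z \<inter> V x" using V by (auto simp: K_def)
  define X where "X = Z \<inter> cball 0 r"
  have "compact X" unfolding X_def using Zc by (intro closed_Int_compact) auto
  moreover have "X \<subseteq> (\<Union>x\<in>X. V x)" using VK(2) by (auto simp: X_def)
  ultimately obtain A where A: "A \<subseteq> X" "finite A" "X \<subseteq> (\<Union>x\<in>A. V x)"
    using VK(1) by (elim compactE_image[of X X V]) (auto simp: X_def)
  have "bounded (\<Union>x\<in>A. K x)" using A VK(3) by (intro bounded_UN) (auto simp: X_def)
  then obtain B where B: "\<And>x p. x \<in> A \<Longrightarrow> p \<in> K x \<Longrightarrow> norm p \<le> B" unfolding bounded_iff by blast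
  define D where "D = 2 * max 0 B"
  have "norm (y - x) \<le> D" if S: "connected S" "S \<subseteq> Z" "x \<in> S" "y \<in> S" for S x y
  proof -
    obtain k where k: "k \<in> lattice" "norm (x - k) \<le> r" unfolding r_def by (rule lattice_near)
    define S' where "S' = (\<lambda>p. p + - k) ` S"
    have S': "connected S'" "S' \<subseteq> Z" "x - k \<in> S'" "y - k \<in> S'"
    proof -
      show "connected S'" unfolding S'_def by (intro connected_continuous_image S continuous_intros)
      show "S' \<subseteq> Z" using S(2) periodic_diff[OF per k(1)] by (auto simp: S'_def Z_def level_set_def)
    qed (use S in \<open>auto simp: S'_def\<close>)
    then have "x - k \<in> X" using k by (auto simp: X_def)
    then obtain a where a: "a \<in> A" "x - k \<in> V a" using A by blast
    then have aZ: "a \<in> Z" using A by (auto simp: X_def)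
    have "y - k \<in> V a"
    proof (rule ccontr)
      assume y: "y - k \<notin> V a"
      have "V a \<inter> S' = {} \<or> - K a \<inter> S' = {}"
      proof (rule connectedD[OF S'(1)])
        show "open (- K a)" using VK(4)[OF aZ] by (rule open_Compl)
        show "V a \<inter> - K a \<inter> S' = {}" "S' \<subseteq> V a \<union> - K a" using S'(2) VK(5)[OF aZ] by auto
      qed (rule VK(1)[OF aZ])
      then show False using a S' y VK(5)[OF aZ] by auto
    qed
    then have "x - k \<in> K a" "y - k \<in> K a" using a S' VK(5)[OF aZ] by auto
    then have "norm (x - k) \<le> B" "norm (y - k) \<le> B" using B a by auto
    moreover have "y - x = (y - k) - (x - k)" by simp
    then have "norm (y - x) \<le> norm (y - k) + norm (x - k)" by (metis norm_triangle_ineq4)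
    ultimately show ?thesis by (simp add: D_def)
  qed
  moreover have "0 \<le> D" by (simp add: D_def)
  ultimately show ?thesis unfolding Z_def by blast
qed

section \<open>Affine minorants of convex functions\<close>

text \<open>Separate \<open>(w, m)\<close> from the closed epigraph. The hyperplane is not vertical, since the epigraph
  contains a point above \<open>w\<close>.\<close>
lemma convex_affine_minorant:
  fixes f :: "'a::euclidean_space \<Rightarrow> real"
  assumes f: "convex_on UNIV f" and "m < f w"
  obtains a b where "\<And>x. a \<bullet> x + b \<le> f x" "m < a \<bullet> w + b"
proof -
  define S where "S = {p :: 'a \<times> real. f (fst p) \<le> snd p}"
  have "continuous_on UNIV f" by (rule convex_on_continuous[OF open_UNIV f])
  then have "closed S"
    unfolding S_def by (intro closed_Collect_le continuous_intros continuous_on_compose2[of UNIV f _ fst]) auto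
  moreover have "S = epigraph UNIV f" by (auto simp: S_def epigraph_def)
  then have "convex S" using f by (simp add: convex_epigraphI)
  moreover have "(w, m) \<notin> S" using assms(2) by (simp add: S_def)
  ultimately obtain n c where sep: "n \<bullet> (w, m) < c" "\<And>p. p \<in> S \<Longrightarrow> c < n \<bullet> p"
    using separating_hyperplane_closed_point[of S "(w, m)"] by blast
  obtain n1 \<alpha> where n: "n = (n1, \<alpha>)" by (cases n)
  have below: "n1 \<bullet> w + \<alpha> * m < c" using sep(1) by (simp add: n)
  have above: "c < n1 \<bullet> x + \<alpha> * f x" for x
    using sep(2)[of "(x, f x)"] by (simp add: n S_def)
  have "\<alpha> * (f w - m) > 0" using below above[of w] by (simp add: algebra_simps)
  then have \<alpha>: "\<alpha> > 0" using assms(2) by (simp add: zero_less_mult_iff)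
  show thesis
  proof (rule that)
    show "(- (1 / \<alpha>) *\<^sub>R n1) \<bullet> x + c / \<alpha> \<le> f x" for x
      using above[of x] \<alpha> by (simp add: field_simps)
    show "m < (- (1 / \<alpha>) *\<^sub>R n1) \<bullet> w + c / \<alpha>"
      using below \<alpha> by (simp add: field_simps)
  qed
qed

section \<open>Existence and convexity of the integrand of a level\<close>

lemma energy_imp_continuous:
  assumes "energy a b u \<le> ennreal K"
  shows "continuous_on {a..b} u"
proof -
  have le: "energy a b u \<le> ennreal (max 0 K)" using assms by (auto simp: max_def ennreal_neg)
  show ?thesis
    unfolding continuous_on_def
  proof
    fix t assume t: "t \<in> {a..b}"
    show "(u \<longlongrightarrow> u t) (at t within {a..b})"
    proof (rule Lim_null_comparison[where g = "\<lambda>s. sqrt (\<bar>s - t\<bar> * max 0 K)" and f = "\<lambda>s. u s - u t", THEN LIM_zero_cancel])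
      show "\<forall>\<^sub>F s in at t within {a..b}. norm (u s - u t) \<le> sqrt (\<bar>s - t\<bar> * max 0 K)"
        unfolding eventually_at_filter
        using energy_increment[OF t _ le] by (auto intro!: always_eventually real_le_rsqrt)
      have "((\<lambda>s. sqrt (\<bar>s - t\<bar> * max 0 K)) \<longlongrightarrow> sqrt (\<bar>t - t\<bar> * max 0 K)) (at t within {a..b})" by (intro tendsto_intros)
      then show "((\<lambda>s. sqrt (\<bar>s - t\<bar> * max 0 K)) \<longlongrightarrow> 0) (at t within {a..b})" by simp
    qed
  qed
qed

locale level_geometry =
  fixes \<phi> :: "real^'m \<Rightarrow> real^'n" and L :: real
  assumes periodic: "one_periodic \<phi>" and Lipschitz: "L-lipschitz_on UNIV \<phi>"
    and controlled: "controlled_length \<phi>" and nondegenerate: "nondegenerate_levels \<phi>"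
begin

lemma continuous_phi: "continuous_on S \<phi>"
  using lipschitz_on_continuous_on[OF Lipschitz] continuous_on_subset by blast

lemma compact_range: "compact (range \<phi>)"
proof -
  have "range \<phi> = \<phi> ` cball 0 (sqrt (real CARD('m)))"
  proof (intro antisym subsetI)
    fix z assume "z \<in> range \<phi>"
    then obtain x where "\<phi> x = z" "norm (x - 0) \<le> sqrt (real CARD('m))" using level_point_near[OF periodic] by blast
    then show "z \<in> \<phi> ` cball 0 (sqrt (real CARD('m)))" by auto
  qed auto
  moreover have "compact (\<phi> ` cball 0 (sqrt (real CARD('m))))" by (intro compact_continuous_image continuous_phi compact_cball)
  ultimately show ?thesis by simp
qed

definition displacement_bound :: "real^'n \<Rightarrow> real \<Rightarrow> bool" where
  "displacement_bound z D \<longleftrightarrow> 0 \<le> D \<and> (\<forall>T x y E. 0 \<le> T \<longrightarrow> reach \<phi> z T x y E \<longrightarrow> norm (y - x) \<le> D)"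

lemma displacement_boundD:
  "displacement_bound z D \<Longrightarrow> 0 \<le> T \<Longrightarrow> reach \<phi> z T x y E \<Longrightarrow> norm (y - x) \<le> D"
  unfolding displacement_bound_def by blast

text \<open>The controlled length condition gives the first alternative. In the second one the image of a level
  path is a connected subset of the level, of bounded diameter.\<close>
lemma level_dichotomy:
  assumes "z \<in> range \<phi>"
  obtains C where "connecting_const \<phi> z C" | D where "displacement_bound z D"
proof -
  have "unbounded_level \<phi> z \<or> (\<forall>K\<in>components (level_set \<phi> z). bounded K)"
    using nondegenerate assms by (auto simp: nondegenerate_levels_def)
  then show thesis
  proof
    assume "unbounded_level \<phi> z"
    then show thesis using unbounded_level_connecting_const[OF controlled assms] that(1) by blast
  next
    assume "\<forall>K\<in>components (level_set \<phi> z). bounded K"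
    then obtain D where D: "0 \<le> D" "\<And>S x y. connected S \<Longrightarrow> S \<subseteq> level_set \<phi> z \<Longrightarrow> x \<in> S \<Longrightarrow> y \<in> S \<Longrightarrow> norm (y - x) \<le> D"
      using bounded_components_displacement[OF periodic continuous_phi, of z] by blast
    have "norm (y - x) \<le> D" if T: "0 \<le> T" and r: "reach \<phi> z T x y E" for T x y E
    proof -
      obtain u where u: "u 0 = x" "u T = y" "\<forall>t\<in>{0..T}. \<phi> (u t) = z" "energy 0 T u \<le> ennreal E"
        using r by (auto simp: reach_def)
      have "connected (u ` {0..T})" by (intro connected_continuous_image energy_imp_continuous[OF u(4)]) simp
      then show ?thesis using u T by (intro D(2)[of "u ` {0..T}"]) (auto simp: level_set_def)
    qed
    then have "displacement_bound z D" using D(1) by (simp add: displacement_bound_def)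
    then show thesis by (rule that(2))
  qed
qed

text \<open>No level path can cover a distance of order \<open>T * norm w\<close>.\<close>
lemma psi_z_infinite:
  assumes "displacement_bound z D" "T > 0" "T * norm w > D + 2 * sqrt (real CARD('m))"
  shows "psi_z \<phi> z T w = \<infinity>"
proof (rule ccontr)
  assume "psi_z \<phi> z T w \<noteq> \<infinity>"
  then obtain f where "psi_z \<phi> z T w = ennreal f" "0 \<le> f" by (cases "psi_z \<phi> z T w") auto
  then have "psi_z \<phi> z T w < ennreal (f + 1)" by (simp add: ennreal_less_iff)
  then obtain x y E where xy: "reach \<phi> z T x y E" "norm x \<le> sqrt (real CARD('m))" "norm (y - T *\<^sub>R w) \<le> sqrt (real CARD('m))"
    by (rule psi_z_less_imp_reach[OF assms(2)])
  have "norm (y - x) \<le> D" using displacement_boundD[OF assms(1) _ xy(1)] assms(2) by simp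
  moreover have "norm (T *\<^sub>R w) = norm ((y - x) + x - (y - T *\<^sub>R w))" by simp
  then have "norm (T *\<^sub>R w) \<le> norm (y - x) + norm x + norm (y - T *\<^sub>R w)"
    using norm_triangle_ineq4[of "(y - x) + x" "y - T *\<^sub>R w"] norm_triangle_ineq[of "y - x" x] by linarith
  ultimately show False using xy(2,3) assms by simp
qed

lemma psi_hom_z_eqI:
  assumes "((\<lambda>T. psi_z \<phi> z T w) \<longlongrightarrow> l) at_top"
  shows "psi_hom_z \<phi> z w = l"
  unfolding psi_hom_z_def by (rule tendsto_Lim[OF _ assms]) simp

lemma psi_z_tendsto_zero:
  assumes "z \<in> range \<phi>"
  shows "((\<lambda>T. psi_z \<phi> z T 0) \<longlongrightarrow> 0) at_top"
proof (rule tendsto_eventually)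
  show "\<forall>\<^sub>F T in at_top. psi_z \<phi> z T 0 = 0"
    using eventually_gt_at_top[of 0] by eventually_elim (rule psi_z_zero[OF periodic assms])
qed

lemma psi_z_tendsto_infinity:
  assumes "displacement_bound z D" "w \<noteq> 0"
  shows "((\<lambda>T. psi_z \<phi> z T w) \<longlongrightarrow> \<infinity>) at_top"
proof (rule tendsto_eventually)
  have "\<forall>\<^sub>F T in at_top. T > max 0 ((D + 2 * sqrt (real CARD('m))) / norm w)" by (rule eventually_gt_at_top)
  then show "\<forall>\<^sub>F T in at_top. psi_z \<phi> z T w = \<infinity>"
  proof eventually_elim
    case (elim T)
    then show ?case using assms(2) by (intro psi_z_infinite[OF assms(1)]) (auto simp: field_simps)
  qed
qed

lemma psi_z_tendsto:
  assumes "z \<in> range \<phi>"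
  shows "((\<lambda>T. psi_z \<phi> z T w) \<longlongrightarrow> psi_hom_z \<phi> z w) at_top"
proof -
  have "\<exists>l. ((\<lambda>T. psi_z \<phi> z T w) \<longlongrightarrow> l) at_top"
  proof (cases rule: level_dichotomy[OF assms])
    case (1 C)
    then obtain K where "0 \<le> K" "\<And>T. T \<ge> 1 \<Longrightarrow> Limsup at_top (\<lambda>S. psi_z \<phi> z S w) \<le> psi_z \<phi> z T w + ennreal (K / T)"
      using psi_z_limsup_le[OF periodic assms 1, of w] by blast
    then show ?thesis using tendsto_of_almost_subadditive[of "\<lambda>S. psi_z \<phi> z S w" K] by blast
  next
    case (2 D)
    then show ?thesis using psi_z_tendsto_infinity psi_z_tendsto_zero[OF assms] by (cases "w = 0") blast+
  qed
  then show ?thesis using psi_hom_z_eqI by blast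
qed

lemma psi_hom_z_0: "z \<in> range \<phi> \<Longrightarrow> psi_hom_z \<phi> z 0 = 0"
  by (rule psi_hom_z_eqI[OF psi_z_tendsto_zero])

lemma psi_hom_z_infinity: "displacement_bound z D \<Longrightarrow> w \<noteq> 0 \<Longrightarrow> psi_hom_z \<phi> z w = \<infinity>"
  by (rule psi_hom_z_eqI[OF psi_z_tendsto_infinity])

lemma psi_hom_z_upper:
  assumes "z \<in> range \<phi>" "connecting_const \<phi> z C"
  shows "psi_hom_z \<phi> z w \<le> ennreal ((C * norm w)\<^sup>2)"
proof (rule tendsto_le[OF _ _ psi_z_tendsto[OF assms(1), of w]])
  have "((\<lambda>T. C * (norm w + 2 * sqrt (real CARD('m)) / T)) \<longlongrightarrow> C * (norm w + 0)) at_top"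
    by (intro tendsto_intros tendsto_divide_0[OF tendsto_const] filterlim_at_top_imp_at_infinity filterlim_ident)
  then have "((\<lambda>T. ennreal ((C * (norm w + 2 * sqrt (real CARD('m)) / T))\<^sup>2)) \<longlongrightarrow> ennreal ((C * (norm w + 0))\<^sup>2)) at_top"
    by (intro tendsto_ennrealI tendsto_power)
  then show "((\<lambda>T. ennreal ((C * (norm w + 2 * sqrt (real CARD('m)) / T))\<^sup>2)) \<longlongrightarrow> ennreal ((C * norm w)\<^sup>2)) at_top" by simp
  show "\<forall>\<^sub>F T in at_top. psi_z \<phi> z T w \<le> ennreal ((C * (norm w + 2 * sqrt (real CARD('m)) / T))\<^sup>2)"
    using eventually_gt_at_top[of 0]
  proof eventually_elim
    case (elim T)
    have "(C * (T * norm w + 2 * sqrt (real CARD('m))))\<^sup>2 / T / T = (C * (norm w + 2 * sqrt (real CARD('m)) / T))\<^sup>2"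
    proof -
      have "C * (T * norm w + 2 * sqrt (real CARD('m))) = T * (C * (norm w + 2 * sqrt (real CARD('m)) / T))" using elim by (simp add: field_simps)
      then show ?thesis using elim by (simp only: power_mult_distrib[of T]) (simp add: power2_eq_square)
    qed
    then show ?case using psi_z_upper[OF periodic assms elim, of w] by simp
  qed
qed auto

lemma psi_hom_z_finite:
  assumes "z \<in> range \<phi>" "connecting_const \<phi> z C"
  shows "ennreal (enn2real (psi_hom_z \<phi> z w)) = psi_hom_z \<phi> z w"
  using psi_hom_z_upper[OF assms, of w] by (intro ennreal_enn2real) (auto intro: le_less_trans)

text \<open>Joining almost optimal paths of slopes \<open>w1\<close> and \<open>w2\<close> and durations \<open>(1 - s) * T\<close> and \<open>s * T\<close> gives a
  path of the intermediate slope; the bounded cost of joining is negligible as \<open>T\<close> grows.\<close>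
lemma psi_hom_z_convex:
  assumes z: "z \<in> range \<phi>" and C: "connecting_const \<phi> z C"
  shows "convex_on UNIV (\<lambda>w. enn2real (psi_hom_z \<phi> z w))"
proof (rule convex_onI)
  fix s :: real and w1 w2 :: "real^'m"
  assume s: "0 < s" "s < 1"
  define w where "w = (1 - s) *\<^sub>R w1 + s *\<^sub>R w2"
  define F where "F T v = enn2real (psi_z \<phi> z T v)" for T v
  define K where "K = (C * (3 * sqrt (real CARD('m))))\<^sup>2 + (C * (3 * sqrt (real CARD('m)) + 2 * norm w))\<^sup>2"
  have fin: "psi_z \<phi> z T v = ennreal (F T v)" if "T > 0" for T v
    unfolding F_def using psi_z_upper[OF periodic z C that, of v]
    by (intro ennreal_enn2real[symmetric]) (auto intro: le_less_trans)
  have lim: "((\<lambda>T. F T v) \<longlongrightarrow> enn2real (psi_hom_z \<phi> z v)) at_top" for v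
    unfolding F_def using psi_z_tendsto[OF z, of v]
    by (intro tendsto_enn2real) (simp_all only: psi_hom_z_finite[OF z C] enn2real_nonneg)
  have scaled: "filterlim (\<lambda>T::real. c * T) at_top at_top" if "c > 0" for c :: real
    using filterlim_tendsto_pos_mult_at_top[OF tendsto_const that filterlim_ident] by simp
  have shifted: "filterlim (\<lambda>T::real. T + 2) at_top at_top"
    using filterlim_tendsto_add_at_top[OF tendsto_const filterlim_ident, of "2::real"] by (simp add: add.commute)
  have main: "F (T + 2) w \<le> (((1 - s) * T) * F ((1 - s) * T) w1 + (s * T) * F (s * T) w2 + (2 + K)) / (T + 2)" if T: "T > 0" for T
  proof -
    define T1 T2 where "T1 = (1 - s) * T" and "T2 = s * T"
    have T12: "T1 > 0" "T2 > 0" "T1 + T2 = T" using s T by (auto simp: T1_def T2_def algebra_simps)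
    have ex: "\<exists>x y E. reach \<phi> z T' x y E \<and> norm x \<le> sqrt (real CARD('m)) \<and> norm (y - T' *\<^sub>R v) \<le> sqrt (real CARD('m)) \<and> 0 \<le> E \<and> E \<le> T' * F T' v + 1"
      if T': "T' > 0" for T' v
    proof -
      have "0 \<le> F T' v" by (simp add: F_def)
      then have "psi_z \<phi> z T' v < ennreal (F T' v + 1 / T')" unfolding fin[OF T'] using T' by (simp add: ennreal_less_iff)
      then obtain x y E where "reach \<phi> z T' x y E" "norm x \<le> sqrt (real CARD('m))" "norm (y - T' *\<^sub>R v) \<le> sqrt (real CARD('m))" "0 \<le> E" "E \<le> (F T' v + 1 / T') * T'"
        by (rule psi_z_less_imp_reach[OF T'])
      moreover have "(F T' v + 1 / T') * T' = T' * F T' v + 1" using T' by (simp add: field_simps)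
      ultimately show ?thesis by metis
    qed
    obtain x1 y1 E1 where 1: "reach \<phi> z T1 x1 y1 E1" "norm x1 \<le> sqrt (real CARD('m))" "norm (y1 - T1 *\<^sub>R w1) \<le> sqrt (real CARD('m))" "0 \<le> E1" "E1 \<le> T1 * F T1 w1 + 1"
      using ex[OF T12(1)] by blast
    obtain x2 y2 E2 where 2: "reach \<phi> z T2 x2 y2 E2" "norm x2 \<le> sqrt (real CARD('m))" "norm (y2 - T2 *\<^sub>R w2) \<le> sqrt (real CARD('m))" "0 \<le> E2" "E2 \<le> T2 * F T2 w2 + 1"
      using ex[OF T12(2)] by blast
    have "(T1 + T2 + 2) *\<^sub>R w - (T1 *\<^sub>R w1 + T2 *\<^sub>R w2) = 2 *\<^sub>R w"
    proof -
      have "T1 *\<^sub>R w1 + T2 *\<^sub>R w2 = T *\<^sub>R w"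
        by (simp add: T1_def T2_def w_def scaleR_add_right mult.commute)
      then show ?thesis unfolding T12(3) by (simp add: scaleR_add_left)
    qed
    then have "norm ((T1 + T2 + 2) *\<^sub>R w - (T1 *\<^sub>R w1 + T2 *\<^sub>R w2)) \<le> 2 * norm w" by simp
    then obtain y where y: "reach \<phi> z (T1 + T2 + 2) x1 y (E1 + E2 + K)" "norm (y - (T1 + T2 + 2) *\<^sub>R w) \<le> sqrt (real CARD('m))"
      unfolding K_def by (rule reach_join[OF periodic z C T12(1,2) 1(1-4) 2(1-4)])
    have K0: "0 \<le> K" by (simp add: K_def)
    have "psi_z \<phi> z (T + 2) w \<le> ennreal ((E1 + E2 + K) / (T + 2))"
      using T 1(4) 2(4) K0 by (intro psi_z_le_of_reach[OF _ y(1)[unfolded T12(3)] 1(2) y(2)[unfolded T12(3)]]) auto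
    then have "F (T + 2) w \<le> (E1 + E2 + K) / (T + 2)"
      using fin[of "T + 2" w] T 1 2 K0 by (simp add: ennreal_le_iff)
    also have "\<dots> \<le> (T1 * F T1 w1 + T2 * F T2 w2 + (2 + K)) / (T + 2)"
      using 1 2 T by (intro divide_right_mono) auto
    finally show ?thesis by (simp add: T1_def T2_def)
  qed
  have "enn2real (psi_hom_z \<phi> z w) \<le> (1 - s) * enn2real (psi_hom_z \<phi> z w1) + s * enn2real (psi_hom_z \<phi> z w2)"
  proof (rule tendsto_le)
    have ratio: "((\<lambda>T::real. T / (T + 2)) \<longlongrightarrow> 1) at_top" by real_asymp
    have small: "((\<lambda>T::real. (2 + K) / (T + 2)) \<longlongrightarrow> 0) at_top"
      by (intro tendsto_divide_0[OF tendsto_const] filterlim_at_top_imp_at_infinity shifted)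
    have "((\<lambda>T. (1 - s) * (T / (T + 2)) * F ((1 - s) * T) w1 + s * (T / (T + 2)) * F (s * T) w2 + (2 + K) / (T + 2))
       \<longlongrightarrow> (1 - s) * 1 * enn2real (psi_hom_z \<phi> z w1) + s * 1 * enn2real (psi_hom_z \<phi> z w2) + 0) at_top"
      using s by (intro tendsto_add tendsto_mult ratio small tendsto_const filterlim_compose[OF lim scaled]) auto
    then show "((\<lambda>T. (1 - s) * (T / (T + 2)) * F ((1 - s) * T) w1 + s * (T / (T + 2)) * F (s * T) w2 + (2 + K) / (T + 2))
       \<longlongrightarrow> (1 - s) * enn2real (psi_hom_z \<phi> z w1) + s * enn2real (psi_hom_z \<phi> z w2)) at_top" by simp
    show "((\<lambda>T. F (T + 2) w) \<longlongrightarrow> enn2real (psi_hom_z \<phi> z w)) at_top" by (rule filterlim_compose[OF lim shifted])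
    show "\<forall>\<^sub>F T in at_top. F (T + 2) w \<le> (1 - s) * (T / (T + 2)) * F ((1 - s) * T) w1 + s * (T / (T + 2)) * F (s * T) w2 + (2 + K) / (T + 2)"
      using eventually_gt_at_top[of 0]
    proof eventually_elim
      case (elim T)
      show ?case using main[OF elim] by (simp add: add_divide_distrib)
    qed
  qed simp
  then show "enn2real (psi_hom_z \<phi> z ((1 - s) *\<^sub>R w1 + s *\<^sub>R w2)) \<le> (1 - s) * enn2real (psi_hom_z \<phi> z w1) + s * enn2real (psi_hom_z \<phi> z w2)"
    by (simp add: w_def)
qed simp

section \<open>Compactness of cheap level paths\<close>

text \<open>The bound is affine in displacement and duration, so that it is additive under subdivision. The start
  is normalised to the fundamental cell for compactness.\<close>
definition cheap :: "real^'n \<Rightarrow> real^'m \<Rightarrow> real \<Rightarrow> real \<Rightarrow> bool" where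
  "cheap z a \<beta> T \<longleftrightarrow> (\<exists>v E. norm (v 0) \<le> sqrt (real CARD('m)) \<and> (\<forall>t\<in>{0..T}. \<phi> (v t) = z) \<and>
     energy 0 T v \<le> ennreal E \<and> 0 \<le> E \<and> E \<le> a \<bullet> (v T - v 0) + \<beta> * T)"

text \<open>The paths need to lie near a level only asymptotically. This covers both exact level paths on
  converging levels and paths along which \<open>\<phi>\<close> oscillates less and less.\<close>
lemma cheap_limit:
  assumes T: "0 \<le> T" and v0: "\<And>n. norm (v n 0) \<le> sqrt (real CARD('m))"
    and E: "\<And>n. energy 0 T (v n) \<le> ennreal (E n)" "\<And>n. 0 \<le> E n" "\<And>n. E n \<le> a \<bullet> (v n T - v n 0) + \<beta> * T"
    and osc: "\<And>n t. t \<in> {0..T} \<Longrightarrow> norm (\<phi> (v n t) - \<zeta> n) \<le> c n"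
    and c: "c \<longlonglongrightarrow> 0" and \<zeta>: "\<zeta> \<longlonglongrightarrow> z"
  shows "cheap z a \<beta> T"
proof -
  \<comment> \<open>The displacement \<open>d\<close> satisfies \<open>d\<^sup>2 \<le> T * E n\<close>, so \<open>norm a * d\<close> is at most half of
    \<open>T * (norm a)\<^sup>2 + E n\<close>; absorbing \<open>E n\<close> into the left side bounds it by \<open>K\<close>.\<close>
  define K where "K = (norm a)\<^sup>2 * T + 2 * \<bar>\<beta>\<bar> * T"
  have K0: "0 \<le> K" using T by (simp add: K_def)
  have EK: "E n \<le> K" for n
  proof -
    define d where "d = norm (v n T - v n 0)"
    have d: "d\<^sup>2 \<le> T * E n"
      using energy_increment[of 0 0 T T "v n" "E n"] E T by (simp add: d_def)
    have "a \<bullet> (v n T - v n 0) \<le> norm a * d" unfolding d_def by (rule norm_cauchy_schwarz)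
    moreover have "\<beta> * T \<le> \<bar>\<beta>\<bar> * T" using T by (intro mult_right_mono) auto
    ultimately have le: "E n \<le> norm a * d + \<bar>\<beta>\<bar> * T" using E(3)[of n] by linarith
    show ?thesis
    proof (cases "T = 0")
      case True
      then have "d = 0" using d by simp
      then show ?thesis using le True by (simp add: K_def)
    next
      case False
      then have T': "T > 0" using T by simp
      have "0 \<le> (T * norm a - d)\<^sup>2" by simp
      then have "2 * (T * (norm a * d)) \<le> T\<^sup>2 * (norm a)\<^sup>2 + d\<^sup>2" by (simp add: power2_eq_square algebra_simps)
      also have "\<dots> \<le> T * (T * (norm a)\<^sup>2 + E n)" using d by (simp add: power2_eq_square algebra_simps)
      finally have "T * (2 * (norm a * d)) \<le> T * (T * (norm a)\<^sup>2 + E n)" by simp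
      then have "2 * (norm a * d) \<le> T * (norm a)\<^sup>2 + E n" using T' by simp
      then show ?thesis using le by (simp add: K_def algebra_simps)
    qed
  qed
  have "energy 0 T (v n) \<le> ennreal K" for n using E(1)[of n] EK[of n] by (meson ennreal_leI order_trans)
  then obtain g r where g: "strict_mono (r :: nat \<Rightarrow> nat)" "\<And>t. t \<in> {0..T} \<Longrightarrow> (\<lambda>n. v (r n) t) \<longlonglongrightarrow> g t"
    using energy_compactness[of 0 T v "sqrt (real CARD('m))" K] T v0 K0 by metis
  define G where "G n = a \<bullet> (v (r n) T - v (r n) 0) + \<beta> * T" for n
  have G: "G \<longlonglongrightarrow> a \<bullet> (g T - g 0) + \<beta> * T"
    unfolding G_def using T by (intro tendsto_intros g) auto
  have "energy 0 T g \<le> ennreal (a \<bullet> (g T - g 0) + \<beta> * T)"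
  proof (rule energy_lsc[OF g(2) _ G])
    show "\<forall>\<^sub>F n in sequentially. energy 0 T (v (r n)) \<le> ennreal (G n)"
      unfolding G_def by (intro always_eventually allI order_trans[OF E(1) ennreal_leI[OF E(3)]])
  qed
  moreover have "0 \<le> a \<bullet> (g T - g 0) + \<beta> * T"
  proof (rule LIMSEQ_le_const[OF G])
    show "\<exists>N. \<forall>n\<ge>N. 0 \<le> G n" unfolding G_def using E(2,3) by (meson order_trans)
  qed
  moreover have "norm (g 0) \<le> sqrt (real CARD('m))"
    using T v0 by (intro LIMSEQ_le_const2[OF tendsto_norm[OF g(2)]]) auto
  moreover have "\<phi> (g t) = z" if t: "t \<in> {0..T}" for t
  proof -
    have 1: "(\<lambda>n. \<phi> (v (r n) t)) \<longlonglongrightarrow> \<phi> (g t)"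
      using continuous_on_tendsto_compose[OF continuous_phi[of UNIV] g(2)[OF t]] by auto
    have 2: "(\<lambda>n. \<zeta> (r n)) \<longlonglongrightarrow> z" "(\<lambda>n. c (r n)) \<longlonglongrightarrow> 0"
      using LIMSEQ_subseq_LIMSEQ[OF \<zeta> g(1)] LIMSEQ_subseq_LIMSEQ[OF c g(1)] by (simp_all add: o_def)
    have "(\<lambda>n. \<phi> (v (r n) t) - \<zeta> (r n)) \<longlonglongrightarrow> 0"
      using osc[OF t] by (intro Lim_null_comparison[OF _ 2(2)]) auto
    moreover have "(\<lambda>n. \<phi> (v (r n) t) - \<zeta> (r n)) \<longlonglongrightarrow> \<phi> (g t) - z" by (intro tendsto_diff 1 2(1))
    ultimately have "\<phi> (g t) - z = 0" using LIMSEQ_unique by blast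
    then show ?thesis by simp
  qed
  ultimately show ?thesis unfolding cheap_def by blast
qed

lemma cheap_limit_level:
  assumes "0 \<le> T" "\<And>n. cheap (\<zeta> n) a \<beta> T" "\<zeta> \<longlonglongrightarrow> z"
  shows "cheap z a \<beta> T"
proof -
  have "\<forall>n. \<exists>v E. norm (v 0) \<le> sqrt (real CARD('m)) \<and> (\<forall>t\<in>{0..T}. \<phi> (v t) = \<zeta> n) \<and>
     energy 0 T v \<le> ennreal E \<and> 0 \<le> E \<and> E \<le> a \<bullet> (v T - v 0) + \<beta> * T"
    using assms(2) unfolding cheap_def by blast
  then obtain v E where v: "\<And>n. norm (v n 0) \<le> sqrt (real CARD('m)) \<and> (\<forall>t\<in>{0..T}. \<phi> (v n t) = \<zeta> n) \<and>
     energy 0 T (v n) \<le> ennreal (E n) \<and> 0 \<le> E n \<and> E n \<le> a \<bullet> (v n T - v n 0) + \<beta> * T" by metis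
  show ?thesis
    by (rule cheap_limit[where v = v and E = E and c = "\<lambda>_. 0" and \<zeta> = \<zeta>]) (use v assms in auto)
qed

text \<open>Energy and bound are sums over the \<open>N\<close> pieces, so one of the pieces satisfies its own bound.\<close>
lemma cheap_divide:
  assumes "cheap z a \<beta> (real N * T)" "N > 0" "T > 0"
  shows "cheap z a \<beta> T"
proof -
  obtain v E where v: "\<forall>t\<in>{0..real N * T}. \<phi> (v t) = z" "energy 0 (real N * T) v \<le> ennreal E" "0 \<le> E"
    "E \<le> a \<bullet> (v (real N * T) - v 0) + \<beta> * (real N * T)"
    using assms(1) unfolding cheap_def by blast
  define e where "e i = enn2real (energy (real i * T) (real (Suc i) * T) v)" for i
  have sub: "energy (real i * T) (real (Suc i) * T) v \<le> energy 0 (real N * T) v" if "i < N" for i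
  proof -
    have "real (Suc i) * T \<le> real N * T" using that assms by (intro mult_right_mono) auto
    then show ?thesis using assms by (intro energy_mono) auto
  qed
  have e: "energy (real i * T) (real (Suc i) * T) v = ennreal (e i)" if "i < N" for i
    unfolding e_def using order_trans[OF sub[OF that] v(2)] by (intro ennreal_enn2real[symmetric]) (auto intro: le_less_trans)
  have "energy 0 (real N * T) v = (\<Sum>i<N. ennreal (e i))"
    using energy_uniform_split[of T 0 N v] assms e by simp
  also have "\<dots> = ennreal (\<Sum>i<N. e i)" by (rule sum_ennreal) (simp add: e_def)
  finally have "(\<Sum>i<N. e i) \<le> E" using v by (simp add: ennreal_le_iff)
  also have "\<dots> \<le> (\<Sum>i<N. a \<bullet> (v (real (Suc i) * T) - v (real i * T)) + \<beta> * T)"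
  proof -
    have "(\<Sum>i<N. v (real (Suc i) * T) - v (real i * T)) = v (real N * T) - v 0"
      using sum_lessThan_telescope[of "\<lambda>i. v (real i * T)" N] by simp
    moreover have "(\<Sum>i<N. a \<bullet> (v (real (Suc i) * T) - v (real i * T)) + \<beta> * T)
        = a \<bullet> (\<Sum>i<N. v (real (Suc i) * T) - v (real i * T)) + real N * (\<beta> * T)"
      unfolding sum.distrib inner_sum_right by simp
    moreover have "\<beta> * (real N * T) = real N * (\<beta> * T)" by simp
    ultimately show ?thesis using v(4) by metis
  qed
  finally have "\<exists>i<N. e i \<le> a \<bullet> (v (real (Suc i) * T) - v (real i * T)) + \<beta> * T"
    using assms(2) by (metis (no_types, lifting) not_less sum_strict_mono finite_lessThan lessThan_iff lessThan_empty_iff neq0_conv less_le_not_le nle_le)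
  then obtain i where i: "i < N" "e i \<le> a \<bullet> (v (real (Suc i) * T) - v (real i * T)) + \<beta> * T" by blast
  obtain k where k: "k \<in> lattice" "norm (v (real i * T) - k) \<le> sqrt (real CARD('m))" by (rule lattice_near)
  define g where "g t = v (1 * t + real i * T) + - k" for t
  have "energy 0 T g = energy (real i * T) (real (Suc i) * T) v"
    unfolding g_def energy_translate by (subst energy_reparam) (auto simp: algebra_simps)
  moreover have "\<phi> (g t) = z" if "t \<in> {0..T}" for t
  proof -
    have "real (Suc i) * T \<le> real N * T" using i assms by (intro mult_right_mono) auto
    then have "1 * t + real i * T \<in> {0..real N * T}" using that assms by (auto simp: algebra_simps)
    then have "\<phi> (v (1 * t + real i * T)) = z" using v(1) by blast
    then show ?thesis using periodic_diff[OF periodic k(1)] by (simp add: g_def)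
  qed
  ultimately show ?thesis
    unfolding cheap_def using i k e[OF i(1)]
    by (intro exI[of _ g] exI[of _ "e i"]) (auto simp: g_def e_def algebra_simps)
qed

text \<open>On a connected unbounded level a cheap path of long duration \<open>T\<close> is closed up to a lattice vector \<open>k\<close>
  in one unit of time and then repeated. This estimates the integrand at the slope \<open>k / (T + 1)\<close> from
  above, and the gain \<open>\<eta> * T\<close> exceeds all errors when \<open>T\<close> is large. On the other levels the displacement
  is bounded, so the bound in the definition of cheap paths becomes negative for long durations.\<close>
lemma cheap_imp_not_minorant:
  assumes z: "z \<in> range \<phi>" and "\<eta> > 0" and cheap: "\<And>N. N > 0 \<Longrightarrow> cheap z a (b - \<eta>) (real N)"
  shows "\<exists>w. \<not> ennreal (a \<bullet> w + b) \<le> psi_hom_z \<phi> z w"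
proof (rule ccontr)
  assume "\<not> ?thesis"
  then have minor: "ennreal (a \<bullet> w + b) \<le> psi_hom_z \<phi> z w" for w by blast
  show False
  proof (cases rule: level_dichotomy[OF z])
    case (2 D)
    have "ennreal b \<le> 0" using minor[of 0] psi_hom_z_0[OF z] by simp
    then have b: "b \<le> 0" by (simp add: ennreal_eq_0_iff)
    obtain N where N: "norm a * D / \<eta> < real N" "N > 0"
      using reals_Archimedean2[of "max 1 (norm a * D / \<eta>)"] by (metis max_less_iff_conj of_nat_0_less_iff zero_less_one order_less_trans)
    obtain v E where v: "\<forall>t\<in>{0..real N}. \<phi> (v t) = z" "energy 0 (real N) v \<le> ennreal E" "0 \<le> E"
      "E \<le> a \<bullet> (v (real N) - v 0) + (b - \<eta>) * real N"
      using cheap[OF N(2)] unfolding cheap_def by blast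
    have "norm (v (real N) - v 0) \<le> D"
      using 2 v unfolding displacement_bound_def reach_def by (metis of_nat_0_le_iff)
    then have "a \<bullet> (v (real N) - v 0) \<le> norm a * D"
      by (intro order_trans[OF norm_cauchy_schwarz] mult_left_mono) auto
    moreover have "(b - \<eta>) * real N \<le> - \<eta> * real N" using b by (intro mult_right_mono) auto
    ultimately show False using v(3,4) N(1) \<open>\<eta> > 0\<close> by (simp add: field_simps)
  next
    case (1 C)
    \<comment> \<open>The cost of closing up, the error in replacing the displacement by \<open>k\<close>, and the extra unit of time.\<close>
    define Q where "Q = norm a * sqrt (real CARD('m)) + (C * sqrt (real CARD('m)))\<^sup>2 + \<bar>b\<bar>"
    obtain N where N: "Q / \<eta> < real N" "N > 0"
      using reals_Archimedean2[of "max 1 (Q / \<eta>)"] by (metis max_less_iff_conj of_nat_0_less_iff zero_less_one order_less_trans)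
    define T where "T = real N"
    have T: "T > 0" using N by (simp add: T_def)
    obtain v E where v: "norm (v 0) \<le> sqrt (real CARD('m))" "\<forall>t\<in>{0..T}. \<phi> (v t) = z" "energy 0 T v \<le> ennreal E" "0 \<le> E"
      "E \<le> a \<bullet> (v T - v 0) + (b - \<eta>) * T"
      using cheap[OF N(2)] unfolding cheap_def T_def by blast
    have r1: "reach \<phi> z T (v 0) (v T) E" using v by (auto simp: reach_def)
    obtain k where k: "k \<in> lattice" "norm ((v T - v 0) - k) \<le> sqrt (real CARD('m))" by (rule lattice_near)
    have "reach \<phi> z 1 (v T) (v 0 + k) ((C * sqrt (real CARD('m)))\<^sup>2 / 1)"
      using k v T periodic_add[OF periodic k(1)]
      by (intro connecting_constD[OF 1]) (auto simp: diff_diff_eq)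
    from reach_trans[OF r1 this] have period: "reach \<phi> z (T + 1) (v 0) (v 0 + k) (E + (C * sqrt (real CARD('m)))\<^sup>2)"
      using T v by simp
    define P where "P = E + (C * sqrt (real CARD('m)))\<^sup>2"
    have P0: "0 \<le> P" using v by (simp add: P_def)
    have iter: "reach \<phi> z (real n * (T + 1)) (v 0) (v 0 + real n *\<^sub>R k) (real n * P)" for n
    proof (induction n)
      case 0
      then show ?case using v T by (auto intro!: reach_refl)
    next
      case (Suc n)
      have nk: "real n *\<^sub>R k \<in> lattice" using k(1) by (auto simp: lattice_def)
      have "reach \<phi> z (T + 1) (v 0 + real n *\<^sub>R k) (v 0 + k + real n *\<^sub>R k) P"
        unfolding P_def by (rule reach_translate[OF periodic nk period])
      from reach_trans[OF Suc.IH this]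
      have "reach \<phi> z (real n * (T + 1) + (T + 1)) (v 0) (v 0 + k + real n *\<^sub>R k) (real n * P + P)"
        using T P0 by simp
      then show ?case by (simp add: algebra_simps)
    qed
    define w where "w = (1 / (T + 1)) *\<^sub>R k"
    have le: "psi_z \<phi> z (real (Suc n) * (T + 1)) w \<le> ennreal (P / (T + 1))" for n
    proof -
      have "(real (Suc n) * (T + 1)) *\<^sub>R w = real (Suc n) *\<^sub>R k" using T by (simp add: w_def)
      then have "psi_z \<phi> z (real (Suc n) * (T + 1)) w \<le> ennreal (real (Suc n) * P / (real (Suc n) * (T + 1)))"
        using T v P0 by (intro psi_z_le_of_reach[OF _ iter[of "Suc n"]]) auto
      then show ?thesis using T by simp
    qed
    have "filterlim (\<lambda>n. real (Suc n)) at_top sequentially"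
      by (rule filterlim_compose[OF filterlim_real_sequentially filterlim_Suc])
    then have "filterlim (\<lambda>n. real (Suc n) * (T + 1)) at_top sequentially"
      using T by (intro filterlim_at_top_mult_tendsto_pos[OF tendsto_const]) simp_all
    from filterlim_compose[OF psi_z_tendsto[OF z, of w] this]
    have "psi_hom_z \<phi> z w \<le> ennreal (P / (T + 1))"
      using le by (intro LIMSEQ_le_const2) auto
    then have "ennreal (a \<bullet> w + b) \<le> ennreal (P / (T + 1))" using minor[of w] by (rule order_trans[rotated])
    then have "a \<bullet> w + b \<le> P / (T + 1)" using P0 T by (simp add: ennreal_le_iff)
    moreover have "a \<bullet> w + b = (a \<bullet> k + b * (T + 1)) / (T + 1)" using T by (simp add: w_def add_divide_distrib)
    ultimately have "a \<bullet> k + b * (T + 1) \<le> P" using T by (simp add: divide_le_cancel)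
    moreover have "a \<bullet> (v T - v 0) \<le> a \<bullet> k + norm a * sqrt (real CARD('m))"
    proof -
      have "a \<bullet> (v T - v 0) = a \<bullet> k + a \<bullet> ((v T - v 0) - k)" by (simp add: inner_diff_right)
      also have "a \<bullet> ((v T - v 0) - k) \<le> norm a * sqrt (real CARD('m))"
        using k(2) by (intro order_trans[OF norm_cauchy_schwarz] mult_left_mono) auto
      finally show ?thesis by simp
    qed
    ultimately have "\<eta> * T \<le> Q" using v(5) by (simp add: P_def Q_def algebra_simps)
    then show False using N(1) \<open>\<eta> > 0\<close> by (simp add: T_def field_simps)
  qed
qed

text \<open>On a level of bounded displacement the integrand is infinite off the origin, so every linear
  function is a minorant, in particular a steep one.\<close>
lemma affine_minorant_of_level:
  assumes z: "z \<in> range \<phi>" and m: "0 \<le> m" "ennreal m < psi_hom_z \<phi> z w"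
  obtains a b where "\<And>x. ennreal (a \<bullet> x + b) \<le> psi_hom_z \<phi> z x" "m < a \<bullet> w + b"
proof (cases rule: level_dichotomy[OF z])
  case (1 C)
  have "m < enn2real (psi_hom_z \<phi> z w)"
    using m psi_hom_z_finite[OF z 1, of w] by (metis ennreal_less_iff)
  then obtain a b where ab: "\<And>x. a \<bullet> x + b \<le> enn2real (psi_hom_z \<phi> z x)" "m < a \<bullet> w + b"
    using convex_affine_minorant[OF psi_hom_z_convex[OF z 1]] by blast
  have "ennreal (a \<bullet> x + b) \<le> psi_hom_z \<phi> z x" for x
    using ennreal_leI[OF ab(1)[of x]] psi_hom_z_finite[OF z 1, of x] by simp
  then show thesis using ab(2) by (rule that)
next
  case (2 D)
  have w: "w \<noteq> 0" using m psi_hom_z_0[OF z] by auto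
  define a where "a = ((m + 1) / (norm w)\<^sup>2) *\<^sub>R w"
  have "ennreal (a \<bullet> x + 0) \<le> psi_hom_z \<phi> z x" for x
    using psi_hom_z_infinity[OF 2, of x] by (cases "x = 0") auto
  moreover have "m < a \<bullet> w + 0" using w by (simp add: a_def power2_norm_eq_inner)
  ultimately show thesis by (rule that)
qed

text \<open>Take levels \<open>\<zeta> n\<close> with integrands at \<open>w\<close> close to the infimum \<open>m\<close> and a limit \<open>z\<close> of a subsequence. If the
  integrand of \<open>z\<close> at \<open>w\<close> exceeded \<open>m\<close>, it would have an affine minorant with value above \<open>m\<close> at \<open>w\<close>. With
  respect to it, almost optimal long paths on \<open>\<zeta> n\<close> are cheap; dividing them and passing to the limit
  gives cheap paths of all integer durations on \<open>z\<close>, which is impossible.\<close>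
lemma psi_hom_z_attained:
  "\<exists>z\<in>range \<phi>. psi_hom_z \<phi> z w = (INF z'\<in>range \<phi>. psi_hom_z \<phi> z' w)"
proof (cases "(INF z'\<in>range \<phi>. psi_hom_z \<phi> z' w) = \<infinity>")
  case True
  then have "psi_hom_z \<phi> (\<phi> 0) w = \<infinity>"
    using INF_lower[of "\<phi> 0" "range \<phi>" "\<lambda>z. psi_hom_z \<phi> z w"] by (simp add: top_unique)
  then show ?thesis using True by auto
next
  case False
  then obtain m where m: "(INF z'\<in>range \<phi>. psi_hom_z \<phi> z' w) = ennreal m" "0 \<le> m"
    by (cases "INF z'\<in>range \<phi>. psi_hom_z \<phi> z' w") auto
  have "\<exists>z\<in>range \<phi>. psi_hom_z \<phi> z w < ennreal (m + 1 / real (Suc n))" for n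
  proof -
    have "(INF z'\<in>range \<phi>. psi_hom_z \<phi> z' w) < ennreal (m + 1 / real (Suc n))"
      unfolding m using m(2) by (simp add: ennreal_less_iff)
    then show ?thesis by (simp add: INF_less_iff)
  qed
  then obtain \<zeta> where \<zeta>: "\<And>n. \<zeta> n \<in> range \<phi>" "\<And>n. psi_hom_z \<phi> (\<zeta> n) w < ennreal (m + 1 / real (Suc n))" by metis
  obtain z r where z: "z \<in> range \<phi>" "strict_mono (r :: nat \<Rightarrow> nat)" "(\<zeta> \<circ> r) \<longlonglongrightarrow> z"
    using compact_range \<zeta>(1) unfolding compact_def by metis
  have "psi_hom_z \<phi> z w \<le> ennreal m"
  proof (rule ccontr)
    assume "\<not> ?thesis"
    then obtain a b where ab: "\<And>x. ennreal (a \<bullet> x + b) \<le> psi_hom_z \<phi> z x" "m < a \<bullet> w + b"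
      using affine_minorant_of_level[OF z(1) m(2), of w] by (auto simp: not_le)
    \<comment> \<open>One third of the gap is kept as loss in cheapness, one is spent on near optimality, and one on the
      deviation of the end points from \<open>0\<close> and \<open>T *\<^sub>R w\<close>.\<close>
    define \<eta> where "\<eta> = (a \<bullet> w + b - m) / 3"
    have \<eta>: "\<eta> > 0" "a \<bullet> w + b = m + 3 * \<eta>" "a \<bullet> w = m + 3 * \<eta> - b"
    proof -
      have "3 * \<eta> = a \<bullet> w + b - m" by (simp add: \<eta>_def)
      then show "\<eta> > 0" "a \<bullet> w + b = m + 3 * \<eta>" "a \<bullet> w = m + 3 * \<eta> - b" using ab(2) by linarith+
    qed
    obtain n0 where n0: "1 / real (Suc n0) < \<eta>"
      using reals_Archimedean[OF \<eta>(1)] by (auto simp: inverse_eq_divide)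
    have each: "cheap (\<zeta> n) a (b - \<eta>) (real N)" if n: "n \<ge> n0" and N: "N > 0" for n N
    proof -
      have "1 / real (Suc n) \<le> 1 / real (Suc n0)" using n by (intro divide_left_mono) auto
      then have "psi_hom_z \<phi> (\<zeta> n) w < ennreal (m + \<eta>)"
        using \<zeta>(2)[of n] n0 m(2) by (intro less_le_trans[OF \<zeta>(2)] ennreal_leI) auto
      then have "\<forall>\<^sub>F T in at_top. psi_z \<phi> (\<zeta> n) T w < ennreal (m + \<eta>)"
        by (rule order_tendstoD(2)[OF psi_z_tendsto[OF \<zeta>(1)]])
      then obtain T0 where T0: "\<And>T. T \<ge> T0 \<Longrightarrow> psi_z \<phi> (\<zeta> n) T w < ennreal (m + \<eta>)"
        by (auto simp: eventually_at_top_linorder)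
      obtain M where M: "max T0 (max 1 (2 * sqrt (real CARD('m)) * norm a / \<eta>)) < real M" using reals_Archimedean2 by blast
      define T where "T = real M * real N"
      have "real M * 1 \<le> T" unfolding T_def using N by (intro mult_left_mono) auto
      then have T: "T > 0" "T \<ge> T0" "2 * sqrt (real CARD('m)) * norm a \<le> \<eta> * T"
      proof -
        have "2 * sqrt (real CARD('m)) * norm a / \<eta> < real M" using M by simp
        then have "2 * sqrt (real CARD('m)) * norm a < real M * \<eta>" using \<eta>(1) by (simp add: pos_divide_less_eq)
        also have "real M * \<eta> \<le> T * \<eta>" using \<open>real M * 1 \<le> T\<close> \<eta>(1) by (intro mult_right_mono) auto
        finally show "2 * sqrt (real CARD('m)) * norm a \<le> \<eta> * T" by (simp add: mult.commute)
      qed (use M \<open>real M * 1 \<le> T\<close> in auto)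
      obtain x y E where xy: "reach \<phi> (\<zeta> n) T x y E" "norm x \<le> sqrt (real CARD('m))" "norm (y - T *\<^sub>R w) \<le> sqrt (real CARD('m))" "0 \<le> E" "E \<le> (m + \<eta>) * T"
        using psi_z_less_imp_reach[OF T(1) T0[OF T(2)]] by blast
      obtain v where v: "v 0 = x" "v T = y" "\<forall>t\<in>{0..T}. \<phi> (v t) = \<zeta> n" "energy 0 T v \<le> ennreal E"
        using xy(1) by (auto simp: reach_def)
      have "a \<bullet> (T *\<^sub>R w) - 2 * sqrt (real CARD('m)) * norm a \<le> a \<bullet> (y - x)"
      proof -
        have "a \<bullet> (T *\<^sub>R w) = a \<bullet> (y - x) + a \<bullet> x + a \<bullet> (T *\<^sub>R w - y)" by (simp add: inner_diff_right)
        also have "a \<bullet> x \<le> norm a * sqrt (real CARD('m))"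
          using xy(2) by (intro order_trans[OF norm_cauchy_schwarz] mult_left_mono) auto
        also have "a \<bullet> (T *\<^sub>R w - y) \<le> norm a * sqrt (real CARD('m))"
          using xy(3) by (intro order_trans[OF norm_cauchy_schwarz] mult_left_mono) (auto simp: norm_minus_commute)
        finally show ?thesis by (simp add: algebra_simps)
      qed
      moreover have "T * (a \<bullet> w) = (m + 3 * \<eta> - b) * T" unfolding \<eta>(3) by (rule mult.commute)
      ultimately have "E \<le> a \<bullet> (y - x) + (b - \<eta>) * T" using xy(5) T(3) by (simp add: algebra_simps)
      then have "cheap (\<zeta> n) a (b - \<eta>) (real M * real N)"
        unfolding cheap_def T_def[symmetric] using v xy by (intro exI[of _ v] exI[of _ E]) auto
      moreover have "M > 0" using M by (cases "M = 0") auto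
      ultimately show ?thesis using N by (intro cheap_divide[of \<open>\<zeta> n\<close> a \<open>b - \<eta>\<close> M \<open>real N\<close>]) simp_all
    qed
    have "cheap z a (b - \<eta>) (real N)" if "N > 0" for N
    proof (rule cheap_limit_level)
      show "cheap ((\<zeta> \<circ> r) (n + n0)) a (b - \<eta>) (real N)" for n
        using each[of "r (n + n0)" N] seq_suble[OF z(2), of "n + n0"] that by simp
      show "(\<lambda>n. (\<zeta> \<circ> r) (n + n0)) \<longlonglongrightarrow> z" by (rule LIMSEQ_ignore_initial_segment[OF z(3)])
    qed simp
    then show False using cheap_imp_not_minorant[OF z(1) \<eta>(1)] ab(1) by blast
  qed
  then have "psi_hom_z \<phi> z w = ennreal m"
    using m(1) INF_lower[OF z(1), of "\<lambda>z. psi_hom_z \<phi> z w"] by (intro antisym) auto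
  then show ?thesis using m(1) z(1) by auto
qed

text \<open>Otherwise, for every duration there are paths violating the bound along which \<open>\<phi>\<close> oscillates
  arbitrarily little, and their limit is a cheap path on some level. These levels depend on the duration;
  a limit of levels carries cheap paths of all integer durations, which contradicts the minorant.\<close>
lemma cell_lower_bound:
  assumes minor: "\<And>z w. z \<in> range \<phi> \<Longrightarrow> ennreal (a \<bullet> w + b) \<le> psi_hom_z \<phi> z w" and "\<eta> > 0"
  obtains T c where "T > 0" "c > 0"
    "\<And>v E. energy 0 T v \<le> ennreal E \<Longrightarrow> 0 \<le> E \<Longrightarrow> (\<And>t. t \<in> {0..T} \<Longrightarrow> norm (\<phi> (v t) - \<phi> (v 0)) \<le> c) \<Longrightarrow>
       a \<bullet> (v T - v 0) + (b - \<eta>) * T \<le> E"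
proof (rule ccontr)
  assume contra: "\<not> thesis"
  note main = that
  have ex: "\<exists>v E. energy 0 T v \<le> ennreal E \<and> 0 \<le> E \<and> (\<forall>t\<in>{0..T}. norm (\<phi> (v t) - \<phi> (v 0)) \<le> c) \<and>
      E \<le> a \<bullet> (v T - v 0) + (b - \<eta>) * T \<and> norm (v 0) \<le> sqrt (real CARD('m))" if Tc: "T > 0" "c > 0" for T c
  proof -
    have "\<exists>v E. energy 0 T v \<le> ennreal E \<and> 0 \<le> E \<and> (\<forall>t\<in>{0..T}. norm (\<phi> (v t) - \<phi> (v 0)) \<le> c) \<and>
      E < a \<bullet> (v T - v 0) + (b - \<eta>) * T"
    proof (rule ccontr)
      assume "\<not> ?thesis"
      then have "a \<bullet> (v T - v 0) + (b - \<eta>) * T \<le> E" if "energy 0 T v \<le> ennreal E" "0 \<le> E"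
        "\<And>t. t \<in> {0..T} \<Longrightarrow> norm (\<phi> (v t) - \<phi> (v 0)) \<le> c" for v E
        using that by (meson not_le)
      then show False using contra main[of T c] Tc by blast
    qed
    then obtain v E where v: "energy 0 T v \<le> ennreal E" "0 \<le> E" "\<forall>t\<in>{0..T}. norm (\<phi> (v t) - \<phi> (v 0)) \<le> c"
      "E < a \<bullet> (v T - v 0) + (b - \<eta>) * T" by blast
    obtain k where k: "k \<in> lattice" "norm (v 0 - k) \<le> sqrt (real CARD('m))" by (rule lattice_near)
    have "energy 0 T (\<lambda>t. v t + - k) \<le> ennreal E" using v(1) by (subst energy_translate)
    then show ?thesis
      using v k periodic_diff[OF periodic k(1)]
      by (intro exI[of _ "\<lambda>t. v t + - k"] exI[of _ E]) auto
  qed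
  have ex_cheap: "\<exists>z\<in>range \<phi>. cheap z a (b - \<eta>) T" if T: "T > 0" for T
  proof -
    have "\<forall>n. \<exists>v E. energy 0 T v \<le> ennreal E \<and> 0 \<le> E \<and> (\<forall>t\<in>{0..T}. norm (\<phi> (v t) - \<phi> (v 0)) \<le> 1 / real (Suc n)) \<and>
      E \<le> a \<bullet> (v T - v 0) + (b - \<eta>) * T \<and> norm (v 0) \<le> sqrt (real CARD('m))"
      using ex[OF T] by simp
    then obtain v E where v: "\<And>n. energy 0 T (v n) \<le> ennreal (E n) \<and> 0 \<le> E n \<and>
      (\<forall>t\<in>{0..T}. norm (\<phi> (v n t) - \<phi> (v n 0)) \<le> 1 / real (Suc n)) \<and>
      E n \<le> a \<bullet> (v n T - v n 0) + (b - \<eta>) * T \<and> norm (v n 0) \<le> sqrt (real CARD('m))" by metis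
    have "\<phi> (v n 0) \<in> range \<phi>" for n by simp
    then obtain z r where z: "z \<in> range \<phi>" "strict_mono (r :: nat \<Rightarrow> nat)" "((\<lambda>n. \<phi> (v n 0)) \<circ> r) \<longlonglongrightarrow> z"
      using compact_range unfolding compact_def by (metis (no_types, lifting))
    have c0: "(\<lambda>n. 1 / real (Suc (r n))) \<longlonglongrightarrow> 0"
      using LIMSEQ_subseq_LIMSEQ[OF LIMSEQ_inverse_real_of_nat z(2)] by (simp add: o_def inverse_eq_divide)
    have "cheap z a (b - \<eta>) T"
      by (rule cheap_limit[where v = "\<lambda>n. v (r n)" and E = "\<lambda>n. E (r n)" and c = "\<lambda>n. 1 / real (Suc (r n))" and \<zeta> = "(\<lambda>n. \<phi> (v n 0)) \<circ> r"])
        (use v T z(3) c0 in auto)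
    then show ?thesis using z(1) by blast
  qed
  \<comment> \<open>With factorials as durations every \<open>N\<close> divides all but finitely many of them.\<close>
  have "\<forall>n. \<exists>z\<in>range \<phi>. cheap z a (b - \<eta>) (real (fact n))" using ex_cheap by simp
  then obtain \<zeta> where \<zeta>: "\<And>n. \<zeta> n \<in> range \<phi>" "\<And>n. cheap (\<zeta> n) a (b - \<eta>) (real (fact n))" by metis
  obtain z r where z: "z \<in> range \<phi>" "strict_mono (r :: nat \<Rightarrow> nat)" "(\<zeta> \<circ> r) \<longlonglongrightarrow> z"
    using compact_range \<zeta>(1) unfolding compact_def by metis
  have "cheap z a (b - \<eta>) (real N)" if N: "N > 0" for N
  proof (rule cheap_limit_level)
    show "cheap ((\<zeta> \<circ> r) (n + N)) a (b - \<eta>) (real N)" for n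
    proof -
      have "N \<le> r (n + N)" using seq_suble[OF z(2), of "n + N"] by simp
      then have "N dvd fact (r (n + N))" using N by (intro dvd_fact) auto
      then obtain q where q: "fact (r (n + N)) = N * q" by (auto simp: dvd_def)
      then have "q > 0" by (metis fact_gt_zero gr0I mult_0_right less_irrefl)
      have "real (fact (r (n + N))) = real q * real N" unfolding q by simp
      then have "cheap (\<zeta> (r (n + N))) a (b - \<eta>) (real q * real N)"
        using \<zeta>(2)[of "r (n + N)"] by simp
      then show ?thesis using \<open>q > 0\<close> N by (auto intro: cheap_divide)
    qed
    show "(\<lambda>n. (\<zeta> \<circ> r) (n + N)) \<longlonglongrightarrow> z" by (rule LIMSEQ_ignore_initial_segment[OF z(3)])
  qed simp
  then show False using cheap_imp_not_minorant[OF z(1) \<open>\<eta> > 0\<close>] minor[OF z(1)] by blast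
qed

end

section \<open>The homogenized integrand\<close>

lemma convex_envelope_le: "convex_envelope f x \<le> f x"
  unfolding convex_envelope_def by (rule SUP_least) auto

lemma convex_envelope_greatest: "ext_convex g \<Longrightarrow> (\<And>y. g y \<le> f y) \<Longrightarrow> g x \<le> convex_envelope f x"
  unfolding convex_envelope_def by (rule SUP_upper) auto

lemma ext_convex_convex_envelope: "ext_convex (convex_envelope f)"
  unfolding ext_convex_def
proof (intro allI ballI)
  fix x y and s :: real assume s: "s \<in> {0..1}"
  show "convex_envelope f ((1 - s) *\<^sub>R x + s *\<^sub>R y) \<le> ennreal (1 - s) * convex_envelope f x + ennreal s * convex_envelope f y"
    unfolding convex_envelope_def[of f "(1 - s) *\<^sub>R x + s *\<^sub>R y"]
  proof (rule SUP_least)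
    fix g assume g: "g \<in> {g. ext_convex g \<and> (\<forall>y. g y \<le> f y)}"
    then have "g ((1 - s) *\<^sub>R x + s *\<^sub>R y) \<le> ennreal (1 - s) * g x + ennreal s * g y"
      using s by (auto simp: ext_convex_def)
    also have "\<dots> \<le> ennreal (1 - s) * convex_envelope f x + ennreal s * convex_envelope f y"
      using g by (intro add_mono mult_left_mono convex_envelope_greatest) auto
    finally show "g ((1 - s) *\<^sub>R x + s *\<^sub>R y) \<le> ennreal (1 - s) * convex_envelope f x + ennreal s * convex_envelope f y" .
  qed
qed

context level_geometry
begin

text \<open>A connected unbounded level makes \<open>psi_hom\<close> finite, so that convex analysis of real-valued
  functions applies.\<close>
definition hom_density :: "real^'m \<Rightarrow> real" where
  "hom_density w = enn2real (psi_hom \<phi> w)"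

lemma psi_hom_le_level: "z \<in> range \<phi> \<Longrightarrow> psi_hom \<phi> w \<le> psi_hom_z \<phi> z w"
  unfolding psi_hom_def by (rule order_trans[OF convex_envelope_le INF_lower])

lemma psi_hom_upper: "\<exists>C. \<forall>w. psi_hom \<phi> w \<le> ennreal ((C * norm w)\<^sup>2)"
proof -
  obtain z where z: "z \<in> range \<phi>" "unbounded_level \<phi> z"
    using nondegenerate by (auto simp: nondegenerate_levels_def)
  obtain C where "connecting_const \<phi> z C" by (rule unbounded_level_connecting_const[OF controlled z])
  then show ?thesis
    using psi_hom_le_level[OF z(1)] psi_hom_z_upper[OF z(1)] order_trans by blast
qed

lemma psi_hom_eq: "psi_hom \<phi> w = ennreal (hom_density w)"
proof -
  obtain C where "psi_hom \<phi> w \<le> ennreal ((C * norm w)\<^sup>2)" using psi_hom_upper by blast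
  then show ?thesis unfolding hom_density_def by (intro ennreal_enn2real[symmetric]) (auto intro: le_less_trans)
qed

lemma hom_density_nonneg: "0 \<le> hom_density w"
  by (simp add: hom_density_def)

lemma hom_density_upper: "\<exists>C. \<forall>w. hom_density w \<le> (C * norm w)\<^sup>2"
  using psi_hom_upper unfolding psi_hom_eq by (simp add: ennreal_le_iff)

lemma hom_density_convex: "convex_on UNIV hom_density"
proof (rule convex_onI)
  fix s :: real and x y :: "real^'m" assume s: "0 < s" "s < 1"
  have "psi_hom \<phi> ((1 - s) *\<^sub>R x + s *\<^sub>R y) \<le> ennreal (1 - s) * psi_hom \<phi> x + ennreal s * psi_hom \<phi> y"
    unfolding psi_hom_def by (rule ext_convex_convex_envelope[unfolded ext_convex_def, rule_format]) (use s in auto)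
  also have "\<dots> = ennreal ((1 - s) * hom_density x + s * hom_density y)"
    unfolding psi_hom_eq using s hom_density_nonneg by (simp add: ennreal_plus ennreal_mult)
  finally show "hom_density ((1 - s) *\<^sub>R x + s *\<^sub>R y) \<le> (1 - s) * hom_density x + s * hom_density y"
    unfolding psi_hom_eq using s hom_density_nonneg[of x] hom_density_nonneg[of y] by (subst (asm) ennreal_le_iff) auto
qed simp

lemma continuous_hom_density: "continuous_on UNIV hom_density"
  by (rule convex_on_continuous[OF open_UNIV hom_density_convex])

lemma hom_density_affine_minorant:
  assumes "m < hom_density w"
  obtains a b where "\<And>x. a \<bullet> x + b \<le> hom_density x" "m < a \<bullet> w + b"
  using convex_affine_minorant[OF hom_density_convex assms] by blast

lemma affine_minorant_levels:
  assumes "\<And>x. a \<bullet> x + b \<le> hom_density x" "z \<in> range \<phi>"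
  shows "ennreal (a \<bullet> w + b) \<le> psi_hom_z \<phi> z w"
  using ennreal_leI[OF assms(1)[of w]] psi_hom_le_level[OF assms(2), of w] unfolding psi_hom_eq by (rule order_trans)

section \<open>The lower bound\<close>

text \<open>The interval is cut into pieces of length \<open>h = e * T\<close>. On a piece with energy \<open>D\<close> of \<open>\<phi> (u / e)\<close> the
  oscillation is at most \<open>sqrt (h * D)\<close>. If \<open>h * D \<le> c\<^sup>2\<close>, the rescaled piece satisfies the cell bound. The
  other pieces are paid for by a fraction \<open>\<kappa>\<close> of their energy and by \<open>h * D / c\<^sup>2 \<ge> 1\<close>, whose sum over all
  pieces is controlled by the bound \<open>\<Lambda> / d\<^sup>2\<close> on the energy of \<open>\<phi> (u / e)\<close>. The last two summands of the
  error account for the remainder of length less than \<open>h\<close>.\<close>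
lemma small_pieces_lower_bound:
  assumes cell: "\<And>v E. energy 0 T v \<le> ennreal E \<Longrightarrow> 0 \<le> E \<Longrightarrow> (\<And>t. t \<in> {0..T} \<Longrightarrow> norm (\<phi> (v t) - \<phi> (v 0)) \<le> c) \<Longrightarrow>
       a \<bullet> (v T - v 0) + \<beta> * T \<le> E"
    and T: "T > 0" and c: "c > 0" and e: "e > 0" and d: "d > 0" and \<kappa>: "\<kappa> > 0"
    and \<Lambda>: "fast_energy \<phi> d e 0 1 u \<le> ennreal \<Lambda>" "0 \<le> \<Lambda>" and st: "0 \<le> s" "s \<le> t" "t \<le> 1"
  shows "a \<bullet> (u t - u s) + \<beta> * (t - s) \<le> enn2real (energy s t u) + \<kappa> * \<Lambda>
    + ((norm a)\<^sup>2 / (4 * \<kappa>) + \<bar>\<beta>\<bar>) * (\<Lambda> * (T / c)\<^sup>2 * (e / d)\<^sup>2) + norm a * sqrt (e * T * \<Lambda>) + \<bar>\<beta>\<bar> * (e * T)"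
proof -
  define W where "W x = \<phi> (u x /\<^sub>R e)" for x
  define h where "h = e * T"
  have h: "h > 0" using e T by (simp add: h_def)
  have en_u: "energy 0 1 u \<le> ennreal \<Lambda>"
    using \<Lambda>(1) unfolding fast_energy_def by (rule order_trans[rotated]) simp
  have en_W: "energy 0 1 W \<le> ennreal (\<Lambda> / d\<^sup>2)"
  proof -
    have "ennreal (d\<^sup>2) * energy 0 1 W \<le> ennreal \<Lambda>"
      using \<Lambda>(1) unfolding fast_energy_def W_def[abs_def] by (rule order_trans[rotated]) simp
    then have "ennreal (1 / d\<^sup>2) * (ennreal (d\<^sup>2) * energy 0 1 W) \<le> ennreal (1 / d\<^sup>2) * ennreal \<Lambda>"
      by (rule mult_left_mono) simp
    then show ?thesis using d \<Lambda>(2) by (simp add: mult.assoc[symmetric] ennreal_mult[symmetric])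
  qed
  define N where "N = nat \<lfloor>(t - s) / h\<rfloor>"
  have "0 \<le> (t - s) / h" using st h by simp
  then have "real N \<le> (t - s) / h" "(t - s) / h < real N + 1" unfolding N_def by linarith+
  then have N: "real N * h \<le> t - s" "t - s < real N * h + h" using h by (simp_all add: field_simps)
  define p where "p i = s + real i * h" for i
  have p_in: "0 \<le> p i \<and> p i \<le> t" if "i \<le> N" for i
  proof -
    have "real i * h \<le> real N * h" "0 \<le> real i * h" using that h by (auto intro: mult_right_mono)
    then show ?thesis using N st unfolding p_def by linarith
  qed
  have p_Suc: "p (Suc i) = p i + h" for i by (simp add: p_def algebra_simps)
  define E where "E i = enn2real (energy (p i) (p (Suc i)) u)" for i
  define D where "D i = enn2real (energy (p i) (p (Suc i)) W)" for i
  have E: "energy (p i) (p (Suc i)) u = ennreal (E i)" "0 \<le> E i" if "i < N" for i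
  proof -
    have "energy (p i) (p (Suc i)) u \<le> energy 0 1 u"
      using p_in[of i] p_in[of "Suc i"] that st by (intro energy_mono) auto
    then have "energy (p i) (p (Suc i)) u \<le> ennreal \<Lambda>" using en_u by (rule order_trans)
    then show "energy (p i) (p (Suc i)) u = ennreal (E i)" "0 \<le> E i"
      unfolding E_def by (auto intro!: ennreal_enn2real[symmetric] intro: le_less_trans)
  qed
  have D: "energy (p i) (p (Suc i)) W = ennreal (D i)" "0 \<le> D i" if "i < N" for i
  proof -
    have "energy (p i) (p (Suc i)) W \<le> energy 0 1 W"
      using p_in[of i] p_in[of "Suc i"] that st by (intro energy_mono) auto
    then have "energy (p i) (p (Suc i)) W \<le> ennreal (\<Lambda> / d\<^sup>2)" using en_W by (rule order_trans)
    then show "energy (p i) (p (Suc i)) W = ennreal (D i)" "0 \<le> D i"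
      unfolding D_def by (auto intro!: ennreal_enn2real[symmetric] intro: le_less_trans)
  qed
  have split: "energy s (s + real N * h) f = (\<Sum>i<N. energy (p i) (p (Suc i)) f)" for f :: "real \<Rightarrow> 'z::real_normed_vector"
    using energy_uniform_split[of h s N f] h by (simp add: p_def)
  have sumE: "(\<Sum>i<N. E i) \<le> enn2real (energy s t u)" "enn2real (energy s t u) \<le> \<Lambda>"
  proof -
    have "ennreal (\<Sum>i<N. E i) = energy s (s + real N * h) u"
      unfolding split using E by (subst sum_ennreal[symmetric]) auto
    also have "\<dots> \<le> energy s t u" using N by (intro energy_mono) auto
    finally have 1: "ennreal (\<Sum>i<N. E i) \<le> energy s t u" .
    have 2: "energy s t u \<le> ennreal \<Lambda>" using st by (intro order_trans[OF energy_mono en_u]) auto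
    then obtain x where x: "energy s t u = ennreal x" "0 \<le> x" by (cases "energy s t u") (auto simp: top_unique)
    show "(\<Sum>i<N. E i) \<le> enn2real (energy s t u)" "enn2real (energy s t u) \<le> \<Lambda>"
      using 1 2 x \<Lambda>(2) by (simp_all add: ennreal_le_iff)
  qed
  have sumD: "(\<Sum>i<N. D i) \<le> \<Lambda> / d\<^sup>2"
  proof -
    have "ennreal (\<Sum>i<N. D i) = energy s (s + real N * h) W"
      unfolding split using D by (subst sum_ennreal[symmetric]) auto
    also have "\<dots> \<le> energy 0 1 W" using N st by (intro energy_mono) auto
    finally have "ennreal (\<Sum>i<N. D i) \<le> ennreal (\<Lambda> / d\<^sup>2)" using en_W by simp
    then show ?thesis using \<Lambda>(2) by (simp add: ennreal_le_iff)
  qed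
  define M where "M = (norm a)\<^sup>2 / (4 * \<kappa>) + \<bar>\<beta>\<bar>"
  have M: "0 \<le> M" using \<kappa> by (simp add: M_def)
  have piece: "a \<bullet> (u (p (Suc i)) - u (p i)) + \<beta> * h \<le> E i + \<kappa> * E i + M * h * (h * D i / c\<^sup>2)" if i: "i < N" for i
  proof (cases "h * D i \<le> c\<^sup>2")
    case True
    define v where "v x = inverse e *\<^sub>R u (e * x + p i)" for x
    have "energy 0 T v = ennreal ((inverse e)\<^sup>2) * (ennreal e * energy (e * 0 + p i) (e * T + p i) u)"
      unfolding v_def energy_scaleR by (subst energy_reparam[OF e]) simp
    also have "e * T + p i = p (Suc i)" by (simp add: p_Suc h_def)
    also have "e * 0 + p i = p i" by simp
    also have "ennreal ((inverse e)\<^sup>2) * (ennreal e * energy (p i) (p (Suc i)) u) = ennreal (E i / e)"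
      using E[OF i] e by (simp add: ennreal_mult[symmetric] power2_eq_square field_simps)
    finally have env: "energy 0 T v \<le> ennreal (E i / e)" by simp
    have osc: "norm (\<phi> (v x) - \<phi> (v 0)) \<le> c" if x: "x \<in> {0..T}" for x
    proof -
      have "e * x \<le> e * T" using x e by simp
      then have in1: "e * x + p i \<in> {p i..p (Suc i)}" "p i \<in> {p i..p (Suc i)}"
        using x e h by (auto simp: p_Suc h_def)
      have "(norm (W (e * x + p i) - W (p i)))\<^sup>2 \<le> \<bar>(e * x + p i) - p i\<bar> * D i"
        using D[OF i] by (intro energy_increment[OF in1(2,1)]) auto
      also have "\<dots> \<le> h * D i"
        using x e D[OF i] \<open>e * x \<le> e * T\<close> by (intro mult_right_mono) (auto simp: h_def)
      also have "\<dots> \<le> c\<^sup>2" by (rule True)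
      finally have "norm (W (e * x + p i) - W (p i)) \<le> c" by (rule power2_le_imp_le[OF _ less_imp_le[OF c]])
      then show ?thesis by (simp add: W_def v_def)
    qed
    have "a \<bullet> (v T - v 0) + \<beta> * T \<le> E i / e"
      using E[OF i] e by (intro cell[OF env _ osc]) auto
    moreover have "v T - v 0 = inverse e *\<^sub>R (u (p (Suc i)) - u (p i))"
      by (simp add: v_def p_Suc h_def scaleR_diff_right add.commute)
    ultimately have "a \<bullet> (u (p (Suc i)) - u (p i)) / e + \<beta> * T \<le> E i / e"
      by (simp add: divide_inverse mult.commute)
    then have "e * (a \<bullet> (u (p (Suc i)) - u (p i)) / e + \<beta> * T) \<le> e * (E i / e)"
      using e by (intro mult_left_mono) auto
    then have "a \<bullet> (u (p (Suc i)) - u (p i)) + \<beta> * h \<le> E i"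
      using e by (simp add: h_def distrib_left mult.left_commute)
    moreover have "0 \<le> \<kappa> * E i + M * h * (h * D i / c\<^sup>2)"
      using \<kappa> E[OF i] D[OF i] M h by (intro add_nonneg_nonneg mult_nonneg_nonneg divide_nonneg_nonneg) auto
    ultimately show ?thesis by linarith
  next
    case False
    define q where "q = norm (u (p (Suc i)) - u (p i))"
    have "q\<^sup>2 \<le> \<bar>p (Suc i) - p i\<bar> * E i"
      unfolding q_def using E[OF i] h p_Suc[of i] by (intro energy_increment[of "p i" "p i" "p (Suc i)" "p (Suc i)"]) auto
    then have q: "q\<^sup>2 \<le> h * E i" using h by (simp add: p_Suc)
    have "a \<bullet> (u (p (Suc i)) - u (p i)) \<le> norm a * q" unfolding q_def by (rule norm_cauchy_schwarz)
    also have "\<dots> \<le> \<kappa> * E i + (norm a)\<^sup>2 / (4 * \<kappa>) * h"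
    proof -
      have "0 \<le> (2 * \<kappa> * q - norm a * h)\<^sup>2" by simp
      then have "4 * \<kappa> * h * (norm a * q) \<le> 4 * \<kappa>\<^sup>2 * q\<^sup>2 + (norm a)\<^sup>2 * h\<^sup>2"
        by (simp add: power2_eq_square algebra_simps)
      also have "\<dots> \<le> 4 * \<kappa>\<^sup>2 * (h * E i) + (norm a)\<^sup>2 * h\<^sup>2" using q by (intro add_mono mult_left_mono) auto
      also have "\<dots> = 4 * \<kappa> * h * (\<kappa> * E i + (norm a)\<^sup>2 / (4 * \<kappa>) * h)"
        using \<kappa> by (simp add: power2_eq_square field_simps)
      finally show ?thesis using \<kappa> h by simp
    qed
    finally have 1: "a \<bullet> (u (p (Suc i)) - u (p i)) \<le> \<kappa> * E i + (norm a)\<^sup>2 / (4 * \<kappa>) * h" .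
    have 2: "\<beta> * h \<le> \<bar>\<beta>\<bar> * h" using h by (intro mult_right_mono) auto
    have "M * h * 1 \<le> M * h * (h * D i / c\<^sup>2)"
      using False M h c by (intro mult_left_mono) (auto simp: field_simps)
    moreover have "M * h = (norm a)\<^sup>2 / (4 * \<kappa>) * h + \<bar>\<beta>\<bar> * h" by (simp add: M_def distrib_right)
    ultimately show ?thesis using 1 2 E(2)[OF i] by linarith
  qed
  have "a \<bullet> (u (p N) - u s) + real N * (\<beta> * h) = (\<Sum>i<N. a \<bullet> (u (p (Suc i)) - u (p i)) + \<beta> * h)"
  proof -
    have "(\<Sum>i<N. u (p (Suc i)) - u (p i)) = u (p N) - u s"
      using sum_lessThan_telescope[of "\<lambda>i. u (p i)" N] by (simp add: p_def)
    then show ?thesis unfolding sum.distrib inner_sum_right[symmetric] by simp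
  qed
  also have "\<dots> \<le> (\<Sum>i<N. E i + \<kappa> * E i + M * h * (h * D i / c\<^sup>2))"
    using piece by (intro sum_mono) auto
  also have "\<dots> = (\<Sum>i<N. E i) + \<kappa> * (\<Sum>i<N. E i) + M * h * h / c\<^sup>2 * (\<Sum>i<N. D i)"
    by (simp add: sum.distrib sum_distrib_left mult.assoc)
  also have "\<dots> \<le> enn2real (energy s t u) + \<kappa> * \<Lambda> + M * h * h / c\<^sup>2 * (\<Lambda> / d\<^sup>2)"
    using sumE sumD \<kappa> M h by (intro add_mono mult_left_mono) auto
  also have "M * h * h / c\<^sup>2 * (\<Lambda> / d\<^sup>2) = M * (\<Lambda> * (T / c)\<^sup>2 * (e / d)\<^sup>2)"
    by (simp add: h_def power2_eq_square)
  finally have main: "a \<bullet> (u (p N) - u s) + real N * (\<beta> * h) \<le> enn2real (energy s t u) + \<kappa> * \<Lambda> + M * (\<Lambda> * (T / c)\<^sup>2 * (e / d)\<^sup>2)" .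
  have pN: "p N \<le> t" "t - p N \<le> h" "0 \<le> p N" using N p_in[of N] by (auto simp: p_def)
  have "(norm (u t - u (p N)))\<^sup>2 \<le> \<bar>t - p N\<bar> * \<Lambda>"
    using pN st \<Lambda>(2) by (intro energy_increment[OF _ _ en_u]) auto
  also have "\<dots> \<le> h * \<Lambda>" using pN \<Lambda>(2) by (intro mult_right_mono) auto
  finally have "norm (u t - u (p N)) \<le> sqrt (h * \<Lambda>)" by (rule real_le_rsqrt)
  then have "a \<bullet> (u t - u (p N)) \<le> norm a * sqrt (h * \<Lambda>)"
    by (intro order_trans[OF norm_cauchy_schwarz] mult_left_mono) auto
  moreover have "\<beta> * (t - p N) \<le> \<bar>\<beta>\<bar> * h"
    using pN by (intro order_trans[OF mult_right_mono[OF abs_ge_self] mult_left_mono]) auto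
  moreover have "a \<bullet> (u t - u s) + \<beta> * (t - s) = (a \<bullet> (u (p N) - u s) + real N * (\<beta> * h)) + a \<bullet> (u t - u (p N)) + \<beta> * (t - p N)"
    by (simp add: p_def inner_diff_right algebra_simps)
  ultimately show ?thesis using main by (simp add: h_def M_def)
qed

text \<open>The error terms of the previous lemma vanish as \<open>e\<close> and \<open>e / d\<close> tend to zero, and an affine minorant of
  \<open>hom_density\<close> comes arbitrarily close to its value at the mean slope.\<close>
lemma interval_lower_bound:
  assumes e: "\<And>j. e j > 0" "e \<longlonglongrightarrow> 0" and d: "\<And>j. d j > 0" "(\<lambda>j. e j / d j) \<longlonglongrightarrow> 0"
    and \<Lambda>: "\<And>j. fast_energy \<phi> (d j) (e j) 0 1 (u j) \<le> ennreal \<Lambda>" "0 \<le> \<Lambda>"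
    and st: "0 \<le> s" "s < t" "t \<le> 1" and lim: "(\<lambda>j. u j s) \<longlonglongrightarrow> x" "(\<lambda>j. u j t) \<longlonglongrightarrow> y"
    and m: "m < hom_density ((y - x) /\<^sub>R (t - s))"
  shows "\<forall>\<^sub>F j in sequentially. m * (t - s) \<le> enn2real (energy s t (u j))"
proof -
  define w where "w = (y - x) /\<^sub>R (t - s)"
  obtain a b where ab: "\<And>x. a \<bullet> x + b \<le> hom_density x" "m < a \<bullet> w + b"
    using hom_density_affine_minorant m unfolding w_def by blast
  \<comment> \<open>Of the gap \<open>4 * g\<close>, one \<open>g\<close> is lost in the cell bound, one is \<open>\<kappa> * \<Lambda>\<close>, and the rest beats \<open>err\<close>.\<close>
  define g where "g = (a \<bullet> w + b - m) / 4"
  have g: "g > 0" "a \<bullet> w + b = m + 4 * g"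
  proof -
    have "4 * g = a \<bullet> w + b - m" by (simp add: g_def)
    then show "g > 0" "a \<bullet> w + b = m + 4 * g" using ab(2) by linarith+
  qed
  obtain T c where T: "T > 0" and c: "c > 0" and cell: "\<And>v E. energy 0 T v \<le> ennreal E \<Longrightarrow> 0 \<le> E \<Longrightarrow>
      (\<And>t. t \<in> {0..T} \<Longrightarrow> norm (\<phi> (v t) - \<phi> (v 0)) \<le> c) \<Longrightarrow> a \<bullet> (v T - v 0) + (b - g) * T \<le> E"
    using cell_lower_bound[OF affine_minorant_levels[OF ab(1)] g(1)] by blast
  define \<kappa> where "\<kappa> = g * (t - s) / (\<Lambda> + 1)"
  have \<kappa>: "\<kappa> > 0" "\<kappa> * \<Lambda> \<le> g * (t - s)"
    using g(1) st \<Lambda>(2) by (auto simp: \<kappa>_def field_simps)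
  define err where "err j = ((norm a)\<^sup>2 / (4 * \<kappa>) + \<bar>b - g\<bar>) * (\<Lambda> * (T / c)\<^sup>2 * (e j / d j)\<^sup>2)
       + norm a * sqrt (e j * T * \<Lambda>) + \<bar>b - g\<bar> * (e j * T)" for j
  have "err \<longlonglongrightarrow> ((norm a)\<^sup>2 / (4 * \<kappa>) + \<bar>b - g\<bar>) * (\<Lambda> * (T / c)\<^sup>2 * 0\<^sup>2) + norm a * sqrt (0 * T * \<Lambda>) + \<bar>b - g\<bar> * (0 * T)"
    unfolding err_def by (intro tendsto_intros e d)
  then have err: "err \<longlonglongrightarrow> 0" by simp
  have "(\<lambda>j. a \<bullet> (u j t - u j s) + (b - g) * (t - s) - \<kappa> * \<Lambda> - err j) \<longlonglongrightarrow> a \<bullet> (y - x) + (b - g) * (t - s) - \<kappa> * \<Lambda> - 0"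
    by (intro tendsto_intros lim err)
  moreover have "m * (t - s) < a \<bullet> (y - x) + (b - g) * (t - s) - \<kappa> * \<Lambda> - 0"
  proof -
    have "y - x = (t - s) *\<^sub>R w" using st by (simp add: w_def)
    then have "a \<bullet> (y - x) = (t - s) * (a \<bullet> w)" by simp
    also have "\<dots> = (m + 4 * g - b) * (t - s)" using g(2) by (simp add: mult.commute eq_diff_eq)
    finally have "a \<bullet> (y - x) + (b - g) * (t - s) = m * (t - s) + 3 * (g * (t - s))" by (simp add: algebra_simps)
    moreover have "0 < g * (t - s)" using g(1) st by simp
    ultimately show ?thesis using \<kappa>(2) by linarith
  qed
  ultimately have "\<forall>\<^sub>F j in sequentially. m * (t - s) < a \<bullet> (u j t - u j s) + (b - g) * (t - s) - \<kappa> * \<Lambda> - err j"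
    by (rule order_tendstoD(1))
  then show ?thesis
  proof eventually_elim
    case (elim j)
    have "a \<bullet> (u j t - u j s) + (b - g) * (t - s) \<le> enn2real (energy s t (u j)) + \<kappa> * \<Lambda>
      + ((norm a)\<^sup>2 / (4 * \<kappa>) + \<bar>b - g\<bar>) * (\<Lambda> * (T / c)\<^sup>2 * (e j / d j)\<^sup>2) + norm a * sqrt (e j * T * \<Lambda>) + \<bar>b - g\<bar> * (e j * T)"
    proof (rule small_pieces_lower_bound[OF _ T c e(1) d(1) \<kappa>(1) \<Lambda>])
      show "a \<bullet> (v T - v 0) + (b - g) * T \<le> E" if "energy 0 T v \<le> ennreal E" "0 \<le> E"
        "\<And>t. t \<in> {0..T} \<Longrightarrow> norm (\<phi> (v t) - \<phi> (v 0)) \<le> c" for v E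
        by (rule cell[OF that])
    qed (use st in auto)
    then show ?case using elim unfolding err_def by linarith
  qed
qed

lemma slope_sum_le:
  assumes e: "\<And>j. e j > 0" "e \<longlonglongrightarrow> 0" and d: "\<And>j. d j > 0" "(\<lambda>j. e j / d j) \<longlonglongrightarrow> 0"
    and \<Lambda>: "\<And>j. fast_energy \<phi> (d j) (e j) 0 1 (u j) \<le> ennreal \<Lambda>" "0 \<le> \<Lambda>"
    and lim: "\<And>t. t \<in> {0..1} \<Longrightarrow> (\<lambda>j. u j t) \<longlonglongrightarrow> g t" and N: "N > 0"
  shows "(\<Sum>i<N. (1 / real N) * hom_density (slope g (1 / real N) i)) \<le> \<Lambda>"
proof (rule field_le_epsilon)
  fix \<kappa> :: real assume \<kappa>: "\<kappa> > 0"
  define h where "h = 1 / real N"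
  have h: "h > 0" "real N * h = 1" using N by (auto simp: h_def)
  have node: "0 \<le> real i * h" "real (Suc i) * h \<le> 1" if "i < N" for i
  proof -
    have "real (Suc i) * h \<le> real N * h" using that h by (intro mult_right_mono) auto
    then show "0 \<le> real i * h" "real (Suc i) * h \<le> 1" using h by auto
  qed
  have diff: "real (Suc i) * h - real i * h = h" for i by (simp add: algebra_simps)
  have "\<forall>\<^sub>F j in sequentially. (hom_density (slope g h i) - \<kappa>) * h \<le> enn2real (energy (real i * h) (real (Suc i) * h) (u j))" if "i < N" for i
  proof -
    have "(g (real (Suc i) * h) - g (real i * h)) /\<^sub>R (real (Suc i) * h - real i * h) = slope g h i"
      unfolding diff slope_def ..
    then have "hom_density (slope g h i) - \<kappa> < hom_density ((g (real (Suc i) * h) - g (real i * h)) /\<^sub>R (real (Suc i) * h - real i * h))"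
      using \<kappa> by simp
    from interval_lower_bound[OF e d \<Lambda> _ _ _ lim lim this] show ?thesis
      using node[OF that] h unfolding diff by (simp add: algebra_simps)
  qed
  then have "\<forall>\<^sub>F j in sequentially. \<forall>i\<in>{..<N}. (hom_density (slope g h i) - \<kappa>) * h \<le> enn2real (energy (real i * h) (real (Suc i) * h) (u j))"
    by (intro eventually_ball_finite) auto
  then obtain j where j: "\<forall>i\<in>{..<N}. (hom_density (slope g h i) - \<kappa>) * h \<le> enn2real (energy (real i * h) (real (Suc i) * h) (u j))"
    by (auto simp: eventually_sequentially)
  have en_u: "energy 0 1 (u j) \<le> ennreal \<Lambda>"
    using \<Lambda>(1)[of j] unfolding fast_energy_def by (rule order_trans[rotated]) simp
  have "energy (real i * h) (real (Suc i) * h) (u j) = ennreal (enn2real (energy (real i * h) (real (Suc i) * h) (u j)))" if "i < N" for i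
  proof -
    have "energy (real i * h) (real (Suc i) * h) (u j) \<le> ennreal \<Lambda>"
      using node[OF that] by (intro order_trans[OF energy_mono en_u]) auto
    then show ?thesis by (intro ennreal_enn2real[symmetric]) (auto intro: le_less_trans)
  qed
  then have "ennreal (\<Sum>i<N. enn2real (energy (real i * h) (real (Suc i) * h) (u j))) = (\<Sum>i<N. energy (real i * h) (real (Suc i) * h) (u j))"
    by (subst sum_ennreal[symmetric]) auto
  also have "\<dots> = energy 0 1 (u j)"
    using energy_uniform_split[of h 0 N "u j"] h by simp
  finally have "(\<Sum>i<N. enn2real (energy (real i * h) (real (Suc i) * h) (u j))) \<le> \<Lambda>"
    using en_u \<Lambda>(2) by (simp flip: ennreal_le_iff)
  moreover have "(\<Sum>i<N. (hom_density (slope g h i) - \<kappa>) * h) \<le> (\<Sum>i<N. enn2real (energy (real i * h) (real (Suc i) * h) (u j)))"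
    using j by (intro sum_mono) auto
  moreover have "(\<Sum>i<N. (hom_density (slope g h i) - \<kappa>) * h) = (\<Sum>i<N. h * hom_density (slope g h i)) - real N * h * \<kappa>"
    by (simp only: left_diff_distrib sum_subtractf) (simp add: mult.commute)
  ultimately show "(\<Sum>i<N. (1 / real N) * hom_density (slope g (1 / real N) i)) \<le> \<Lambda> + \<kappa>"
    using h by (simp add: h_def)
qed

end

text \<open>The cell of the partition that contains \<open>t\<close> need not have \<open>t\<close> as an end point, which is why the
  derivative was established along all short intervals around \<open>t\<close>.\<close>
lemma slope_tendsto_derivative:
  fixes v :: "real \<Rightarrow> 'a::euclidean_space"
  assumes "primitive_of 1 v g"
  shows "AE t in lebesgue_on {0..1}. (\<lambda>k. step_fun (1 / real (Suc k)) (slope g (1 / real (Suc k))) t) \<longlonglongrightarrow> v t"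
  using primitive_AE_slope[OF assms] AE_lebesgue_on_interior[of 0 1]
proof eventually_elim
  case (elim t)
  show ?case
  proof (rule LIMSEQ_I)
    fix r :: real assume "r > 0"
    then have r2: "r / 2 > 0" by simp
    from spec[OF elim(1), THEN mp, OF r2] obtain \<delta> where \<delta>: "\<delta> > 0"
      "\<forall>x y. 0 \<le> x \<and> x \<le> t \<and> t \<le> y \<and> y \<le> 1 \<and> x < y \<and> y - x < \<delta> \<longrightarrow> norm (g y - g x - (y - x) *\<^sub>R v t) \<le> r / 2 * (y - x)"
      by (elim exE conjE)
    obtain K where K: "1 / real (Suc K) < \<delta>" using reals_Archimedean[OF \<delta>(1)] by (auto simp: inverse_eq_divide)
    have "norm (step_fun (1 / real (Suc k)) (slope g (1 / real (Suc k))) t - v t) < r" if k: "k \<ge> K" for k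
    proof -
      define h where "h = 1 / real (Suc k)"
      have h: "h > 0" "real (Suc k) * h = 1" by (auto simp: h_def)
      have "h \<le> 1 / real (Suc K)" unfolding h_def using k by (intro divide_left_mono) auto
      then have h\<delta>: "h < \<delta>" using K by simp
      define i where "i = nat \<lfloor>t / h\<rfloor>"
      have "0 \<le> t / h" using elim(2) h by simp
      then have "real i \<le> t / h" "t / h < real i + 1" unfolding i_def by linarith+
      then have i: "real i * h \<le> t" "t < real (Suc i) * h" using h by (simp_all add: field_simps)
      have "real i * h < real (Suc k) * h" using i elim(2) h(2) by linarith
      then have "i < Suc k" using h(1) by simp
      then have "real (Suc i) * h \<le> real (Suc k) * h" using h by (intro mult_right_mono) auto
      then have le1: "real (Suc i) * h \<le> 1" by (simp only: h(2))
      have d: "real (Suc i) * h - real i * h = h" by (simp add: algebra_simps)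
      have "norm (g (real (Suc i) * h) - g (real i * h) - (real (Suc i) * h - real i * h) *\<^sub>R v t) \<le> r / 2 * (real (Suc i) * h - real i * h)"
        using \<delta>(2)[rule_format, of "real i * h" "real (Suc i) * h"] i le1 h h\<delta> d by auto
      then have "norm (h *\<^sub>R slope g h i - h *\<^sub>R v t) \<le> r / 2 * h"
        unfolding d scaleR_slope[OF h(1)] .
      then have "h * norm (slope g h i - v t) \<le> r / 2 * h"
        using h(1) by (simp flip: scaleR_diff_right)
      then have "norm (slope g h i - v t) \<le> r / 2" using h(1) by (simp add: mult.commute)
      moreover have "step_fun h (slope g h) t = slope g h i" using step_fun_eq[OF h(1) i] .
      ultimately show ?thesis using \<open>r > 0\<close> unfolding h_def[symmetric] by simp
    qed
    then show "\<exists>no. \<forall>n\<ge>no. norm (step_fun (1 / real (Suc n)) (slope g (1 / real (Suc n))) t - v t) < r" by blast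
  qed
qed

context level_geometry
begin

text \<open>Fatou's lemma for the densities at the slopes of \<open>g\<close> on uniform partitions, which converge almost
  everywhere to the density at the derivative.\<close>
lemma hom_energy_le:
  assumes e: "\<And>j. e j > 0" "e \<longlonglongrightarrow> 0" and d: "\<And>j. d j > 0" "(\<lambda>j. e j / d j) \<longlonglongrightarrow> 0"
    and \<Lambda>: "\<And>j. fast_energy \<phi> (d j) (e j) 0 1 (u j) \<le> ennreal \<Lambda>" "0 \<le> \<Lambda>"
    and lim: "\<And>t. t \<in> {0..1} \<Longrightarrow> (\<lambda>j. u j t) \<longlonglongrightarrow> g t" and g: "primitive_of 1 v g"
  shows "(\<integral>\<^sup>+t. psi_hom \<phi> (v t) \<partial>lebesgue_on {0..1}) \<le> ennreal \<Lambda>"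
proof -
  define S where "S k = step_fun (1 / real (Suc k)) (slope g (1 / real (Suc k)))" for k
  have S_hom: "S' = (\<lambda>t. hom_density (S k t))" if "S' = step_fun (1 / real (Suc k)) (\<lambda>i. hom_density (slope g (1 / real (Suc k)) i))" for S' k
    unfolding that S_def by (simp add: step_fun_def fun_eq_iff)
  have int: "((\<lambda>t. hom_density (S k t)) has_integral (\<Sum>i<Suc k. (1 / real (Suc k)) * hom_density (slope g (1 / real (Suc k)) i))) {0..1}"
    and absint: "(\<lambda>t. hom_density (S k t)) absolutely_integrable_on {0..1}" for k
  proof -
    have p: "1 / real (Suc k) > 0" "real (Suc k) * (1 / real (Suc k)) = 1" by auto
    show "((\<lambda>t. hom_density (S k t)) has_integral (\<Sum>i<Suc k. (1 / real (Suc k)) * hom_density (slope g (1 / real (Suc k)) i))) {0..1}"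
      using has_integral_step_fun[OF p(1), where N = "Suc k" and c = "\<lambda>i. hom_density (slope g (1 / real (Suc k)) i)"]
      unfolding S_hom[OF refl] p(2) real_scaleR_def .
    show "(\<lambda>t. hom_density (S k t)) absolutely_integrable_on {0..1}"
      using step_fun_absolutely_integrable[OF p(1), where N = "Suc k" and c = "\<lambda>i. hom_density (slope g (1 / real (Suc k)) i)"]
      unfolding S_hom[OF refl] p(2) .
  qed
  have le: "(\<integral>\<^sup>+t. ennreal (hom_density (S k t)) \<partial>lebesgue_on {0..1}) \<le> ennreal \<Lambda>" for k
  proof -
    have i: "integrable (lebesgue_on {0..1}) (\<lambda>t. hom_density (S k t))" using absint by (simp add: integrable_lebesgue_on_iff)
    have "(\<integral>\<^sup>+t. ennreal (hom_density (S k t)) \<partial>lebesgue_on {0..1}) = ennreal (integral {0..1} (\<lambda>t. hom_density (S k t)))"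
      using hom_density_nonneg by (subst nn_integral_eq_integral[OF i]) (auto simp: lebesgue_integral_eq_integral[OF i])
    also have "\<dots> \<le> ennreal \<Lambda>"
      unfolding integral_unique[OF int] by (intro ennreal_leI slope_sum_le[OF e d \<Lambda> lim]) auto
    finally show ?thesis .
  qed
  have "(\<integral>\<^sup>+t. psi_hom \<phi> (v t) \<partial>lebesgue_on {0..1}) = (\<integral>\<^sup>+t. liminf (\<lambda>k. ennreal (hom_density (S k t))) \<partial>lebesgue_on {0..1})"
  proof (rule nn_integral_cong_AE, use slope_tendsto_derivative[OF g] in eventually_elim)
    case (elim t)
    then have "(\<lambda>k. S k t) \<longlonglongrightarrow> v t" by (simp add: S_def)
    then have "(\<lambda>k. hom_density (S k t)) \<longlonglongrightarrow> hom_density (v t)"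
      using continuous_on_tendsto_compose[OF continuous_hom_density] by auto
    then have "(\<lambda>k. ennreal (hom_density (S k t))) \<longlonglongrightarrow> ennreal (hom_density (v t))" by (rule tendsto_ennrealI)
    then show ?case unfolding psi_hom_eq by (rule lim_imp_Liminf[OF sequentially_bot, symmetric])
  qed
  also have "\<dots> \<le> liminf (\<lambda>k. \<integral>\<^sup>+t. ennreal (hom_density (S k t)) \<partial>lebesgue_on {0..1})"
    using absolutely_integrable_imp_borel_measurable[OF absint] by (intro nn_integral_liminf) simp
  also have "\<dots> \<le> ennreal \<Lambda>"
    using le by (intro Liminf_le) (auto intro: always_eventually)
  finally show ?thesis .
qed

section \<open>The upper bound\<close>

text \<open>No relation between \<open>e\<close> and \<open>d\<close> is imposed: on a level the second part of the energy vanishes, and the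
  short segments off the level cost little as soon as both are small. Since start and length of
  the interval are arbitrary, such paths can be concatenated.\<close>
definition achievable :: "real^'m \<Rightarrow> real \<Rightarrow> bool" where
  "achievable w E \<longleftrightarrow> 0 \<le> E \<and> (\<forall>\<eta>>0. \<forall>l>0. \<exists>\<kappa>>0. \<forall>e d p. 0 < e \<longrightarrow> e < \<kappa> \<longrightarrow> 0 < d \<longrightarrow> d < \<kappa> \<longrightarrow>
     (\<exists>u. u 0 = p \<and> u l = p + l *\<^sub>R w \<and> fast_energy \<phi> d e 0 l u \<le> ennreal (l * E + \<eta>)))"

lemma fast_energy_concat:
  assumes "0 \<le> S" "0 \<le> T" "u S = v 0"
  shows "fast_energy \<phi> d e 0 (S + T) (concat_path S u v) = fast_energy \<phi> d e 0 S u + fast_energy \<phi> d e 0 T v"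
proof -
  have "(\<lambda>t. \<phi> (concat_path S u v t /\<^sub>R e)) = concat_path S (\<lambda>t. \<phi> (u t /\<^sub>R e)) (\<lambda>t. \<phi> (v t /\<^sub>R e))"
    by (auto simp: concat_path_def)
  then show ?thesis
    using assms energy_concat_path[of S T u v] energy_concat_path[of S T "\<lambda>t. \<phi> (u t /\<^sub>R e)" "\<lambda>t. \<phi> (v t /\<^sub>R e)"]
    by (simp add: fast_energy_def distrib_left ac_simps)
qed

lemma achievableD:
  assumes "achievable w E" "\<eta> > 0" "l > 0"
  shows "\<exists>\<kappa>>0. \<forall>e d p. 0 < e \<longrightarrow> e < \<kappa> \<longrightarrow> 0 < d \<longrightarrow> d < \<kappa> \<longrightarrow>
     (\<exists>u. u 0 = p \<and> u l = p + l *\<^sub>R w \<and> fast_energy \<phi> d e 0 l u \<le> ennreal (l * E + \<eta>))"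
  using assms unfolding achievable_def by blast

lemma achievable_mono:
  assumes "achievable w E" "E \<le> E'"
  shows "achievable w E'"
  unfolding achievable_def
proof (intro conjI allI impI)
  show "0 \<le> E'" using assms by (auto simp: achievable_def)
  fix \<eta> l :: real assume \<eta>: "\<eta> > 0" and l: "l > 0"
  obtain \<kappa> where \<kappa>: "\<kappa> > 0" "\<forall>e d p. 0 < e \<longrightarrow> e < \<kappa> \<longrightarrow> 0 < d \<longrightarrow> d < \<kappa> \<longrightarrow>
     (\<exists>u. u 0 = p \<and> u l = p + l *\<^sub>R w \<and> fast_energy \<phi> d e 0 l u \<le> ennreal (l * E + \<eta>))"
    using achievableD[OF assms(1) \<eta> l] by blast
  have "ennreal (l * E + \<eta>) \<le> ennreal (l * E' + \<eta>)" using assms(2) l by (intro ennreal_leI) auto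
  then show "\<exists>\<kappa>>0. \<forall>e d p. 0 < e \<longrightarrow> e < \<kappa> \<longrightarrow> 0 < d \<longrightarrow> d < \<kappa> \<longrightarrow>
     (\<exists>u. u 0 = p \<and> u l = p + l *\<^sub>R w \<and> fast_energy \<phi> d e 0 l u \<le> ennreal (l * E' + \<eta>))"
    using \<kappa> by (intro exI[of _ \<kappa>]) (blast intro: order_trans)
qed

lemma achievable_convex:
  assumes "achievable w1 E1" "achievable w2 E2" "0 < s" "s < 1"
  shows "achievable ((1 - s) *\<^sub>R w1 + s *\<^sub>R w2) ((1 - s) * E1 + s * E2)"
  unfolding achievable_def
proof (intro conjI allI impI)
  show "0 \<le> (1 - s) * E1 + s * E2" using assms by (auto simp: achievable_def)
  fix \<eta> l :: real assume \<eta>: "\<eta> > 0" and l: "l > 0"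
  define l1 l2 where "l1 = (1 - s) * l" and "l2 = s * l"
  have l12: "l1 > 0" "l2 > 0" "l1 + l2 = l" using assms l by (auto simp: l1_def l2_def algebra_simps)
  have \<eta>2: "\<eta> / 2 > 0" using \<eta> by simp
  obtain \<kappa>1 where \<kappa>1: "\<kappa>1 > 0" "\<forall>e d p. 0 < e \<longrightarrow> e < \<kappa>1 \<longrightarrow> 0 < d \<longrightarrow> d < \<kappa>1 \<longrightarrow>
     (\<exists>u. u 0 = p \<and> u l1 = p + l1 *\<^sub>R w1 \<and> fast_energy \<phi> d e 0 l1 u \<le> ennreal (l1 * E1 + \<eta> / 2))"
    using achievableD[OF assms(1) \<eta>2 l12(1)] by blast
  obtain \<kappa>2 where \<kappa>2: "\<kappa>2 > 0" "\<forall>e d p. 0 < e \<longrightarrow> e < \<kappa>2 \<longrightarrow> 0 < d \<longrightarrow> d < \<kappa>2 \<longrightarrow>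
     (\<exists>u. u 0 = p \<and> u l2 = p + l2 *\<^sub>R w2 \<and> fast_energy \<phi> d e 0 l2 u \<le> ennreal (l2 * E2 + \<eta> / 2))"
    using achievableD[OF assms(2) \<eta>2 l12(2)] by blast
  have E: "0 \<le> E1" "0 \<le> E2" using assms by (auto simp: achievable_def)
  show "\<exists>\<kappa>>0. \<forall>e d p. 0 < e \<longrightarrow> e < \<kappa> \<longrightarrow> 0 < d \<longrightarrow> d < \<kappa> \<longrightarrow>
     (\<exists>u. u 0 = p \<and> u l = p + l *\<^sub>R ((1 - s) *\<^sub>R w1 + s *\<^sub>R w2) \<and> fast_energy \<phi> d e 0 l u \<le> ennreal (l * ((1 - s) * E1 + s * E2) + \<eta>))"
  proof (intro exI[of _ "min \<kappa>1 \<kappa>2"] conjI allI impI)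
    fix e d p assume ed: "0 < e" "e < min \<kappa>1 \<kappa>2" "0 < d" "d < min \<kappa>1 \<kappa>2"
    obtain u where u: "u 0 = p" "u l1 = p + l1 *\<^sub>R w1" "fast_energy \<phi> d e 0 l1 u \<le> ennreal (l1 * E1 + \<eta> / 2)"
      using \<kappa>1(2)[rule_format, of e d p] ed by auto
    obtain v where v: "v 0 = p + l1 *\<^sub>R w1" "v l2 = (p + l1 *\<^sub>R w1) + l2 *\<^sub>R w2" "fast_energy \<phi> d e 0 l2 v \<le> ennreal (l2 * E2 + \<eta> / 2)"
      using \<kappa>2(2)[rule_format, of e d "p + l1 *\<^sub>R w1"] ed by auto
    have "fast_energy \<phi> d e 0 l (concat_path l1 u v) = fast_energy \<phi> d e 0 l1 u + fast_energy \<phi> d e 0 l2 v"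
      using fast_energy_concat[of l1 l2 u v] l12 u v by simp
    also have "\<dots> \<le> ennreal (l1 * E1 + \<eta> / 2) + ennreal (l2 * E2 + \<eta> / 2)" by (intro add_mono u v)
    also have "\<dots> = ennreal (l * ((1 - s) * E1 + s * E2) + \<eta>)"
    proof -
      have "0 \<le> l1 * E1 + \<eta> / 2" "0 \<le> l2 * E2 + \<eta> / 2" using E l12 \<eta> by auto
      then have "ennreal (l1 * E1 + \<eta> / 2) + ennreal (l2 * E2 + \<eta> / 2) = ennreal (l1 * E1 + \<eta> / 2 + (l2 * E2 + \<eta> / 2))"
        by (rule ennreal_plus[symmetric])
      also have "l1 * E1 + \<eta> / 2 + (l2 * E2 + \<eta> / 2) = l * ((1 - s) * E1 + s * E2) + \<eta>"
        by (simp add: l1_def l2_def algebra_simps)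
      finally show ?thesis .
    qed
    finally have "fast_energy \<phi> d e 0 l (concat_path l1 u v) \<le> ennreal (l * ((1 - s) * E1 + s * E2) + \<eta>)" .
    moreover have "concat_path l1 u v 0 = p" using u l12 by (simp add: concat_path_def)
    moreover have "concat_path l1 u v l = p + l *\<^sub>R ((1 - s) *\<^sub>R w1 + s *\<^sub>R w2)"
    proof -
      have "\<not> l \<le> l1" "l - l1 = l2" using l12 by auto
      then show ?thesis using v by (simp add: concat_path_def l1_def l2_def scaleR_add_right mult.commute)
    qed
    ultimately show "\<exists>u. u 0 = p \<and> u l = p + l *\<^sub>R ((1 - s) *\<^sub>R w1 + s *\<^sub>R w2) \<and> fast_energy \<phi> d e 0 l u \<le> ennreal (l * ((1 - s) * E1 + s * E2) + \<eta>)"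
      by blast
  qed (use \<kappa>1 \<kappa>2 in auto)
qed

text \<open>Segments of length of order \<open>e\<close> run through in a fixed time, for connecting a given point with the
  rescaled level.\<close>
lemma fast_energy_segment:
  assumes "\<tau> > 0" "e > 0" "norm (y - x) \<le> r * e"
  shows "fast_energy \<phi> d e 0 \<tau> (\<lambda>t. x + (t / \<tau>) *\<^sub>R (y - x)) \<le> ennreal (r\<^sup>2 / \<tau> * (e\<^sup>2 + L\<^sup>2 * d\<^sup>2))"
proof -
  let ?u = "\<lambda>t. x + (t / \<tau>) *\<^sub>R (y - x)"
  have re: "0 \<le> r * e" using assms(3) norm_ge_zero order_trans by blast
  have "energy 0 \<tau> ?u \<le> ennreal ((r * e / \<tau>)\<^sup>2 * (\<tau> - 0))"
  proof (rule energy_Lipschitz)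
    fix s t assume st: "s \<in> {0..\<tau>}" "t \<in> {0..\<tau>}" "s \<le> t"
    have "?u t - ?u s = ((t - s) / \<tau>) *\<^sub>R (y - x)" by (simp add: diff_divide_distrib scaleR_diff_left)
    then have "norm (?u t - ?u s) = (t - s) / \<tau> * norm (y - x)" using st assms(1) by simp
    also have "\<dots> \<le> (t - s) / \<tau> * (r * e)" using st assms by (intro mult_left_mono) auto
    finally show "norm (?u t - ?u s) \<le> r * e / \<tau> * (t - s)" by (simp add: mult.commute)
  qed (use re assms in auto)
  also have "(r * e / \<tau>)\<^sup>2 * (\<tau> - 0) = r\<^sup>2 / \<tau> * e\<^sup>2" using assms by (simp add: power2_eq_square)
  finally have en: "energy 0 \<tau> ?u \<le> ennreal (r\<^sup>2 / \<tau> * e\<^sup>2)" .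
  have "ennreal (d\<^sup>2) * energy 0 \<tau> (\<lambda>t. \<phi> (?u t /\<^sub>R e)) \<le> ennreal (d\<^sup>2) * (ennreal ((L / e)\<^sup>2) * ennreal (r\<^sup>2 / \<tau> * e\<^sup>2))"
    by (intro mult_left_mono order_trans[OF energy_Lipschitz_rescaled[OF Lipschitz assms(2)]] en) auto
  also have "\<dots> = ennreal (r\<^sup>2 / \<tau> * (L\<^sup>2 * d\<^sup>2))"
  proof -
    have "d\<^sup>2 * ((L / e)\<^sup>2 * (r\<^sup>2 / \<tau> * e\<^sup>2)) = r\<^sup>2 / \<tau> * (L\<^sup>2 * d\<^sup>2)" using assms by (simp add: power_divide)
    then show ?thesis by (simp only: ennreal_mult'[OF zero_le_power2, symmetric])
  qed
  finally have "fast_energy \<phi> d e 0 \<tau> ?u \<le> ennreal (r\<^sup>2 / \<tau> * e\<^sup>2) + ennreal (r\<^sup>2 / \<tau> * (L\<^sup>2 * d\<^sup>2))"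
    unfolding fast_energy_def by (intro add_mono en)
  also have "\<dots> = ennreal (r\<^sup>2 / \<tau> * (e\<^sup>2 + L\<^sup>2 * d\<^sup>2))"
    using assms(1) by (subst ennreal_plus[symmetric]) (auto simp: distrib_left)
  finally show ?thesis .
qed

text \<open>Rescale an almost optimal level path of duration \<open>l / e\<close>, moved by a lattice vector to the vicinity of
  the given start. The connecting segments \<open>A\<close> and \<open>C\<close> take time \<open>\<tau>\<close> each, so the level path \<open>B\<close> is run
  through slightly faster, in time \<open>l - 2 * \<tau>\<close>.\<close>
lemma achievable_level:
  assumes z: "z \<in> range \<phi>" and E: "psi_hom_z \<phi> z w < ennreal E"
  shows "achievable w E"
  unfolding achievable_def
proof (intro conjI allI impI)
  show E0: "0 \<le> E" using E by (metis ennreal_neg linorder_le_cases not_less_zero order_le_less)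
  fix \<eta> l :: real assume \<eta>: "\<eta> > 0" and l: "l > 0"
  define r where "r = 2 * sqrt (real CARD('m))"
  have "\<forall>\<^sub>F T in at_top. psi_z \<phi> z T w < ennreal E" by (rule order_tendstoD(2)[OF psi_z_tendsto[OF z] E])
  then obtain T0 where T0: "\<And>T. T \<ge> T0 \<Longrightarrow> psi_z \<phi> z T w < ennreal E" by (auto simp: eventually_at_top_linorder)
  \<comment> \<open>Small enough for the speed-up to cost at most \<open>\<eta> / 2\<close>; then \<open>\<kappa>\<close> below makes each segment cost at most
    \<open>\<eta> / 4\<close>.\<close>
  define \<tau> where "\<tau> = min (l / 4) (l * \<eta> / (4 * (l * E + \<eta> / 2)))"
  have pos: "0 < l * E + \<eta> / 2" using l E0 \<eta> by (simp add: add_nonneg_pos)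
  have \<tau>: "\<tau> > 0" "\<tau> \<le> l / 4"
  proof -
    show "\<tau> > 0" using l \<eta> pos by (simp add: \<tau>_def)
    show "\<tau> \<le> l / 4" unfolding \<tau>_def by (rule min.cobounded1)
  qed
  have "\<tau> * (4 * (l * E + \<eta> / 2)) \<le> l * \<eta>"
  proof -
    have "\<tau> \<le> l * \<eta> / (4 * (l * E + \<eta> / 2))" by (simp add: \<tau>_def)
    then show ?thesis using pos by (subst (asm) pos_le_divide_eq) auto
  qed
  then have speed: "l\<^sup>2 * E \<le> (l - 2 * \<tau>) * (l * E + \<eta> / 2)"
    by (simp add: power2_eq_square algebra_simps)
  define \<kappa> where "\<kappa> = min (l / max 1 T0) (sqrt (\<tau> * \<eta> / (4 * (r\<^sup>2 * (1 + L\<^sup>2) + 1))))"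
  have rpos: "0 < r\<^sup>2 * (1 + L\<^sup>2) + 1" by (simp add: add_nonneg_pos)
  have "\<kappa> > 0" using l \<tau> \<eta> rpos by (auto simp: \<kappa>_def)
  moreover have "\<exists>u. u 0 = p \<and> u l = p + l *\<^sub>R w \<and> fast_energy \<phi> d e 0 l u \<le> ennreal (l * E + \<eta>)"
    if ed: "0 < e" "e < \<kappa>" "0 < d" "d < \<kappa>" for e d p
  proof -
    define T where "T = l / e"
    have "e < l / max 1 T0" using ed by (simp add: \<kappa>_def)
    then have "e * max 1 T0 < l" by (simp add: pos_less_divide_eq)
    then have "max 1 T0 * e < l" by (simp only: mult.commute)
    then have "max 1 T0 < T" unfolding T_def using pos_less_divide_eq[OF ed(1)] by blast
    then have T: "T \<ge> T0" "T > 0" by auto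
    obtain x y F where xy: "reach \<phi> z T x y F" "norm x \<le> sqrt (real CARD('m))" "norm (y - T *\<^sub>R w) \<le> sqrt (real CARD('m))" "0 \<le> F" "F \<le> E * T"
      using psi_z_less_imp_reach[OF T(2) T0[OF T(1)]] by blast
    obtain v where v: "v 0 = x" "v T = y" "\<forall>t\<in>{0..T}. \<phi> (v t) = z" "energy 0 T v \<le> ennreal F"
      using xy(1) by (auto simp: reach_def)
    obtain k where k: "k \<in> lattice" "norm (p /\<^sub>R e - k) \<le> sqrt (real CARD('m))" by (rule lattice_near)
    have p: "p = e *\<^sub>R (p /\<^sub>R e)" using ed by simp
    define x' y' where "x' = e *\<^sub>R (x + k)" and "y' = e *\<^sub>R (y + k)"
    define A where "A t = p + (t / \<tau>) *\<^sub>R (x' - p)" for t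
    define B where "B t = e *\<^sub>R (v (T / (l - 2 * \<tau>) * t + 0) + k)" for t
    define C where "C t = y' + (t / \<tau>) *\<^sub>R (p + l *\<^sub>R w - y')" for t
    have l2: "l - 2 * \<tau> > 0" using \<tau> l by simp
    have "norm (x' - p) = e * norm (x - (p /\<^sub>R e - k))"
    proof -
      have "x' - p = e *\<^sub>R (x - (p /\<^sub>R e - k))" by (subst p) (simp add: x'_def algebra_simps)
      then show ?thesis using ed by simp
    qed
    also have "\<dots> \<le> e * r"
      using norm_triangle_ineq4[of x "p /\<^sub>R e - k"] xy(2) k(2) ed by (intro mult_left_mono) (auto simp: r_def)
    finally have enA: "fast_energy \<phi> d e 0 \<tau> A \<le> ennreal (r\<^sup>2 / \<tau> * (e\<^sup>2 + L\<^sup>2 * d\<^sup>2))"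
      unfolding A_def using \<tau> ed by (intro fast_energy_segment) (auto simp: mult.commute)
    have "norm (p + l *\<^sub>R w - y') = e * norm ((p /\<^sub>R e - k) - (y - T *\<^sub>R w))"
    proof -
      have "l *\<^sub>R w = e *\<^sub>R (T *\<^sub>R w)" using ed by (simp add: T_def)
      then have "p + l *\<^sub>R w - y' = e *\<^sub>R ((p /\<^sub>R e - k) - (y - T *\<^sub>R w))" by (subst p) (simp add: y'_def algebra_simps)
      then show ?thesis using ed by simp
    qed
    also have "\<dots> \<le> e * r"
      using norm_triangle_ineq4[of "p /\<^sub>R e - k" "y - T *\<^sub>R w"] xy(3) k(2) ed by (intro mult_left_mono) (auto simp: r_def)
    finally have enC: "fast_energy \<phi> d e 0 \<tau> C \<le> ennreal (r\<^sup>2 / \<tau> * (e\<^sup>2 + L\<^sup>2 * d\<^sup>2))"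
      unfolding C_def using \<tau> ed by (intro fast_energy_segment) (auto simp: mult.commute)
    have enB: "fast_energy \<phi> d e 0 (l - 2 * \<tau>) B \<le> ennreal (l * E + \<eta> / 2)"
    proof -
      let ?\<sigma> = "T / (l - 2 * \<tau>)"
      have \<sigma>: "?\<sigma> > 0" using T l2 by simp
      have "energy 0 (l - 2 * \<tau>) B = ennreal (e\<^sup>2) * (ennreal ?\<sigma> * energy (?\<sigma> * 0 + 0) (?\<sigma> * (l - 2 * \<tau>) + 0) v)"
        unfolding B_def energy_scaleR energy_translate by (subst energy_reparam[OF \<sigma>]) simp
      also have "?\<sigma> * 0 + 0 = 0" by simp
      also have "?\<sigma> * (l - 2 * \<tau>) + 0 = T" using l2 by simp
      also have "ennreal (e\<^sup>2) * (ennreal ?\<sigma> * energy 0 T v) \<le> ennreal (e\<^sup>2) * (ennreal ?\<sigma> * ennreal (E * T))"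
        using v(4) xy(5) by (intro mult_left_mono) (auto intro: order_trans ennreal_leI)
      also have "\<dots> = ennreal (e\<^sup>2 * (?\<sigma> * (E * T)))"
        by (simp only: ennreal_mult'[OF zero_le_power2] ennreal_mult'[OF less_imp_le[OF \<sigma>]])
      also have "e\<^sup>2 * (?\<sigma> * (E * T)) = l\<^sup>2 * E / (l - 2 * \<tau>)"
        using ed by (simp add: T_def power2_eq_square)
      also have "ennreal \<dots> \<le> ennreal (l * E + \<eta> / 2)"
        using speed l2 by (intro ennreal_leI) (simp add: pos_divide_le_eq mult.commute)
      finally have 1: "energy 0 (l - 2 * \<tau>) B \<le> ennreal (l * E + \<eta> / 2)" .
      have "\<phi> (B t /\<^sub>R e) = z" if t: "t \<in> {0..l - 2 * \<tau>}" for t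
      proof -
        have "?\<sigma> * t \<le> ?\<sigma> * (l - 2 * \<tau>)" using t \<sigma> by (intro mult_left_mono) auto
        also have "?\<sigma> * (l - 2 * \<tau>) = T" using l2 by simp
        finally have "?\<sigma> * t \<le> T" .
        moreover have "0 \<le> ?\<sigma> * t" using t \<sigma> by (intro mult_nonneg_nonneg) auto
        ultimately have "?\<sigma> * t + 0 \<in> {0..T}" unfolding atLeastAtMost_iff add_0_right by blast
        then have "\<phi> (v (?\<sigma> * t + 0)) = z" using v(3) by blast
        then show ?thesis using ed periodic_add[OF periodic k(1)] by (simp add: B_def)
      qed
      then have "energy 0 (l - 2 * \<tau>) (\<lambda>t. \<phi> (B t /\<^sub>R e)) = energy 0 (l - 2 * \<tau>) (\<lambda>t. z)" by (intro energy_cong) auto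
      then show ?thesis using 1 by (simp add: fast_energy_def)
    qed
    define U where "U = concat_path \<tau> A (concat_path (l - 2 * \<tau>) B C)"
    have joinB: "B (l - 2 * \<tau>) = C 0" using l2 v by (simp add: B_def C_def y'_def)
    have joinA: "A \<tau> = concat_path (l - 2 * \<tau>) B C 0" using l2 v \<tau> by (simp add: A_def B_def x'_def concat_path_def)
    have "fast_energy \<phi> d e 0 (\<tau> + ((l - 2 * \<tau>) + \<tau>)) U = fast_energy \<phi> d e 0 \<tau> A + (fast_energy \<phi> d e 0 (l - 2 * \<tau>) B + fast_energy \<phi> d e 0 \<tau> C)"
      unfolding U_def using \<tau> l2 fast_energy_concat[of \<tau> "(l - 2 * \<tau>) + \<tau>" A "concat_path (l - 2 * \<tau>) B C" d e, OF _ _ joinA]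
        fast_energy_concat[of "l - 2 * \<tau>" \<tau> B C d e, OF _ _ joinB] by simp
    also have "\<tau> + ((l - 2 * \<tau>) + \<tau>) = l" by simp
    also have "fast_energy \<phi> d e 0 \<tau> A + (fast_energy \<phi> d e 0 (l - 2 * \<tau>) B + fast_energy \<phi> d e 0 \<tau> C)
       \<le> ennreal (\<eta> / 4) + (ennreal (l * E + \<eta> / 2) + ennreal (\<eta> / 4))"
    proof -
      have "e\<^sup>2 \<le> \<kappa>\<^sup>2" "d\<^sup>2 \<le> \<kappa>\<^sup>2" using ed by (auto intro: power_mono)
      moreover have "\<kappa>\<^sup>2 \<le> \<tau> * \<eta> / (4 * (r\<^sup>2 * (1 + L\<^sup>2) + 1))"
      proof -
        have "0 \<le> \<tau> * \<eta> / (4 * (r\<^sup>2 * (1 + L\<^sup>2) + 1))" using \<tau> \<eta> rpos by simp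
        moreover have "\<kappa>\<^sup>2 \<le> (sqrt (\<tau> * \<eta> / (4 * (r\<^sup>2 * (1 + L\<^sup>2) + 1))))\<^sup>2"
          using \<open>\<kappa> > 0\<close> by (intro power_mono) (auto simp: \<kappa>_def)
        ultimately show ?thesis by simp
      qed
      ultimately have "e\<^sup>2 \<le> \<tau> * \<eta> / (4 * (r\<^sup>2 * (1 + L\<^sup>2) + 1))" "d\<^sup>2 \<le> \<tau> * \<eta> / (4 * (r\<^sup>2 * (1 + L\<^sup>2) + 1))" by linarith+
      then have "e\<^sup>2 + L\<^sup>2 * d\<^sup>2 \<le> \<tau> * \<eta> / (4 * (r\<^sup>2 * (1 + L\<^sup>2) + 1)) + L\<^sup>2 * (\<tau> * \<eta> / (4 * (r\<^sup>2 * (1 + L\<^sup>2) + 1)))"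
        by (intro add_mono mult_left_mono) auto
      also have "\<dots> = (1 + L\<^sup>2) * (\<tau> * \<eta> / (4 * (r\<^sup>2 * (1 + L\<^sup>2) + 1)))" by (simp only: distrib_right mult_1)
      finally have "r\<^sup>2 / \<tau> * (e\<^sup>2 + L\<^sup>2 * d\<^sup>2) \<le> r\<^sup>2 / \<tau> * ((1 + L\<^sup>2) * (\<tau> * \<eta> / (4 * (r\<^sup>2 * (1 + L\<^sup>2) + 1))))"
        using \<tau> by (intro mult_left_mono) auto
      also have "\<dots> = \<eta> / 4 * ((r\<^sup>2 * (1 + L\<^sup>2)) / (r\<^sup>2 * (1 + L\<^sup>2) + 1))" using \<tau> by simp
      also have "\<dots> \<le> \<eta> / 4 * 1" using rpos \<eta> by (intro mult_left_mono) (auto simp: divide_le_eq)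
      finally have "ennreal (r\<^sup>2 / \<tau> * (e\<^sup>2 + L\<^sup>2 * d\<^sup>2)) \<le> ennreal (\<eta> / 4)" by (intro ennreal_leI) simp
      then show ?thesis using enA enB enC by (intro add_mono) (auto intro: order_trans)
    qed
    also have "\<dots> = ennreal (l * E + \<eta>)"
      using \<eta> pos by (simp add: ennreal_plus[symmetric] del: ennreal_plus)
    finally have "fast_energy \<phi> d e 0 l U \<le> ennreal (l * E + \<eta>)" .
    moreover have "U 0 = p" using \<tau> by (simp add: U_def concat_path_def A_def)
    moreover have "U l = p + l *\<^sub>R w"
    proof -
      have "\<not> l \<le> \<tau>" "\<not> l - \<tau> \<le> l - 2 * \<tau>" "l - \<tau> - (l - 2 * \<tau>) = \<tau>" using \<tau> l by auto
      then have "U l = C \<tau>" unfolding U_def concat_path_def by simp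
      then show ?thesis using \<tau> by (simp add: C_def)
    qed
    ultimately show ?thesis by blast
  qed
  ultimately show "\<exists>\<kappa>>0. \<forall>e d p. 0 < e \<longrightarrow> e < \<kappa> \<longrightarrow> 0 < d \<longrightarrow> d < \<kappa> \<longrightarrow>
     (\<exists>u. u 0 = p \<and> u l = p + l *\<^sub>R w \<and> fast_energy \<phi> d e 0 l u \<le> ennreal (l * E + \<eta>))" by blast
qed

text \<open>The infimum \<open>G\<close> of the achievable costs is convex by concatenation and at most the integrand of every
  level, so it is one of the functions over which the convex envelope is the supremum.\<close>
lemma achievable_hom:
  assumes "hom_density w < E"
  shows "achievable w E"
proof -
  define G where "G w = (INF E \<in> {E. achievable w E}. ennreal E)" for w
  have approx: "\<exists>E. achievable x E \<and> ennreal E \<le> G x + ennreal \<eta>" if x: "G x < \<infinity>" "\<eta> > 0" for x \<eta>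
  proof -
    obtain y where y: "G x = ennreal y" "0 \<le> y" using x by (cases "G x") auto
    then have "G x < ennreal (y + \<eta>)" using x by (simp add: ennreal_less_iff)
    then obtain E where "achievable x E" "ennreal E < ennreal (y + \<eta>)" unfolding G_def by (auto simp: INF_less_iff)
    then show ?thesis using y x by (intro exI[of _ E]) (auto simp: ennreal_plus)
  qed
  have "ext_convex G"
    unfolding ext_convex_def
  proof (intro allI ballI)
    fix x y :: "real^'m" and s :: real assume s: "s \<in> {0..1}"
    show "G ((1 - s) *\<^sub>R x + s *\<^sub>R y) \<le> ennreal (1 - s) * G x + ennreal s * G y"
    proof (cases "s = 0 \<or> s = 1")
      case True
      then show ?thesis by auto
    next
      case False
      then have s: "0 < s" "s < 1" using s by auto
      show ?thesis
      proof (cases "G x < \<infinity> \<and> G y < \<infinity>")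
        case True
        show ?thesis
        proof (rule ennreal_le_epsilon)
          fix \<eta> :: real assume \<eta>: "0 < \<eta>"
          obtain E1 where E1: "achievable x E1" "ennreal E1 \<le> G x + ennreal \<eta>" using approx True \<eta> by blast
          obtain E2 where E2: "achievable y E2" "ennreal E2 \<le> G y + ennreal \<eta>" using approx True \<eta> by blast
          have E0: "0 \<le> E1" "0 \<le> E2" using E1 E2 by (auto simp: achievable_def)
          have "G ((1 - s) *\<^sub>R x + s *\<^sub>R y) \<le> ennreal ((1 - s) * E1 + s * E2)"
            unfolding G_def by (intro INF_lower) (use achievable_convex[OF E1(1) E2(1) s] in auto)
          also have "\<dots> = ennreal (1 - s) * ennreal E1 + ennreal s * ennreal E2"
            using s E0 by (simp add: ennreal_plus ennreal_mult)
          also have "\<dots> \<le> ennreal (1 - s) * (G x + ennreal \<eta>) + ennreal s * (G y + ennreal \<eta>)"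
            using E1 E2 by (intro add_mono mult_left_mono) auto
          also have "\<dots> = ennreal (1 - s) * G x + ennreal s * G y + (ennreal (1 - s) * ennreal \<eta> + ennreal s * ennreal \<eta>)"
            by (simp add: distrib_left ac_simps)
          also have "ennreal (1 - s) * ennreal \<eta> + ennreal s * ennreal \<eta> = ennreal \<eta>"
            using s \<eta> by (simp add: ennreal_mult[symmetric] ennreal_plus[symmetric] algebra_simps del: ennreal_plus)
          finally show "G ((1 - s) *\<^sub>R x + s *\<^sub>R y) \<le> ennreal (1 - s) * G x + ennreal s * G y + ennreal \<eta>" .
        qed
      next
        case False
        then have "G x = \<infinity> \<or> G y = \<infinity>" by (auto simp: not_less top_unique)
        then have "ennreal (1 - s) * G x + ennreal s * G y = \<infinity>"
          using s by (auto simp: ennreal_mult_eq_top_iff)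
        from this[symmetric] show ?thesis by (rule subst) simp
      qed
    qed
  qed
  moreover have "G x \<le> (INF z\<in>range \<phi>. psi_hom_z \<phi> z x)" for x
  proof (rule INF_greatest)
    fix z assume z: "z \<in> range \<phi>"
    show "G x \<le> psi_hom_z \<phi> z x"
    proof (rule ccontr)
      assume "\<not> ?thesis"
      then obtain q where q: "psi_hom_z \<phi> z x < q" "q < G x" using dense[of "psi_hom_z \<phi> z x" "G x"] by (auto simp: not_le)
      then obtain E where E: "q = ennreal E" by (cases q) auto
      have "G x \<le> ennreal E" unfolding G_def using achievable_level[OF z, of x E] q E by (intro INF_lower) auto
      then show False using q E by simp
    qed
  qed
  ultimately have "G w \<le> psi_hom \<phi> w"
    unfolding psi_hom_def by (rule convex_envelope_greatest)
  also have "\<dots> < ennreal E" unfolding psi_hom_eq using assms hom_density_nonneg[of w] by (simp add: ennreal_less_iff)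
  finally obtain E' where E': "achievable w E'" "ennreal E' < ennreal E" unfolding G_def by (auto simp: INF_less_iff)
  then have "E' < E" by (simp add: ennreal_less_iff achievable_def)
  then show ?thesis using achievable_mono[OF E'(1)] by simp
qed

lemma hom_density_integrable:
  assumes "v \<in> L2 1"
  shows "(\<lambda>t. hom_density (v t)) integrable_on {0..1}"
proof -
  obtain C where C: "\<And>w. hom_density w \<le> (C * norm w)\<^sup>2" using hom_density_upper by blast
  show ?thesis
  proof (rule measurable_bounded_by_integrable_imp_integrable)
    show "(\<lambda>t. hom_density (v t)) \<in> borel_measurable (lebesgue_on {0..1})"
      using measurable_compose[OF L2_measurable[OF assms] borel_measurable_continuous_onI[OF continuous_hom_density]] .
    show "(\<lambda>t. C\<^sup>2 * (norm (v t))\<^sup>2) integrable_on {0..1}"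
      by (intro integrable_on_mult_right L2_integrable_on[OF assms]) auto
    show "norm (hom_density (v t)) \<le> C\<^sup>2 * (norm (v t))\<^sup>2" for t
      using C[of "v t"] hom_density_nonneg[of "v t"] by (simp add: power_mult_distrib)
  qed auto
qed

text \<open>Jensen's inequality, by integrating affine minorants.\<close>
lemma hom_density_Jensen:
  assumes "primitive_of 1 v g" "0 \<le> s" "s < t" "t \<le> 1"
  shows "(t - s) * hom_density ((g t - g s) /\<^sub>R (t - s)) \<le> integral {s..t} (\<lambda>x. hom_density (v x))"
proof (rule field_le_epsilon)
  fix \<kappa> :: real assume \<kappa>: "\<kappa> > 0"
  define w where "w = (g t - g s) /\<^sub>R (t - s)"
  have ts: "t - s > 0" using assms by simp
  have "hom_density w - \<kappa> / (t - s) < hom_density w" using \<kappa> ts by simp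
  then obtain a b where ab: "\<And>x. a \<bullet> x + b \<le> hom_density x" "hom_density w - \<kappa> / (t - s) < a \<bullet> w + b"
    using hom_density_affine_minorant by blast
  have vi: "v integrable_on {s..t}" using assms by (intro L2_integrable_on[OF primitive_L2[OF assms(1)]]) auto
  have "(g t - g s) = (t - s) *\<^sub>R w" using ts by (simp add: w_def)
  then have "integral {s..t} v = (t - s) *\<^sub>R w"
    using primitive_increment[OF assms(1), of s t] assms by simp
  then have "((\<lambda>x. a \<bullet> v x + b) has_integral a \<bullet> ((t - s) *\<^sub>R w) + (t - s) *\<^sub>R b) {s..t}"
    using has_integral_linear[OF integrable_integral[OF vi] bounded_linear_inner_right[of a]] assms has_integral_const_real[of b s t]
    by (intro has_integral_add) (auto simp: o_def)
  moreover have "(\<lambda>x. hom_density (v x)) integrable_on {s..t}"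
    by (rule integrable_subinterval_real[OF hom_density_integrable[OF primitive_L2[OF assms(1)]]]) (use assms in auto)
  ultimately have "a \<bullet> ((t - s) *\<^sub>R w) + (t - s) *\<^sub>R b \<le> integral {s..t} (\<lambda>x. hom_density (v x))"
    using ab(1) by (intro has_integral_le[OF _ integrable_integral]) auto
  then have "(t - s) * (a \<bullet> w + b) \<le> integral {s..t} (\<lambda>x. hom_density (v x))" by (simp add: distrib_left)
  moreover have "(t - s) * (hom_density w - \<kappa> / (t - s)) \<le> (t - s) * (a \<bullet> w + b)"
    using ab(2) ts by (intro mult_left_mono) auto
  moreover have "(t - s) * (hom_density w - \<kappa> / (t - s)) = (t - s) * hom_density w - \<kappa>"
    using ts by (simp add: right_diff_distrib)
  ultimately show "(t - s) * hom_density ((g t - g s) /\<^sub>R (t - s)) \<le> integral {s..t} (\<lambda>x. hom_density (v x)) + \<kappa>"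
    unfolding w_def by linarith
qed

lemma slope_sum_le_hom_energy:
  assumes g: "primitive_of 1 v g" and N: "N > 0"
  shows "(\<Sum>i<N. (1 / real N) * hom_density (slope g (1 / real N) i)) \<le> integral {0..1} (\<lambda>x. hom_density (v x))"
proof -
  define h where "h = 1 / real N"
  have h: "h > 0" "real N * h = 1" using N by (auto simp: h_def)
  have hi: "(\<lambda>x. hom_density (v x)) integrable_on {0..1}" by (rule hom_density_integrable[OF primitive_L2[OF g]])
  have "M \<le> N \<Longrightarrow> (\<Sum>i<M. h * hom_density (slope g h i)) \<le> integral {0..real M * h} (\<lambda>x. hom_density (v x))" for M
  proof (induction M)
    case (Suc M)
    have "real (Suc M) * h \<le> real N * h" using Suc.prems h by (intro mult_right_mono) auto
    then have le: "0 \<le> real M * h" "real M * h < real (Suc M) * h" "real (Suc M) * h \<le> 1" using h by auto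
    have d: "real (Suc M) * h - real M * h = h" by (simp add: algebra_simps)
    have "h * hom_density (slope g h M) \<le> integral {real M * h..real (Suc M) * h} (\<lambda>x. hom_density (v x))"
      using hom_density_Jensen[OF g le] unfolding d slope_def .
    moreover have "integral {0..real M * h} (\<lambda>x. hom_density (v x)) + integral {real M * h..real (Suc M) * h} (\<lambda>x. hom_density (v x))
        = integral {0..real (Suc M) * h} (\<lambda>x. hom_density (v x))"
      using le by (intro Henstock_Kurzweil_Integration.integral_combine integrable_subinterval_real[OF hi]) auto
    ultimately show ?case using Suc by simp
  qed simp
  from this[of N] show ?thesis using h by (simp add: h_def)
qed

text \<open>Each of the \<open>N\<close> cells uses the density at its slope plus \<open>1 / N\<close> as achievable cost and an error of
  \<open>1 / N\<^sup>2\<close>; together these add \<open>2 / N\<close>.\<close>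
lemma recovery_path:
  assumes g: "primitive_of 1 v g" and N: "N > 0"
  defines "\<Lambda> \<equiv> integral {0..1} (\<lambda>x. hom_density (v x))"
  obtains \<kappa> where "\<kappa> > 0" "\<And>e d. 0 < e \<Longrightarrow> e < \<kappa> \<Longrightarrow> 0 < d \<Longrightarrow> d < \<kappa> \<Longrightarrow>
    \<exists>u. fast_energy \<phi> d e 0 1 u \<le> ennreal (\<Lambda> + 2 / real N) \<and> (\<forall>i\<le>N. u (real i / real N) = g (real i / real N))"
proof -
  define h where "h = 1 / real N"
  have h: "h > 0" "real N * h = 1" using N by (auto simp: h_def)
  define E where "E i = hom_density (slope g h i) + 1 / real N" for i
  have E0: "0 \<le> E i" for i using hom_density_nonneg by (simp add: E_def)
  define \<eta> where "\<eta> = h / real N"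
  have \<eta>: "\<eta> > 0" using h N by (simp add: \<eta>_def)
  have "\<exists>\<kappa>>0. \<forall>e d p. 0 < e \<longrightarrow> e < \<kappa> \<longrightarrow> 0 < d \<longrightarrow> d < \<kappa> \<longrightarrow>
     (\<exists>u. u 0 = p \<and> u h = p + h *\<^sub>R slope g h i \<and> fast_energy \<phi> d e 0 h u \<le> ennreal (h * E i + \<eta>))" for i
  proof -
    have "achievable (slope g h i) (E i)" using N by (intro achievable_hom) (simp add: E_def)
    then show ?thesis using h(1) \<eta> unfolding achievable_def by blast
  qed
  then obtain K where K: "\<And>i. K i > 0" "\<And>i e d p. 0 < e \<Longrightarrow> e < K i \<Longrightarrow> 0 < d \<Longrightarrow> d < K i \<Longrightarrow>
     \<exists>u. u 0 = p \<and> u h = p + h *\<^sub>R slope g h i \<and> fast_energy \<phi> d e 0 h u \<le> ennreal (h * E i + \<eta>)" by metis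
  define \<kappa> where "\<kappa> = Min (K ` {..<N})"
  have "\<kappa> > 0" unfolding \<kappa>_def using K(1) N by (subst Min_gr_iff) (auto simp: lessThan_empty_iff)
  moreover have "\<exists>u. fast_energy \<phi> d e 0 1 u \<le> ennreal (\<Lambda> + 2 / real N) \<and> (\<forall>i\<le>N. u (real i / real N) = g (real i / real N))"
    if ed: "0 < e" "e < \<kappa>" "0 < d" "d < \<kappa>" for e d
  proof -
    have \<kappa>K: "\<kappa> \<le> K i" if "i < N" for i unfolding \<kappa>_def using that by (intro Min_le) auto
    have "M \<le> N \<Longrightarrow> \<exists>u. fast_energy \<phi> d e 0 (real M * h) u \<le> ennreal (\<Sum>i<M. h * E i + \<eta>) \<and> (\<forall>i\<le>M. u (real i * h) = g (real i * h))" for M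
    proof (induction M)
      case 0
      have "fast_energy \<phi> d e 0 0 (\<lambda>_. g 0) = 0" by (simp add: fast_energy_def)
      then show ?case by (intro exI[of _ "\<lambda>_. g 0"]) simp
    next
      case (Suc M)
      then obtain u where u: "fast_energy \<phi> d e 0 (real M * h) u \<le> ennreal (\<Sum>i<M. h * E i + \<eta>)" "\<forall>i\<le>M. u (real i * h) = g (real i * h)" by auto
      have "M < N" using Suc.prems by simp
      then have "e < K M" "d < K M" using \<kappa>K[of M] ed by auto
      then obtain q where q: "q 0 = g (real M * h)" "q h = g (real M * h) + h *\<^sub>R slope g h M" "fast_energy \<phi> d e 0 h q \<le> ennreal (h * E M + \<eta>)"
        using K(2)[of e M d "g (real M * h)"] ed by blast
      let ?w = "concat_path (real M * h) u q"
      have "fast_energy \<phi> d e 0 (real M * h + h) ?w = fast_energy \<phi> d e 0 (real M * h) u + fast_energy \<phi> d e 0 h q"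
        using h u q by (intro fast_energy_concat) auto
      also have "\<dots> \<le> ennreal (\<Sum>i<M. h * E i + \<eta>) + ennreal (h * E M + \<eta>)" by (intro add_mono u q)
      also have "\<dots> = ennreal (\<Sum>i<Suc M. h * E i + \<eta>)"
        using h \<eta> E0 by (subst ennreal_plus[symmetric]) (auto intro!: sum_nonneg)
      also have "real M * h + h = real (Suc M) * h" by (simp add: algebra_simps)
      finally have "fast_energy \<phi> d e 0 (real (Suc M) * h) ?w \<le> ennreal (\<Sum>i<Suc M. h * E i + \<eta>)" .
      moreover have "?w (real i * h) = g (real i * h)" if "i \<le> Suc M" for i
      proof (cases "i = Suc M")
        case True
        have "\<not> real (Suc M) * h \<le> real M * h" "real (Suc M) * h - real M * h = h" using h by (auto simp: algebra_simps)
        then show ?thesis unfolding True concat_path_def using q(2) by (simp add: scaleR_slope[OF h(1)])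
      next
        case False
        then have "i \<le> M" using that by simp
        then have "real i * h \<le> real M * h" using h by (intro mult_right_mono) auto
        then show ?thesis using u(2) \<open>i \<le> M\<close> by (simp add: concat_path_def)
      qed
      ultimately show ?case by blast
    qed
    from this[of N] obtain u where u: "fast_energy \<phi> d e 0 1 u \<le> ennreal (\<Sum>i<N. h * E i + \<eta>)" "\<forall>i\<le>N. u (real i * h) = g (real i * h)"
      using h by auto
    have "(\<Sum>i<N. h * E i + \<eta>) = (\<Sum>i<N. h * hom_density (slope g h i)) + real N * h * (1 / real N) + real N * h * (1 / real N)"
      by (simp add: E_def \<eta>_def sum.distrib distrib_left)
    also have "\<dots> \<le> \<Lambda> + 2 / real N"
      using slope_sum_le_hom_energy[OF g N] h unfolding \<Lambda>_def by (simp add: h_def)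
    finally have "fast_energy \<phi> d e 0 1 u \<le> ennreal (\<Lambda> + 2 / real N)" using u(1) by (meson ennreal_leI order_trans)
    then show ?thesis using u(2) by (intro exI[of _ u]) (auto simp: h_def)
  qed
  ultimately show thesis by (rule that)
qed

end

text \<open>Both paths are Hoelder continuous, and the nearest common node is at distance at most \<open>1 / N\<close>.\<close>
lemma close_of_equal_nodes:
  assumes "energy 0 1 u \<le> ennreal A" "energy 0 1 g \<le> ennreal B" "0 \<le> A" "0 \<le> B" "N > 0"
    and nodes: "\<And>i. i \<le> N \<Longrightarrow> u (real i / real N) = g (real i / real N)" and t: "t \<in> {0..1}"
  shows "norm (u t - g t) \<le> sqrt (A / real N) + sqrt (B / real N)"
proof -
  define i where "i = nat \<lfloor>t * real N\<rfloor>"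
  have "0 \<le> t * real N" using t by simp
  then have i: "real i \<le> t * real N" "t * real N < real i + 1" unfolding i_def by linarith+
  have "t * real N \<le> 1 * real N" using t by (intro mult_right_mono) auto
  then have "i \<le> N" using i by simp
  define s where "s = real i / real N"
  have s: "s \<le> t" "t - s \<le> 1 / real N" "0 \<le> s" "s \<in> {0..1}"
  proof -
    have N: "0 < real N" using assms(5) by simp
    show "s \<le> t" unfolding s_def using i(1) N by (simp add: pos_divide_le_eq)
    have "(t - s) * real N \<le> 1" using i(2) N by (simp add: s_def left_diff_distrib)
    then show "t - s \<le> 1 / real N" using N by (simp add: pos_le_divide_eq)
    show "0 \<le> s" by (simp add: s_def)
    then show "s \<in> {0..1}" using \<open>s \<le> t\<close> t by simp
  qed
  have est: "norm (f t - f s) \<le> sqrt (K / real N)" if f: "energy 0 1 f \<le> ennreal K" "0 \<le> K" for f :: "real \<Rightarrow> 'a" and K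
  proof -
    have "(norm (f t - f s))\<^sup>2 \<le> \<bar>t - s\<bar> * K" by (rule energy_increment[OF s(4) t f])
    also have "\<dots> \<le> 1 / real N * K" using s f by (intro mult_right_mono) auto
    finally show ?thesis by (simp add: real_le_rsqrt)
  qed
  have "u s = g s" unfolding s_def by (rule nodes[OF \<open>i \<le> N\<close>])
  then have "norm (u t - g t) \<le> norm (u t - u s) + norm (g t - g s)"
    using norm_triangle_ineq4[of "u t - u s" "g t - g s"] by simp
  then show ?thesis using est[OF assms(1,3)] est[OF assms(2,4)] by linarith
qed

section \<open>The Gamma-limit\<close>

lemma L2_tendsto_AE_subsequence:
  assumes us: "\<And>j. us j \<in> L2 T" and u: "u \<in> L2 T" and lim: "L2_tendsto T us u"
  obtains r where "strict_mono (r :: nat \<Rightarrow> nat)" "AE t in lebesgue_on {0..T}. (\<lambda>j. us (r j) t) \<longlonglongrightarrow> u t"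
proof -
  let ?M = "lebesgue_on {0..T}"
  define f where "f j t = (norm (us j t - u t))\<^sup>2" for j t
  have int: "integrable ?M (f j)" for j
    using L2_diff[OF us u, of j] by (simp add: L2_def f_def[abs_def])
  have "(\<integral>\<^sup>+t. ennreal (f j t) \<partial>?M) = ennreal (LINT t|?M. f j t)" for j
    by (rule nn_integral_eq_integral[OF int]) (simp add: f_def)
  then have "(\<lambda>j. ennreal (LINT t|?M. f j t)) \<longlonglongrightarrow> ennreal 0"
    using lim by (simp add: L2_tendsto_def f_def)
  then have "(\<lambda>j. enn2real (ennreal (LINT t|?M. f j t))) \<longlonglongrightarrow> 0" by (rule tendsto_enn2real) simp
  moreover have "0 \<le> (LINT t|?M. f j t)" for j by (rule integral_nonneg_AE) (simp add: f_def)
  ultimately have "(\<lambda>j. LINT t|?M. f j t) \<longlonglongrightarrow> 0" by simp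
  moreover have "norm (f j t) = f j t" for j t by (simp add: f_def)
  ultimately have "(\<lambda>j. LINT t|?M. norm (f j t)) \<longlonglongrightarrow> 0" by simp
  then obtain r where r: "strict_mono (r :: nat \<Rightarrow> nat)" "AE t in ?M. (\<lambda>n. f (r n) t) \<longlonglongrightarrow> 0"
    using tendsto_L1_AE_subseq[of _ f, OF int] by blast
  from r(2) have "AE t in ?M. (\<lambda>j. us (r j) t) \<longlonglongrightarrow> u t"
  proof eventually_elim
    case (elim t)
    have "(\<lambda>n. sqrt (f (r n) t)) \<longlonglongrightarrow> sqrt 0" by (intro tendsto_intros elim)
    then have "(\<lambda>n. norm (us (r n) t - u t)) \<longlonglongrightarrow> 0" by (simp add: f_def)
    then show ?case by (simp add: tendsto_norm_zero_iff LIM_zero_iff)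
  qed
  with r(1) show thesis by (rule that)
qed

lemma H1_AE_cong:
  fixes u g :: "real \<Rightarrow> 'a::euclidean_space"
  assumes "g \<in> H1 T" "u \<in> L2 T" "AE t in lebesgue_on {0..T}. g t = u t"
  shows "u \<in> H1 T"
proof -
  obtain v where v: "v \<in> L2 T" "has_weak_deriv T g v" and g: "g \<in> L2 T" using assms(1) by (auto simp: H1_def)
  have "(LINT t|lebesgue_on {0..T}. deriv \<eta> t *\<^sub>R u t) = (LINT t|lebesgue_on {0..T}. deriv \<eta> t *\<^sub>R g t)" if \<eta>: "test_function T \<eta>" for \<eta>
    using assms(3) borel_measurable_integrable[OF test_function_integrable(1)[OF \<eta> g]] borel_measurable_integrable[OF test_function_integrable(1)[OF \<eta> assms(2)]]
    by (intro integral_cong_AE) (auto elim: eventually_mono)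
  then have "has_weak_deriv T u v" using v(2) by (simp add: has_weak_deriv_def)
  then show ?thesis using assms(2) v(1) by (auto simp: H1_def)
qed

context level_geometry
begin

text \<open>Convergence at a single point and the energy bound make the continuous representatives \<open>w j\<close>
  uniformly bounded, so a subsequence converges pointwise. The limit is the continuous representative of
  \<open>u\<close>, which in particular belongs to \<open>H1\<close>.\<close>
lemma F_hom_le_of_bounded_sequence:
  assumes e: "\<And>j. e j > 0" "e \<longlonglongrightarrow> 0" and d: "\<And>j. \<delta> (e j) > 0" "(\<lambda>j. e j / \<delta> (e j)) \<longlonglongrightarrow> 0"
    and us: "\<And>j. us j \<in> L2 1" and u: "u \<in> L2 1" and lim: "L2_tendsto 1 us u"
    and \<Lambda>: "\<And>j. F_eps \<phi> \<delta> (e j) (us j) \<le> ennreal \<Lambda>" "0 \<le> \<Lambda>"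
  shows "F_hom \<phi> u \<le> ennreal \<Lambda>"
proof -
  have H1: "us j \<in> H1 1" for j
    using \<Lambda>(1)[of j] by (auto simp: F_eps_def top_unique split: if_splits)
  define w where "w j = cont_rep 1 (us j)" for j
  have w_AE: "AE t in lebesgue_on {0..1}. w j t = us j t" for j
    unfolding w_def using H1_cont_rep(2)[OF _ H1[of j]] by simp
  have fast: "fast_energy \<phi> (\<delta> (e j)) (e j) 0 1 (w j) \<le> ennreal \<Lambda>" for j
    using \<Lambda>(1)[of j] unfolding F_eps_eq[OF Lipschitz e(1) H1] w_def .
  have en: "energy 0 1 (w j) \<le> ennreal \<Lambda>" for j
    using fast[of j] unfolding fast_energy_def by (rule order_trans[rotated]) simp
  obtain r where r: "strict_mono (r :: nat \<Rightarrow> nat)" "AE t in lebesgue_on {0..1}. (\<lambda>j. us (r j) t) \<longlonglongrightarrow> u t"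
    by (rule L2_tendsto_AE_subsequence[OF us u lim])
  have "AE t in lebesgue_on {0..1}. \<forall>j. w j t = us j t" using w_AE by (simp add: AE_all_countable)
  with r(2) have w_lim: "AE t in lebesgue_on {0..1}. (\<lambda>j. w (r j) t) \<longlonglongrightarrow> u t"
    by eventually_elim simp
  have "emeasure (lebesgue_on {0..1::real}) (space (lebesgue_on {0..1})) \<noteq> 0"
    by (simp add: emeasure_restrict_space)
  then have "ae_filter (lebesgue_on {0..1::real}) \<noteq> bot" by (simp add: ae_filter_eq_bot_iff)
  moreover have "AE t in lebesgue_on {0..1}. (\<lambda>j. w (r j) t) \<longlonglongrightarrow> u t \<and> 0 < t \<and> t < 1"
    using w_lim AE_lebesgue_on_interior[of 0 1] by eventually_elim simp
  ultimately obtain t0 where t0: "(\<lambda>j. w (r j) t0) \<longlonglongrightarrow> u t0" "t0 \<in> {0..1}"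
    using eventually_happens' by (metis (mono_tags, lifting) atLeastAtMost_iff less_imp_le)
  obtain B where B: "\<And>j. norm (w (r j) t0) \<le> B"
    using convergent_imp_Bseq[of "\<lambda>j. w (r j) t0"] t0(1) unfolding Bseq_def convergent_def by blast
  have B0: "norm (w (r j) 0) \<le> B + sqrt \<Lambda>" for j
  proof -
    have "(norm (w (r j) t0 - w (r j) 0))\<^sup>2 \<le> \<bar>t0 - 0\<bar> * \<Lambda>"
      using t0(2) \<Lambda>(2) by (intro energy_increment[OF _ _ en]) auto
    also have "\<dots> \<le> 1 * \<Lambda>" using t0(2) \<Lambda>(2) by (intro mult_right_mono) auto
    finally have "norm (w (r j) t0 - w (r j) 0) \<le> sqrt \<Lambda>" by (simp add: real_le_rsqrt)
    then show ?thesis using B[of j] norm_triangle_ineq4[of "w (r j) t0" "w (r j) t0 - w (r j) 0"] by simp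
  qed
  obtain g q where q: "strict_mono (q :: nat \<Rightarrow> nat)" and g: "continuous_on {0..1} g" "\<And>t. t \<in> {0..1} \<Longrightarrow> (\<lambda>n. w (r (q n)) t) \<longlonglongrightarrow> g t"
    using energy_compactness[of 0 1 "\<lambda>j. w (r j)" "B + sqrt \<Lambda>" \<Lambda>] B0 en \<Lambda>(2) by (metis zero_le_one)
  have "energy 0 1 g \<le> ennreal \<Lambda>"
    by (rule energy_lsc[OF g(2), where K = "\<lambda>_. \<Lambda>"]) (use en in auto)
  then have "g \<in> H1_path 1" by (intro finite_energy_imp_H1_path) (auto intro: le_less_trans)
  then have gH1: "g \<in> H1 1" by (simp add: H1_path_def)
  have gu: "AE t in lebesgue_on {0..1}. g t = u t"
    using w_lim AE_lebesgue_on_interior[of 0 1]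
  proof eventually_elim
    case (elim t)
    have "(\<lambda>n. w (r (q n)) t) \<longlonglongrightarrow> u t" using LIMSEQ_subseq_LIMSEQ[OF elim(1) q] by (simp add: o_def)
    moreover have "(\<lambda>n. w (r (q n)) t) \<longlonglongrightarrow> g t" using elim(2) by (intro g(2)) auto
    ultimately show ?case using LIMSEQ_unique by blast
  qed
  have uH1: "u \<in> H1 1" by (rule H1_AE_cong[OF gH1 u gu])
  have pc: "primitive_of 1 (weak_deriv 1 u) (cont_rep 1 u)" by (rule H1_cont_rep(1)[OF _ uH1]) simp
  have "AE t in lebesgue_on {0..1}. g t = cont_rep 1 u t"
    using gu H1_cont_rep(2)[OF _ uH1, simplified] by eventually_elim simp
  then have "g t = cont_rep 1 u t" if "t \<in> {0..1}" for t
    using continuous_AE_eq[OF _ g(1) primitive_continuous[OF pc] _ that] by simp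
  then have pg: "primitive_of 1 (weak_deriv 1 u) g" by (intro primitive_cong[OF _ pc]) auto
  have rq: "strict_mono (\<lambda>n. r (q n))" using r(1) q by (simp add: strict_mono_def)
  have "(\<integral>\<^sup>+t. psi_hom \<phi> (weak_deriv 1 u t) \<partial>lebesgue_on {0..1}) \<le> ennreal \<Lambda>"
  proof (rule hom_energy_le[where e = "\<lambda>n. e (r (q n))" and d = "\<lambda>n. \<delta> (e (r (q n)))" and u = "\<lambda>n. w (r (q n))", OF _ _ _ _ _ _ g(2) pg])
    show "(\<lambda>n. e (r (q n))) \<longlonglongrightarrow> 0" using LIMSEQ_subseq_LIMSEQ[OF e(2) rq] by (simp add: o_def)
    show "(\<lambda>n. e (r (q n)) / \<delta> (e (r (q n)))) \<longlonglongrightarrow> 0" using LIMSEQ_subseq_LIMSEQ[OF d(2) rq] by (simp add: o_def)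
  qed (use e d fast \<Lambda> in auto)
  then show ?thesis using uH1 by (simp add: F_hom_def)
qed

text \<open>If the lower limit is below \<open>y\<close>, then a subsequence has energies below \<open>y\<close>.\<close>
lemma liminf_inequality:
  assumes e: "\<And>j. e j > 0" "e \<longlonglongrightarrow> 0" and d: "\<And>j. \<delta> (e j) > 0" "(\<lambda>j. e j / \<delta> (e j)) \<longlonglongrightarrow> 0"
    and us: "\<And>j. us j \<in> L2 1" and u: "u \<in> L2 1" and lim: "L2_tendsto 1 us u"
  shows "F_hom \<phi> u \<le> liminf (\<lambda>j. F_eps \<phi> \<delta> (e j) (us j))"
proof (rule ccontr)
  assume "\<not> ?thesis"
  then obtain y where y: "liminf (\<lambda>j. F_eps \<phi> \<delta> (e j) (us j)) < y" "y < F_hom \<phi> u"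
    using dense by (auto simp: not_le)
  then obtain \<Lambda> where \<Lambda>: "y = ennreal \<Lambda>" "0 \<le> \<Lambda>" by (cases y) auto
  have "\<not> (\<forall>\<^sub>F j in sequentially. y \<le> F_eps \<phi> \<delta> (e j) (us j))"
    using Liminf_bounded[of y "\<lambda>j. F_eps \<phi> \<delta> (e j) (us j)" sequentially] y(1) by auto
  then have "\<exists>\<^sub>F j in sequentially. F_eps \<phi> \<delta> (e j) (us j) < y" by (simp add: frequently_def not_less)
  then have "infinite {j. F_eps \<phi> \<delta> (e j) (us j) < y}"
    by (simp add: frequently_cofinite flip: cofinite_eq_sequentially)
  then obtain r where r: "strict_mono (r :: nat \<Rightarrow> nat)" "\<And>n. r n \<in> {j. F_eps \<phi> \<delta> (e j) (us j) < y}"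
    using infinite_enumerate by blast
  have "F_hom \<phi> u \<le> ennreal \<Lambda>"
  proof (rule F_hom_le_of_bounded_sequence[where e = "\<lambda>n. e (r n)" and us = "\<lambda>n. us (r n)", OF _ _ _ _ _ u])
    show "(\<lambda>n. e (r n)) \<longlonglongrightarrow> 0" using LIMSEQ_subseq_LIMSEQ[OF e(2) r(1)] by (simp add: o_def)
    show "(\<lambda>n. e (r n) / \<delta> (e (r n))) \<longlonglongrightarrow> 0" using LIMSEQ_subseq_LIMSEQ[OF d(2) r(1)] by (simp add: o_def)
    show "L2_tendsto 1 (\<lambda>n. us (r n)) u"
      using LIMSEQ_subseq_LIMSEQ[OF lim[unfolded L2_tendsto_def] r(1)] by (simp add: L2_tendsto_def o_def)
    show "F_eps \<phi> \<delta> (e (r n)) (us (r n)) \<le> ennreal \<Lambda>" for n using r(2)[of n] \<Lambda> by (auto intro: less_imp_le)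
  qed (use e d us \<Lambda> in auto)
  then show False using y \<Lambda> by simp
qed

text \<open>A diagonal choice among the paths of the previous section: agreement with \<open>g\<close> at more and more nodes
  gives uniform convergence.\<close>
lemma recovery_sequence:
  assumes e: "\<And>j. e j > 0" "e \<longlonglongrightarrow> 0" and d: "\<And>j. \<delta> (e j) > 0" "(\<lambda>j. \<delta> (e j)) \<longlonglongrightarrow> 0" and u: "u \<in> H1 1"
  obtains us where "\<And>j. us j \<in> L2 1" "L2_tendsto 1 us u" "limsup (\<lambda>j. F_eps \<phi> \<delta> (e j) (us j)) \<le> F_hom \<phi> u"
proof -
  define v where "v = weak_deriv 1 u"
  define g where "g = cont_rep 1 u"
  have g: "primitive_of 1 v g" "AE t in lebesgue_on {0..1}. g t = u t"
    unfolding v_def g_def using H1_cont_rep[OF _ u] by simp_all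
  define \<Lambda> where "\<Lambda> = integral {0..1} (\<lambda>x. hom_density (v x))"
  have \<Lambda>0: "0 \<le> \<Lambda>"
    unfolding \<Lambda>_def by (intro integral_nonneg hom_density_integrable[OF primitive_L2[OF g(1)]] hom_density_nonneg)
  have F: "F_hom \<phi> u = ennreal \<Lambda>"
  proof -
    have "(\<lambda>t. hom_density (v t)) absolutely_integrable_on {0..1}"
      using hom_density_integrable[OF primitive_L2[OF g(1)]] hom_density_nonneg
      by (intro nonnegative_absolutely_integrable_1) auto
    then have i: "integrable (lebesgue_on {0..1}) (\<lambda>t. hom_density (v t))" by (simp add: integrable_lebesgue_on_iff)
    have "F_hom \<phi> u = (\<integral>\<^sup>+t. ennreal (hom_density (v t)) \<partial>lebesgue_on {0..1})"
      using u by (simp add: F_hom_def psi_hom_eq v_def)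
    also have "\<dots> = ennreal \<Lambda>"
      unfolding \<Lambda>_def using hom_density_nonneg
      by (subst nn_integral_eq_integral[OF i]) (auto simp: lebesgue_integral_eq_integral[OF i])
    finally show ?thesis .
  qed
  obtain B where B: "energy 0 1 g = ennreal B" "0 \<le> B"
    using primitive_finite_energy[OF g(1)] by (cases "energy 0 1 g") auto
  have "\<exists>\<kappa>>0. \<forall>e d. 0 < e \<longrightarrow> e < \<kappa> \<longrightarrow> 0 < d \<longrightarrow> d < \<kappa> \<longrightarrow>
    (\<exists>w. fast_energy \<phi> d e 0 1 w \<le> ennreal (\<Lambda> + 2 / real (Suc n)) \<and> (\<forall>i\<le>Suc n. w (real i / real (Suc n)) = g (real i / real (Suc n))))" for n
    using recovery_path[OF g(1), of "Suc n"] unfolding \<Lambda>_def by (metis zero_less_Suc)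
  then obtain \<kappa> where \<kappa>: "\<And>n. \<kappa> n > 0" "\<And>n e d. 0 < e \<Longrightarrow> e < \<kappa> n \<Longrightarrow> 0 < d \<Longrightarrow> d < \<kappa> n \<Longrightarrow>
    \<exists>w. fast_energy \<phi> d e 0 1 w \<le> ennreal (\<Lambda> + 2 / real (Suc n)) \<and> (\<forall>i\<le>Suc n. w (real i / real (Suc n)) = g (real i / real (Suc n)))"
    by metis
  \<comment> \<open>For each \<open>j\<close> the finest partition that is allowed by the size of \<open>e j\<close> and \<open>\<delta> (e j)\<close>; the bound
    \<open>n < j\<close> makes it exist. For the finitely many \<open>j\<close> without any, \<open>g\<close> itself is used.\<close>
  define ok where "ok j n \<longleftrightarrow> n < j \<and> e j < \<kappa> n \<and> \<delta> (e j) < \<kappa> n" for j n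
  define m where "m j = Max {n. ok j n}" for j
  have fin: "finite {n. ok j n}" for j by (rule finite_subset[of _ "{..<j}"]) (auto simp: ok_def)
  have ev_ok: "\<forall>\<^sub>F j in sequentially. ok j n" for n
    using order_tendstoD(2)[OF e(2) \<kappa>(1)[of n]] order_tendstoD(2)[OF d(2) \<kappa>(1)[of n]] eventually_gt_at_top[of n]
    by eventually_elim (simp add: ok_def)
  have ok_m: "ok j (m j)" "n \<le> m j" if "ok j n" for j n
    unfolding m_def using Max_in[OF fin[of j]] Max_ge[OF fin[of j]] that by auto
  have m_lim: "filterlim m at_top sequentially"
    unfolding filterlim_at_top
  proof
    fix n show "\<forall>\<^sub>F j in sequentially. n \<le> m j" using ev_ok[of n] by eventually_elim (rule ok_m(2))
  qed
  have "\<exists>w. ok j (m j) \<longrightarrow> fast_energy \<phi> (\<delta> (e j)) (e j) 0 1 w \<le> ennreal (\<Lambda> + 2 / real (Suc (m j))) \<and>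
      (\<forall>i\<le>Suc (m j). w (real i / real (Suc (m j))) = g (real i / real (Suc (m j))))" for j
    using \<kappa>(2)[of "e j" "m j" "\<delta> (e j)"] e(1) d(1) by (auto simp: ok_def)
  then obtain w where w: "\<And>j. ok j (m j) \<Longrightarrow> fast_energy \<phi> (\<delta> (e j)) (e j) 0 1 (w j) \<le> ennreal (\<Lambda> + 2 / real (Suc (m j)))"
      "\<And>j i. ok j (m j) \<Longrightarrow> i \<le> Suc (m j) \<Longrightarrow> w j (real i / real (Suc (m j))) = g (real i / real (Suc (m j)))" by metis
  define us where "us j = (if ok j (m j) then w j else g)" for j
  have gH1: "g \<in> H1_path 1" using B by (intro finite_energy_imp_H1_path) auto
  have en_w: "energy 0 1 (w j) \<le> ennreal (\<Lambda> + 2 / real (Suc (m j)))" if "ok j (m j)" for j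
    using w(1)[OF that] unfolding fast_energy_def by (rule order_trans[rotated]) simp
  have us_H1: "us j \<in> H1 1" for j
  proof (cases "ok j (m j)")
    case True
    then have "w j \<in> H1_path 1" using en_w[OF True] by (intro finite_energy_imp_H1_path) (auto intro: le_less_trans)
    then show ?thesis using True by (simp add: us_def H1_path_def)
  next
    case False
    then show ?thesis using gH1 by (simp add: us_def H1_path_def)
  qed
  have recip: "(\<lambda>j. 1 / real (Suc (m j))) \<longlonglongrightarrow> 0"
    using filterlim_compose[OF LIMSEQ_inverse_real_of_nat m_lim] by (simp add: inverse_eq_divide)
  have ev_m: "\<forall>\<^sub>F j in sequentially. ok j (m j)" using ev_ok[of 0] by eventually_elim (rule ok_m(1))
  define c where "c j = (sqrt ((\<Lambda> + 2) * (1 / real (Suc (m j)))) + sqrt (B * (1 / real (Suc (m j)))))\<^sup>2" for j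
  have "(\<lambda>j. ennreal (c j)) \<longlonglongrightarrow> ennreal ((sqrt ((\<Lambda> + 2) * 0) + sqrt (B * 0))\<^sup>2)"
    unfolding c_def by (intro tendsto_ennrealI tendsto_intros recip)
  then have c: "(\<lambda>j. ennreal (c j)) \<longlonglongrightarrow> 0" by simp
  have "L2_tendsto 1 us u"
    unfolding L2_tendsto_def
  proof (rule tendsto_sandwich[OF _ _ tendsto_const c])
    show "\<forall>\<^sub>F j in sequentially. (\<integral>\<^sup>+t. ennreal ((norm (us j t - u t))\<^sup>2) \<partial>lebesgue_on {0..1}) \<le> ennreal (c j)"
      using ev_m
    proof eventually_elim
      case (elim j)
      have close: "norm (w j t - g t) \<le> sqrt ((\<Lambda> + 2) * (1 / real (Suc (m j)))) + sqrt (B * (1 / real (Suc (m j))))" if t: "t \<in> {0..1}" for t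
      proof -
        have "2 / real (Suc (m j)) \<le> 2" by (simp add: divide_le_eq)
        then have "energy 0 1 (w j) \<le> ennreal (\<Lambda> + 2)"
          by (intro order_trans[OF en_w[OF elim]] ennreal_leI) auto
        then have "norm (w j t - g t) \<le> sqrt ((\<Lambda> + 2) / real (Suc (m j))) + sqrt (B / real (Suc (m j)))"
          using B \<Lambda>0 w(2)[OF elim] t by (intro close_of_equal_nodes) auto
        then show ?thesis by simp
      qed
      have "(\<integral>\<^sup>+t. ennreal ((norm (us j t - u t))\<^sup>2) \<partial>lebesgue_on {0..1}) \<le> (\<integral>\<^sup>+t. ennreal (c j) \<partial>lebesgue_on {0..1::real})"
      proof (rule nn_integral_mono_AE, use g(2) AE_lebesgue_on_interior[of 0 1] in eventually_elim)
        case (elim t)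
        have "norm (us j t - u t) = norm (w j t - g t)" using elim \<open>ok j (m j)\<close> by (simp add: us_def)
        then show ?case unfolding c_def using close[of t] elim by (intro ennreal_leI power_mono) auto
      qed
      also have "\<dots> = ennreal (c j)" by (simp add: emeasure_restrict_space)
      finally show ?case .
    qed
  qed simp
  moreover have "limsup (\<lambda>j. F_eps \<phi> \<delta> (e j) (us j)) \<le> F_hom \<phi> u"
  proof -
    have "limsup (\<lambda>j. F_eps \<phi> \<delta> (e j) (us j)) \<le> limsup (\<lambda>j. ennreal (\<Lambda> + 2 * (1 / real (Suc (m j)))))"
    proof (rule Limsup_mono, use ev_m in eventually_elim)
      case (elim j)
      have "energy 0 1 (w j) < \<infinity>" using en_w[OF elim] by (auto intro: le_less_trans)
      then have "F_eps \<phi> \<delta> (e j) (w j) = fast_energy \<phi> (\<delta> (e j)) (e j) 0 1 (w j)" by (rule F_eps_path(2)[OF Lipschitz e(1)])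
      then show ?case using w(1)[OF elim] elim by (simp add: us_def)
    qed
    also have "\<dots> = ennreal (\<Lambda> + 2 * 0)"
      by (intro lim_imp_Limsup tendsto_ennrealI tendsto_intros recip) simp
    finally show ?thesis by (simp add: F)
  qed
  ultimately show thesis using us_H1 by (intro that[of us]) (auto simp: H1_def)
qed

end

lemma positive_null_sequence_at_right:
  fixes e :: "nat \<Rightarrow> real"
  assumes "\<And>j. e j > 0" "e \<longlonglongrightarrow> 0"
  shows "filterlim e (at_right 0) sequentially"
proof -
  have "e j \<in> {0<..} \<and> e j \<noteq> 0" for j using assms(1)[of j] by simp
  then show ?thesis using assms(2) by (simp add: filterlim_at)
qed

theorem theorem2p6:
  fixes \<phi> :: "real^'m \<Rightarrow> real^'n" and \<delta> :: "real \<Rightarrow> real"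
  assumes "one_periodic \<phi>"
    and "\<exists>L. L-lipschitz_on UNIV \<phi>"
    and "geometrically_stable \<phi>"
    and "controlled_length \<phi>"
    and "nondegenerate_levels \<phi>"
    and "\<And>\<epsilon>. \<epsilon> > 0 \<Longrightarrow> \<delta> \<epsilon> > 0"
    and "(\<delta> \<longlongrightarrow> 0) (at_right 0)"
    and "filterlim (\<lambda>\<epsilon>. \<delta> \<epsilon> / \<epsilon>) at_top (at_right 0)"
  shows "(\<forall>z\<in>range \<phi>. \<forall>w. ((\<lambda>T. psi_z \<phi> z T w) \<longlongrightarrow> psi_hom_z \<phi> z w) at_top) \<and>
    (\<forall>w. \<exists>z\<in>range \<phi>. psi_hom_z \<phi> z w = (INF z'\<in>range \<phi>. psi_hom_z \<phi> z' w)) \<and>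
    (\<forall>u\<in>L2 1. has_gamma_limit_at (F_eps \<phi> \<delta>) u (F_hom \<phi> u))"
proof -
  obtain L where L: "L-lipschitz_on UNIV \<phi>" using assms(2) by blast
  interpret level_geometry \<phi> L
    by unfold_locales (use assms L in auto)
  have "has_gamma_limit_at (F_eps \<phi> \<delta>) u (F_hom \<phi> u)" if u: "u \<in> L2 1" for u
    unfolding has_gamma_limit_at_def
  proof (intro allI impI conjI, goal_cases)
    case (1 e us)
    then have e: "\<And>j. e j > 0" "e \<longlonglongrightarrow> 0" by auto
    then have "filterlim e (at_right 0) sequentially" by (rule positive_null_sequence_at_right)
    then have "filterlim (\<lambda>j. \<delta> (e j) / e j) at_top sequentially" by (rule filterlim_compose[OF assms(8)])
    then have "(\<lambda>j. inverse (\<delta> (e j) / e j)) \<longlonglongrightarrow> 0" by (rule tendsto_inverse_0_at_top)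
    then have "(\<lambda>j. e j / \<delta> (e j)) \<longlonglongrightarrow> 0" by simp
    then show ?case using 1 u assms(6) by (intro liminf_inequality e) auto
  next
    case (2 e)
    then have e: "\<And>j. e j > 0" "e \<longlonglongrightarrow> 0" by auto
    then have "filterlim e (at_right 0) sequentially" by (rule positive_null_sequence_at_right)
    then have d: "(\<lambda>j. \<delta> (e j)) \<longlonglongrightarrow> 0" by (rule filterlim_compose[OF assms(7)])
    show ?case
    proof (cases "u \<in> H1 1")
      case True
      obtain us where "\<And>j. us j \<in> L2 1" "L2_tendsto 1 us u" "limsup (\<lambda>j. F_eps \<phi> \<delta> (e j) (us j)) \<le> F_hom \<phi> u"
        using recovery_sequence[where \<delta> = \<delta>, OF e assms(6)[OF e(1)] d True] by metis
      then show ?thesis by blast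
    next
      case False
      \<comment> \<open>Every sequence is a recovery sequence here, for instance the constant one.\<close>
      then have "F_hom \<phi> u = \<infinity>" by (simp add: F_hom_def)
      then show ?thesis using u by (intro exI[of _ "\<lambda>_. u"]) (simp add: L2_tendsto_def)
    qed
  qed
  then show ?thesis using psi_z_tendsto psi_hom_z_attained by blast
qed

end
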